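(* Let $A\in GL_n(\mathbb{R})$ with real Jordan form $J$. The following statements are equivalent. (1) For every full-rank lattice $\Gamma\subset\mathbb{R}^n$, there exists a $(J,\Gamma)$ orthonormal wavelet of order $\infty$. (2) There exists an $(A,\mathbb{Z}^n)$ orthonormal wavelet of order $\infty$. (3) For every full-rank lattice $\Gamma\subset\mathbb{R}^n$, there exists an $(A,\Gamma)$ orthonormal wavelet of order $\infty$. (4) There exists a non-zero $(A,\mathbb{Z}^n)$ Bessel wavelet of order $1$. (5) $J$ is not orthogonal. (6) The matrix $A$ is not similar (over $M_n(\mathbb{C})$) to a unitary matrix.
   Context: Let $A\in GL_n(\mathbb{R})$, let $\Gamma\subset\mathbb{R}^n$ be a full-rank lattice (i.e. $\Gamma=B\mathbb{Z}^n$ for some invertible real matrix $B$), and let $N\in\mathbb{N}\cup\{\infty\}$. An $(A,\Gamma)$ orthonormal (resp. Bessel) wavelet of order $N$ is a collection $\{\psi^i\}_{i=1}^N$ of functions in $L^2(\mathbb{R}^n)$ (a sequence $\psi^1,\psi^2,\dots$ if $N=\infty$) such that the system $\{|\det A|^{j/2}\psi^i(A^j\,\cdot\,+k): j\in\mathbb{Z},\ k\in\Gamma,\ i=1,\dots,N\}$ is an orthonormal basis of $L^2(\mathbb{R}^n)$ (resp. a Bessel system, i.e. there is a constant $C<\infty$ such that the sum of $|\langle f,g\rangle|^2$ over all members $g$ of the system is at most $C\|f\|^2$ for all $f\in L^2(\mathbb{R}^n)$). Real Jordan form: a block diagonal real matrix similar to $A$ over $\mathbb{R}$, in which a block corresponding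 to a real eigenvalue $\alpha$ has $\alpha$ on the diagonal, $1$ on the superdiagonal and $0$ elsewhere, and a block corresponding to a pair of complex eigenvalues $\alpha\pm i\beta$, $\beta\neq0$, is a block upper triangular matrix made of $2\times2$ blocks with $\begin{pmatrix}\alpha&\beta\\-\beta&\alpha\end{pmatrix}$ on the block diagonal, $I_2$ on the block superdiagonal, and $0$ elsewhere. *)

theory Defs
  imports "HOL-Analysis.Analysis"
begin

subsection \<open>Similarity, unitary matrices, integer powers\<close>

definition similar_matrix :: "'a::semiring_1^'n^'n \<Rightarrow> 'a^'n^'n \<Rightarrow> bool" where
  "similar_matrix A B \<longleftrightarrow> (\<exists>P. invertible P \<and> A = P ** B ** matrix_inv P)"

definition unitary_matrix :: "complex^'n^'n \<Rightarrow> bool" where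
  "unitary_matrix U \<longleftrightarrow>
     transpose (map_matrix cnj U) ** U = mat 1 \<and> U ** transpose (map_matrix cnj U) = mat 1"

(* The power operator of the library is not the matrix power on this type. *)
definition matrix_powi :: "real^'n^'n \<Rightarrow> int \<Rightarrow> real^'n^'n" where
  "matrix_powi A j =
     (if j \<ge> 0 then (((**) A) ^^ nat j) (mat 1)
      else (((**) (matrix_inv A)) ^^ nat (- j)) (mat 1))"


subsection \<open>Real Jordan form\<close>

(* Real_Block m a: the m x m block of a real eigenvalue a.
   Complex_Block m a b: the 2m x 2m block of the eigenvalues a + ib and a - ib. *)
datatype jordan_cell = Real_Block nat real | Complex_Block nat real real

fun proper_cell :: "jordan_cell \<Rightarrow> bool" where
  "proper_cell (Real_Block m a) \<longleftrightarrow> m > 0"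
| "proper_cell (Complex_Block m a b) \<longleftrightarrow> m > 0 \<and> b \<noteq> 0"

fun cell_size :: "jordan_cell \<Rightarrow> nat" where
  "cell_size (Real_Block m a) = m"
| "cell_size (Complex_Block m a b) = 2 * m"

(* Entry in row r and column c, both counted from 0. In a Complex_Block, (r div 2, c div 2) is
   the position of the 2 x 2 sub-block and (r mod 2, c mod 2) the position inside it. *)
fun cell_entry :: "jordan_cell \<Rightarrow> nat \<Rightarrow> nat \<Rightarrow> real" where
  "cell_entry (Real_Block m a) r c = (if c = r then a else if c = Suc r then 1 else 0)"
| "cell_entry (Complex_Block m a b) r c =
     (if c div 2 = r div 2 then
        (if c = r then a else if r < c then b else - b)
      else if c div 2 = Suc (r div 2) \<and> c mod 2 = r mod 2 then 1
      else 0)"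

fun block_diag_entry :: "jordan_cell list \<Rightarrow> nat \<Rightarrow> nat \<Rightarrow> real" where
  "block_diag_entry [] r c = 0"
| "block_diag_entry (B # Bs) r c =
     (if r < cell_size B \<and> c < cell_size B then cell_entry B r c
      else if cell_size B \<le> r \<and> cell_size B \<le> c
      then block_diag_entry Bs (r - cell_size B) (c - cell_size B)
      else 0)"

(* The index type carries no order, so the rows and columns are numbered by a bijection e
   from {0, ..., n - 1}, the same one for rows and columns. *)
definition real_jordan_matrix :: "real^'n^'n \<Rightarrow> bool" where
  "real_jordan_matrix J \<longleftrightarrow>
     (\<exists>(e :: nat \<Rightarrow> 'n) Bs.
        bij_betw e {..<CARD('n)} UNIV \<and>
        (\<forall>B \<in> set Bs. proper_cell B) \<and>
        sum_list (map cell_size Bs) = CARD('n) \<and>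
        (\<forall>r < CARD('n). \<forall>c < CARD('n). J $ e r $ e c = block_diag_entry Bs r c))"

definition real_jordan_form :: "real^'n^'n \<Rightarrow> real^'n^'n \<Rightarrow> bool" where
  "real_jordan_form A J \<longleftrightarrow> real_jordan_matrix J \<and> similar_matrix A J"


subsection \<open>Lattices\<close>

definition integer_lattice :: "(real^'n) set" where
  "integer_lattice = {k. \<forall>i. k $ i \<in> \<int>}"

definition full_rank_lattice :: "(real^'n) set \<Rightarrow> bool" where
  "full_rank_lattice \<Gamma> \<longleftrightarrow>
     (\<exists>B :: real^'n^'n. invertible B \<and> \<Gamma> = (\<lambda>k. B *v k) ` integer_lattice)"


subsection \<open>The Hilbert space of square-integrable functions\<close>

(* Elements of the Hilbert space are represented by functions; equality in it is
   almost-everywhere equality. *)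
definition L2_space :: "(real^'n \<Rightarrow> complex) set" where
  "L2_space = {f. f \<in> borel_measurable lebesgue \<and> integrable lebesgue (\<lambda>x. (cmod (f x))\<^sup>2)}"

definition L2_inner :: "(real^'n \<Rightarrow> complex) \<Rightarrow> (real^'n \<Rightarrow> complex) \<Rightarrow> complex" where
  "L2_inner f g = (LINT x|lebesgue. f x * cnj (g x))"

definition L2_norm :: "(real^'n \<Rightarrow> complex) \<Rightarrow> real" where
  "L2_norm f = sqrt (LINT x|lebesgue. (cmod (f x))\<^sup>2)"

(* Systems are indexed families: distinct indices count as distinct members, even if the
   corresponding functions coincide. *)
definition L2_orthonormal_basis :: "'i set \<Rightarrow> ('i \<Rightarrow> real^'n \<Rightarrow> complex) \<Rightarrow> bool" where
  "L2_orthonormal_basis I g \<longleftrightarrow>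
     (\<forall>p \<in> I. g p \<in> L2_space) \<and>
     (\<forall>p \<in> I. \<forall>q \<in> I. L2_inner (g p) (g q) = (if p = q then 1 else 0)) \<and>
     (\<forall>f \<in> L2_space. \<forall>\<epsilon> > 0. \<exists>F c. finite F \<and> F \<subseteq> I \<and>
        L2_norm (\<lambda>x. f x - (\<Sum>p \<in> F. c p * g p x)) < \<epsilon>)"

definition L2_bessel_system :: "'i set \<Rightarrow> ('i \<Rightarrow> real^'n \<Rightarrow> complex) \<Rightarrow> bool" where
  "L2_bessel_system I g \<longleftrightarrow>
     (\<forall>p \<in> I. g p \<in> L2_space) \<and>
     (\<exists>C :: real. \<forall>f \<in> L2_space.
        (\<lambda>p. (cmod (L2_inner f (g p)))\<^sup>2) summable_on I \<and>
        (\<Sum>\<^sub>\<infinity>p\<in>I. (cmod (L2_inner f (g p)))\<^sup>2) \<le> C * (L2_norm f)\<^sup>2)"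


subsection \<open>Wavelets\<close>

(* The generators are numbered from 0, so order N means the indices i < N. *)
definition wavelet_index :: "(real^'n) set \<Rightarrow> enat \<Rightarrow> (int \<times> (real^'n) \<times> nat) set" where
  "wavelet_index \<Gamma> N = UNIV \<times> \<Gamma> \<times> {i. enat i < N}"

definition wavelet_system ::
    "real^'n^'n \<Rightarrow> (nat \<Rightarrow> real^'n \<Rightarrow> complex) \<Rightarrow> int \<times> (real^'n) \<times> nat \<Rightarrow> real^'n \<Rightarrow> complex" where
  "wavelet_system A \<psi> = (\<lambda>(j, k, i) x.
     of_real (\<bar>det A\<bar> powr (real_of_int j / 2)) * \<psi> i (matrix_powi A j *v x + k))"

definition orthonormal_wavelet ::
    "real^'n^'n \<Rightarrow> (real^'n) set \<Rightarrow> enat \<Rightarrow> (nat \<Rightarrow> real^'n \<Rightarrow> complex) \<Rightarrow> bool" where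
  "orthonormal_wavelet A \<Gamma> N \<psi> \<longleftrightarrow>
     (\<forall>i. enat i < N \<longrightarrow> \<psi> i \<in> L2_space) \<and>
     L2_orthonormal_basis (wavelet_index \<Gamma> N) (wavelet_system A \<psi>)"

definition bessel_wavelet ::
    "real^'n^'n \<Rightarrow> (real^'n) set \<Rightarrow> enat \<Rightarrow> (nat \<Rightarrow> real^'n \<Rightarrow> complex) \<Rightarrow> bool" where
  "bessel_wavelet A \<Gamma> N \<psi> \<longleftrightarrow>
     (\<forall>i. enat i < N \<longrightarrow> \<psi> i \<in> L2_space) \<and>
     L2_bessel_system (wavelet_index \<Gamma> N) (wavelet_system A \<psi>)"

end

theory Submission
  imports Defs "HOL-Real_Asymp.Real_Asymp"
begin

text \<open>
  The existence direction works on the Fourier side. If \<open>J\<close> is not orthogonal, then \<open>J\<^sup>T\<close> acts as a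
  unit translation \<open>u \<mapsto> u \<plusminus> 1\<close> on a function \<open>u\<close> defined almost everywhere: for an eigenfunctional
  \<open>\<lambda>\<close> with eigenvalue \<open>\<alpha>\<close> off the unit circle take \<open>u = ln \<bar>\<lambda>\<bar> / \<bar>ln \<bar>\<alpha>\<bar>\<bar>\<close>, and for a Jordan chain
  \<open>\<mu>, \<lambda>\<close> with \<open>\<bar>\<alpha>\<bar> = 1\<close> take \<open>u = Re (\<alpha> \<mu> / \<lambda>)\<close>. Pulling back a set of reals that tiles by integer
  translations gives a set \<open>W\<close> whose dilates tile space and which can be made to contain arbitrarily
  large balls. Hence every point has infinitely many lattice translates in \<open>W\<close>, so \<open>W\<close> splits into
  countably many fundamental domains \<open>K\<^sub>i\<close> of the lattice; the exponentials restricted to the dilates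
  of the \<open>K\<^sub>i\<close> form an orthonormal basis, and the wavelets are the Fourier transforms of the
  indicators of the \<open>K\<^sub>i\<close>. Plancherel's theorem is obtained by integrating Parseval's identity for
  Fourier series on a cube over all shifts of the frequency lattice.

  Conversely, if \<open>A\<close> is similar to a unitary matrix, then its powers are bounded, so the powers \<open>A\<close> to
  the \<open>-r\<close> converge along a subsequence. Testing the Bessel bound against a fixed function composed
  with the inverse of the limit gives a null sequence that also converges to a nonzero multiple of the
  inner product of that function with \<open>\<psi>\<close>; hence \<open>\<psi>\<close> is orthogonal to all test functions.
\<close>

subsection \<open>Linear changes of variables\<close>

text \<open>When |det A| = 1, the dilations preserve volume and any two dilation tiles have the same
  measure, so the size of a tile cannot be adjusted. Infinite order removes this obstacle: the tile
  may have infinite measure, because it is cut into countably many pieces of measure 1. What is then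
  required is that every lattice coset meets it infinitely often. Large balls are a convenient
  sufficient condition, since they survive every linear change of coordinates. This also disposes of
  the lattice: B Z^n with the matrix A becomes Z^n with the conjugate of A by B, which is still
  similar to J. Transposes appear because the Fourier transform turns composition with a matrix into
  composition with its inverse transpose, so the wavelets for A come from a tile for the transpose
  of A. No linear algebra proves that a non-orthogonal J excludes similarity to a unitary matrix:
  the existence of wavelets, which bounded powers forbid, gives it. The return from (6) to (5) is
  plain complexification of a real similarity.\<close>

lemma shear_image_measure:
  fixes l u :: "real^'n"
  assumes "m \<noteq> k"
  shows "emeasure lborel ((\<lambda>x. \<chi> i. if i = m then x$m + x$k else x$i) ` box l u) = emeasure lborel (box l u)"
proof (cases "box l u = {}")
  case False
  let ?f = "\<lambda>x::real^'n. \<chi> i. if i = m then x$m + x$k else x$i"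
  have lin: "linear ?f"
    by (rule linearI) (auto simp: plus_vec_def scaleR_vec_def algebra_simps)
  \<comment> \<open>Moves the lower corner of the box to the origin: the shear formula for closed
    boxes asks for a nonnegative lower bound in the coordinate that is added on.\<close>
  define t :: "real^'n" where "t = (\<chi> i. - l$i)"
  have box: "cbox (l + t) (u + t) = (+) t ` cbox l u"
    using cbox_translation[of t l u] by (metis add.commute)
  have "cbox l u \<noteq> {}"
    using False box_subset_cbox[of l u] by blast
  then have ne: "cbox (l + t) (u + t) \<noteq> {}"
    by (simp add: box)
  have "measure lebesgue (?f ` cbox (l + t) (u + t)) = measure lebesgue (cbox (l + t) (u + t))"
    by (rule measure_shear_interval) (use assms ne in \<open>auto simp: t_def\<close>)
  moreover have "?f ` cbox (l + t) (u + t) = (+) (?f t) ` ?f ` cbox l u"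
    unfolding box image_image by (intro image_cong) (auto simp: vec_eq_iff)
  ultimately have 1: "measure lebesgue (?f ` cbox l u) = measure lebesgue (cbox l u)"
    by (simp add: measure_translation box)
  have fc: "?f ` cbox l u \<in> lmeasurable"
    by (rule measurable_linear_image_interval[OF lin])
  \<comment> \<open>The shear formula concerns closed boxes, whereas Lebesgue measure is
    characterized below on open ones; the difference is the image of the boundary.\<close>
  have neg: "negligible (?f ` (cbox l u - box l u))"
    using lin by (intro negligible_differentiable_image_negligible)
      (auto simp: negligible_frontier_interval intro: linear_imp_differentiable_on)
  have inj: "inj ?f"
  proof (rule injI)
    fix x y assume e: "?f x = ?f y"
    have "x$i = y$i" for i
    proof (cases "i = m")
      case True
      have "(?f x)$m = (?f y)$m" "(?f x)$k = (?f y)$k" using e by simp_all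
      with assms True show ?thesis by simp
    next
      case False
      have "(?f x)$i = (?f y)$i" using e by simp
      with False show ?thesis by simp
    qed
    then show "x = y" by (simp add: vec_eq_iff)
  qed
  have eq: "?f ` box l u = ?f ` cbox l u - ?f ` (cbox l u - box l u)"
    using box_subset_cbox[of l u] inj by (auto simp: image_set_diff)
  have meas: "?f ` box l u \<in> lmeasurable"
    unfolding eq by (rule fmeasurable.Diff[OF fc negligible_imp_measurable[OF neg]])
  have "measure lebesgue (?f ` box l u) = measure lebesgue (?f ` cbox l u)"
    unfolding eq
    by (rule measure_Diff_null_set[OF fmeasurableD[OF fc] neg[unfolded negligible_iff_null_sets]])
  with 1 have 2: "measure lebesgue (?f ` box l u) = measure lebesgue (cbox l u)"
    by simp
  have "open (?f ` box l u)"
    using lin inj by (intro open_surjective_linear_image) (auto simp: linear_injective_imp_surjective)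
  then have "emeasure lborel (?f ` box l u) = emeasure lebesgue (?f ` box l u)"
    by simp
  also have "\<dots> = ennreal (measure lebesgue (cbox l u))"
    using meas 2 by (simp add: emeasure_eq_measure2)
  also have "\<dots> = emeasure lborel (box l u)"
    by (simp add: emeasure_lborel_box_eq emeasure_lborel_cbox_eq measure_lborel_cbox_eq)
  finally show ?thesis .
qed simp

text \<open>The product step of the induction over elementary matrices: factors of push-forwards
  multiply just as determinants do.\<close>

lemma lborel_density_distr_compose:
  fixes f g :: "'a::euclidean_space \<Rightarrow> 'a"
  assumes [measurable]: "f \<in> borel \<rightarrow>\<^sub>M borel" "g \<in> borel \<rightarrow>\<^sub>M borel"
    and f: "lborel = density (distr lborel borel f) (\<lambda>_. ennreal a)"
    and g: "lborel = density (distr lborel borel g) (\<lambda>_. ennreal b)"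
    and ab: "a \<ge> 0" "b \<ge> 0"
  shows "lborel = density (distr lborel borel (f \<circ> g)) (\<lambda>_. ennreal (a * b))"
proof (rule measure_eqI)
  fix A :: "'a set" assume "A \<in> sets lborel"
  then have A[measurable]: "A \<in> sets borel" by simp
  have *: "emeasure lborel B = ennreal c * emeasure lborel (h -` B)"
    if "B \<in> sets borel" "h \<in> borel \<rightarrow>\<^sub>M borel" "lborel = density (distr lborel borel h) (\<lambda>_. ennreal c)"
    for B c and h :: "'a \<Rightarrow> 'a"
  proof -
    have "emeasure lborel B = emeasure (density (distr lborel borel h) (\<lambda>_. ennreal c)) B"
      using that(3) by (rule arg_cong)
    also have "\<dots> = ennreal c * emeasure lborel (h -` B)"
      using that(1,2) by (simp add: emeasure_density nn_integral_cmult emeasure_distr)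
    finally show ?thesis .
  qed
  have fA: "f -` A \<in> sets borel"
    using measurable_sets_borel[OF assms(1) A] .
  have "emeasure lborel A = ennreal a * (ennreal b * emeasure lborel (g -` f -` A))"
    using *[OF A assms(1) f] *[OF fA assms(2) g] by simp
  also have "\<dots> = emeasure (density (distr lborel borel (f \<circ> g)) (\<lambda>_. ennreal (a * b))) A"
    using ab by (simp add: emeasure_density nn_integral_cmult emeasure_distr ennreal_mult mult.assoc vimage_comp)
  finally show "emeasure lborel A = emeasure (density (distr lborel borel (f \<circ> g)) (\<lambda>_. ennreal (a * b))) A" .
qed simp

lemma vimage_eq_image_inverse:
  assumes "\<And>x. f (g x) = x" "\<And>x. g (f x) = x"
  shows "g -` B = f ` B"
proof (intro set_eqI iffI)
  fix x assume "x \<in> g -` B"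
  with assms(1)[of x] show "x \<in> f ` B"
    by (metis imageI vimageD)
qed (use assms(2) in auto)

lemma prod_Basis_cart: "(\<Prod>b\<in>(Basis :: (real^'n) set). f b) = (\<Prod>i\<in>UNIV. f (axis i 1))"
proof -
  have B: "(Basis :: (real^'n) set) = range (\<lambda>i. axis i 1)" and inj: "inj (\<lambda>i::'n. axis i (1::real))"
    by (auto simp: Basis_vec_def axis_eq_axis inj_on_def)
  show ?thesis unfolding B prod.reindex[OF inj] o_def ..
qed

lemma emeasure_lborel_box_cart:
  fixes l u :: "real^'n"
  assumes "\<And>i. l $ i \<le> u $ i"
  shows "emeasure lborel (box l u) = ennreal (\<Prod>i\<in>UNIV. u $ i - l $ i)"
proof -
  have "emeasure lborel (box l u) = ennreal (\<Prod>b\<in>Basis. (u - l) \<bullet> b)"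
    by (rule emeasure_lborel_box) (use assms in \<open>auto simp: Basis_vec_def inner_axis\<close>)
  then show ?thesis by (simp add: prod_Basis_cart inner_axis)
qed

text \<open>Serves the coordinate swaps among the elementary matrices. Since \<pi> is an involution,
  the preimage of a box is the box with permuted corners, and the product of the side lengths is
  merely reordered.\<close>

lemma lborel_permute_coordinates:
  fixes \<pi> :: "'n::finite \<Rightarrow> 'n"
  assumes \<pi>: "\<And>i. \<pi> (\<pi> i) = i" and m: "(\<lambda>x::real^'n. \<chi> i. x $ \<pi> i) \<in> borel \<rightarrow>\<^sub>M borel"
  shows "lborel = distr lborel borel (\<lambda>x::real^'n. \<chi> i. x $ \<pi> i)"
proof (rule lborel_eqI)
  fix l u :: "real^'n" assume le: "\<And>b. b \<in> Basis \<Longrightarrow> l \<bullet> b \<le> u \<bullet> b"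
  have le': "l $ i \<le> u $ i" for i
    using le[of "axis i 1"] by (simp add: inner_axis)
  have *: "(\<lambda>x. \<chi> i. x $ \<pi> i) -` box l u = box (\<chi> i. l $ \<pi> i) (\<chi> i. u $ \<pi> i)"
  proof (intro set_eqI iffI)
    fix x assume x: "x \<in> (\<lambda>x. \<chi> i. x $ \<pi> i) -` box l u"
    have "l $ \<pi> i < x $ i \<and> x $ i < u $ \<pi> i" for i
      using x \<pi>[of i] unfolding vimage_eq mem_box_cart vec_lambda_beta by metis
    then show "x \<in> box (\<chi> i. l $ \<pi> i) (\<chi> i. u $ \<pi> i)"
      by (simp add: mem_box_cart)
  next
    fix x assume x: "x \<in> box (\<chi> i. l $ \<pi> i) (\<chi> i. u $ \<pi> i)"
    have "l $ i < x $ \<pi> i \<and> x $ \<pi> i < u $ i" for i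
      using x \<pi>[of i] unfolding mem_box_cart vec_lambda_beta by metis
    then show "x \<in> (\<lambda>x. \<chi> i. x $ \<pi> i) -` box l u"
      by (simp add: mem_box_cart)
  qed
  have "(\<Prod>i\<in>UNIV. u $ \<pi> i - l $ \<pi> i) = (\<Prod>i\<in>UNIV. u $ i - l $ i)"
    by (rule prod.reindex_bij_witness[of _ \<pi> \<pi>]) (auto simp: \<pi>)
  then show "emeasure (distr lborel borel (\<lambda>x::real^'n. \<chi> i. x $ \<pi> i)) (box l u) = ennreal (\<Prod>b\<in>Basis. (u - l) \<bullet> b)"
    using m by (simp add: emeasure_distr * emeasure_lborel_box_cart le' prod_Basis_cart inner_axis)
qed simp

lemma borel_measurable_matrix_vector_mult [measurable]:
  "(\<lambda>x. M *v x) \<in> borel \<rightarrow>\<^sub>M borel" for M :: "real^'m^'n"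
  by (intro borel_measurable_continuous_onI matrix_vector_mult_linear_continuous_on)

text \<open>
  The library formula \<open>measure_linear_image\<close> requires a well-ordered index type, so the determinant
  formula is proved again from elementary matrices.
\<close>

lemma lborel_matrix_vector_mult:
  fixes M :: "real^'n^'n"
  assumes "invertible M"
  shows "lborel = density (distr lborel borel ((*v) M)) (\<lambda>_. ennreal \<bar>det M\<bar>)"
proof -
  have "invertible M \<longrightarrow> lborel = density (distr lborel borel ((*v) M)) (\<lambda>_. ennreal \<bar>det M\<bar>)"
  proof (rule induct_matrix_elementary_alt)
    fix A B :: "real^'n^'n"
    assume A: "invertible A \<longrightarrow> lborel = density (distr lborel borel ((*v) A)) (\<lambda>_. ennreal \<bar>det A\<bar>)"
      and B: "invertible B \<longrightarrow> lborel = density (distr lborel borel ((*v) B)) (\<lambda>_. ennreal \<bar>det B\<bar>)"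
    show "invertible (A ** B) \<longrightarrow> lborel = density (distr lborel borel ((*v) (A ** B))) (\<lambda>_. ennreal \<bar>det (A ** B)\<bar>)"
    proof
      assume "invertible (A ** B)"
      then have "invertible A" "invertible B"
        by (auto simp: invertible_det_nz det_mul)
      with A B have "lborel = density (distr lborel borel ((*v) A \<circ> (*v) B)) (\<lambda>_. ennreal (\<bar>det A\<bar> * \<bar>det B\<bar>))"
        by (intro lborel_density_distr_compose) auto
      then show "lborel = density (distr lborel borel ((*v) (A ** B))) (\<lambda>_. ennreal \<bar>det (A ** B)\<bar>)"
        by (simp add: det_mul abs_mult matrix_vector_mult_matrix_matrix_mult_compose)
    qed
  next
    fix A :: "real^'n^'n" and i assume "row i A = 0"
    then have "det A = 0" by (rule det_zero_row)
    then show "invertible A \<longrightarrow> lborel = density (distr lborel borel ((*v) A)) (\<lambda>_. ennreal \<bar>det A\<bar>)"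
      by (simp add: invertible_det_nz)
  next
    fix A :: "real^'n^'n" assume 0: "\<And>i j. i \<noteq> j \<Longrightarrow> A $ i $ j = 0"
    show "invertible A \<longrightarrow> lborel = density (distr lborel borel ((*v) A)) (\<lambda>_. ennreal \<bar>det A\<bar>)"
    proof
      assume "invertible A"
      have d: "det A = (\<Prod>i\<in>UNIV. A $ i $ i)" by (rule det_diagonal) (use 0 in auto)
      with \<open>invertible A\<close> have nz: "A $ i $ i \<noteq> 0" for i
        by (auto simp: invertible_det_nz)
      define c where "c b = (\<Sum>i\<in>UNIV. A $ i $ i * b $ i)" for b :: "real^'n"
      have c: "c (axis i 1) = A $ i $ i" for i
        by (simp add: c_def axis_def if_distrib cong: if_cong)
      have "A *v x = 0 + (\<Sum>j\<in>Basis. (c j * (x \<bullet> j)) *\<^sub>R j)" for x :: "real^'n"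
      proof -
        have "(\<Sum>j\<in>Basis. (c j * (x \<bullet> j)) *\<^sub>R j) = (\<Sum>i\<in>UNIV. (c (axis i 1) * (x \<bullet> axis i 1)) *\<^sub>R axis i 1)"
          by (rule sum.reindex_bij_witness[of _ "\<lambda>i. axis i 1" "\<lambda>b. SOME i. b = axis i 1"])
             (auto simp: axis_eq_axis Basis_vec_def)
        also have "\<dots> = A *v x"
        proof -
          have "(A *v x) $ i = A $ i $ i * x $ i" for i
            unfolding matrix_vector_mult_def
            by (simp add: sum.remove[of UNIV i] 0)
          then show ?thesis
            by (simp only: vec_eq_iff c inner_axis sum_component vector_scaleR_component)
              (simp add: axis_def if_distrib cong: if_cong)
        qed
        finally show ?thesis by simp
      qed
      then have eq: "(*v) A = (\<lambda>x. 0 + (\<Sum>j\<in>Basis. (c j * (x \<bullet> j)) *\<^sub>R j))" by blast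
      have det: "\<bar>det A\<bar> = (\<Prod>j\<in>Basis. \<bar>c j\<bar>)"
      proof -
        have "(\<Prod>j\<in>Basis. \<bar>c j\<bar>) = (\<Prod>i\<in>UNIV. \<bar>c (axis i 1)\<bar>)"
          by (rule prod.reindex_bij_witness[of _ "\<lambda>i. axis i 1" "\<lambda>b. SOME i. b = axis i 1"])
             (auto simp: axis_eq_axis Basis_vec_def)
        then show ?thesis by (simp add: d c abs_prod)
      qed
      show "lborel = density (distr lborel borel ((*v) A)) (\<lambda>_. ennreal \<bar>det A\<bar>)"
        unfolding eq det
        by (rule lborel_affine_euclidean) (use nz c in \<open>auto simp: Basis_vec_def\<close>)
    qed
  next
    fix m n :: 'n assume mn: "m \<noteq> n"
    define S :: "real^'n^'n" where "S = (\<chi> i j. mat 1 $ i $ Transposition.transpose m n j)"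
    have Sx: "S *v x = (\<chi> i. x $ Transposition.transpose m n i)" for x
    proof -
      have "S $ i $ j = of_bool (j = Transposition.transpose m n i)" for i j
        by (auto simp: S_def mat_def Transposition.transpose_def)
      then show ?thesis
        by (simp add: matrix_vector_mult_def)
    qed
    \<comment> \<open>Only |det S| is wanted, and for an involution it is 1; the sign of the
      transposition never has to be computed.\<close>
    have "S *v (S *v x) = x" for x
      unfolding Sx by (simp add: vec_eq_iff)
    then have "S ** S = mat 1"
      unfolding matrix_eq matrix_vector_mul_assoc[symmetric] by simp
    then have "det S * det S = 1"
      by (metis det_I det_mul)
    then have det: "\<bar>det S\<bar> = 1"
      unfolding power2_eq_square[symmetric] power2_eq_1_iff by auto
    have S_eq: "(*v) S = (\<lambda>x. \<chi> i. x $ Transposition.transpose m n i)"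
      using Sx by blast
    have "lborel = distr lborel borel ((*v) S)"
      unfolding S_eq
      by (rule lborel_permute_coordinates)
         (use borel_measurable_matrix_vector_mult[of S] in \<open>simp_all add: Sx\<close>)
    then have "lborel = density (distr lborel borel ((*v) S)) (\<lambda>_. ennreal \<bar>det S\<bar>)"
      unfolding det ennreal_1 density_1 .
    then show "invertible ((\<chi> i j. mat 1 $ i $ Transposition.transpose m n j) :: real^'n^'n) \<longrightarrow>
        lborel = density (distr lborel borel ((*v) ((\<chi> i j. mat 1 $ i $ Transposition.transpose m n j) :: real^'n^'n)))
          (\<lambda>_. ennreal \<bar>det ((\<chi> i j. mat 1 $ i $ Transposition.transpose m n j) :: real^'n^'n)\<bar>)"
      unfolding S_def by (intro impI)
  next
    fix m n :: 'n assume mn: "m \<noteq> n"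
    let ?A = "(\<chi> i j. of_bool (i = m \<and> j = n \<or> i = j)) :: real^'n^'n"
    let ?f = "\<lambda>x::real^'n. \<chi> i. if i = m then x$m + x$n else x$i"
    let ?g = "\<lambda>x::real^'n. \<chi> i. if i = m then x$m - x$n else x$i"
    have Ax: "?A *v x = ?f x" for x
    proof -
      have "(\<Sum>j\<in>UNIV. of_bool (i = m \<and> j = n \<or> i = j) * x $ j) = (if i = m then x$m + x$n else x$i)" for i
      proof -
        have "(\<Sum>j\<in>UNIV. of_bool (i = m \<and> j = n \<or> i = j) * x $ j)
          = (\<Sum>j\<in>UNIV. (if j = i then x $ j else 0) + (if j = n then (if i = m then x$j else 0) else 0))"
          by (rule sum.cong) (use mn in auto)
        then show ?thesis by (simp add: sum.distrib)
      qed
      then show ?thesis by (simp add: matrix_vector_mult_def)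
    qed
    have A: "?A = (\<chi> k. if k = m then row m (mat 1) + 1 *s row n (mat 1) else row k (mat 1))"
      using mn by (auto simp: vec_eq_iff row_def mat_def)
    have det: "det ?A = 1"
      unfolding A by (subst det_row_operation[OF mn]) simp
    have f_eq: "(*v) ?A = ?f" using Ax by blast
    have fm: "?f \<in> borel \<rightarrow>\<^sub>M borel"
      using borel_measurable_matrix_vector_mult[of ?A] unfolding f_eq .
    have "linear ?g"
      by (rule linearI) (auto simp: plus_vec_def scaleR_vec_def algebra_simps)
    then have g_cont: "continuous_on UNIV ?g"
      by (simp add: linear_continuous_on linear_conv_bounded_linear)
    then have gm: "?g \<in> borel \<rightarrow>\<^sub>M borel"
      by (intro borel_measurable_continuous_onI)
    have fg: "?f (?g x) = x" "?g (?f x) = x" for x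
      using mn by (auto simp: vec_eq_iff)
    \<comment> \<open>The inverse shear comes before the shear: preimages under \<open>?g\<close>
      are images under \<open>?f\<close>, whose measure is known from
      \<open>shear_image_measure\<close>. Pushing the result forward along \<open>?f\<close> then
      gives the claim for \<open>?f\<close>.\<close>
    have "lborel = distr lborel borel ?g"
    proof (rule lborel_eqI)
      fix l u :: "real^'n" assume le: "\<And>b. b \<in> Basis \<Longrightarrow> l \<bullet> b \<le> u \<bullet> b"
      have "?g -` box l u = ?f ` box l u"
        by (rule vimage_eq_image_inverse) (fact fg)+
      then have "emeasure (distr lborel borel ?g) (box l u) = emeasure lborel (box l u)"
        using gm shear_image_measure[OF mn, of l u] by (simp add: emeasure_distr)
      then show "emeasure (distr lborel borel ?g) (box l u) = (\<Prod>b\<in>Basis. (u - l) \<bullet> b)"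
        using le by simp
    qed simp
    from arg_cong[OF this, of "\<lambda>M. distr M borel ?f"]
    have "distr lborel borel ?f = distr lborel borel (?f \<circ> ?g)"
      by (subst (asm) distr_distr) (use fm gm in simp_all)
    also have "?f \<circ> ?g = (\<lambda>x. x)"
      using fg(1) by auto
    also have "distr lborel borel (\<lambda>x::real^'n. x) = lborel"
      by (simp add: distr_id2)
    finally have "lborel = distr lborel borel ?f" ..
    then show "invertible ?A \<longrightarrow> lborel = density (distr lborel borel ((*v) ?A)) (\<lambda>_. ennreal \<bar>det ?A\<bar>)"
      unfolding det f_eq abs_one ennreal_1 density_1 by (intro impI)
  qed
  with assms show ?thesis by blast
qed

text \<open>Passage from Borel to Lebesgue measure. Completion commutes with densities and
  push-forwards once the map respects null sets in both directions, which follows from the Borel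
  formula because its factor is nonzero.\<close>

lemma
  fixes M :: "real^'n^'n"
  assumes M: "invertible M"
  shows lebesgue_matrix_vector_mult:
      "lebesgue = density (distr lebesgue lebesgue ((*v) M)) (\<lambda>_. ennreal \<bar>det M\<bar>)"
    and lebesgue_measurable_matrix_vector_mult: "(*v) M \<in> lebesgue \<rightarrow>\<^sub>M lebesgue"
proof -
  let ?T = "(*v) M"
  have d: "\<bar>det M\<bar> > 0" using M by (simp add: invertible_det_nz)
  { fix A :: "(real^'n) set" assume A: "A \<in> sets borel"
    then have "emeasure lborel A = 0 \<longleftrightarrow> emeasure (density (distr lborel borel ?T) (\<lambda>_. ennreal \<bar>det M\<bar>)) A = 0"
      by (subst lborel_matrix_vector_mult[OF M, symmetric]) auto
    also have "\<dots> \<longleftrightarrow> emeasure (distr lebesgue lborel ?T) A = 0"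
      using A d by (simp add: distr_completion emeasure_density nn_integral_cmult cong: distr_cong)
    finally have "emeasure lborel A = 0 \<longleftrightarrow> emeasure (distr lebesgue lborel ?T) A = 0" . }
  then have eq: "null_sets lborel = null_sets (distr lebesgue lborel ?T)"
    by (auto simp: null_sets_def)
  show "?T \<in> lebesgue \<rightarrow>\<^sub>M lebesgue"
    by (simp add: completion.measurable_completion2 eq measurable_completion)
  have "lebesgue = completion (density (distr lborel borel ?T) (\<lambda>_. ennreal \<bar>det M\<bar>))"
    by (subst lborel_matrix_vector_mult[OF M]) simp
  also have "\<dots> = density (completion (distr lebesgue lborel ?T)) (\<lambda>_. ennreal \<bar>det M\<bar>)"
    using d by (auto intro!: always_eventually completion_density_eq simp: distr_completion cong: distr_cong)
  also have "\<dots> = density (distr lebesgue lebesgue ?T) (\<lambda>_. ennreal \<bar>det M\<bar>)"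
    by (subst completion.completion_distr_eq) (auto simp: eq measurable_completion)
  finally show "lebesgue = density (distr lebesgue lebesgue ?T) (\<lambda>_. ennreal \<bar>det M\<bar>)" .
qed

lemma lebesgue_translate: "lebesgue = distr lebesgue lebesgue (\<lambda>x. v + x :: 'a::euclidean_space)"
  and lebesgue_measurable_translate: "(\<lambda>x. v + x :: 'a) \<in> lebesgue \<rightarrow>\<^sub>M lebesgue"
  using lebesgue_affine_euclidean[of "\<lambda>_. 1" v] lebesgue_affine_measurable[of "\<lambda>_. 1" v]
  by (simp_all add: euclidean_representation density_1)

subsection \<open>Square-integrable functions\<close>

text \<open>The squared norm with values in the extended reals. It makes sense for every function,
  so that Fatou, monotone sums and estimates apply before square-integrability is known.\<close>

definition energy :: "(real^'n \<Rightarrow> complex) \<Rightarrow> ennreal" where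
  "energy f = (\<integral>\<^sup>+x. ennreal ((cmod (f x))\<^sup>2) \<partial>lebesgue)"

lemma L2_space_iff: "f \<in> L2_space \<longleftrightarrow> f \<in> borel_measurable lebesgue \<and> energy f < \<infinity>"
  by (auto simp: L2_space_def energy_def integrable_iff_bounded)

lemma L2_spaceD [measurable_dest]: "f \<in> L2_space \<Longrightarrow> f \<in> borel_measurable lebesgue"
  by (simp add: L2_space_iff)

lemma L2_norm_nonneg: "L2_norm f \<ge> 0"
  by (simp add: L2_norm_def)

lemma energy_eq: "f \<in> L2_space \<Longrightarrow> energy f = ennreal ((L2_norm f)\<^sup>2)"
  by (auto simp: L2_space_def energy_def L2_norm_def intro!: nn_integral_eq_integral)

lemma energy_cong_AE: "(AE x in lebesgue. cmod (f x) = cmod (g x)) \<Longrightarrow> energy f = energy g"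
  unfolding energy_def by (rule nn_integral_cong_AE) auto

lemma energy_mono: "(\<And>x. cmod (f x) \<le> cmod (g x)) \<Longrightarrow> energy f \<le> energy g"
  unfolding energy_def by (intro nn_integral_mono ennreal_leI power_mono) auto

text \<open>The mixed term is split by the weighted arithmetic-geometric inequality. The choice d =
  1 serves crude estimates; arbitrarily small d is what gives the sharp constant in Plancherel's
  theorem.\<close>

lemma cmod_add_square_le:
  assumes "d > 0"
  shows "(cmod (a + b))\<^sup>2 \<le> (1 + d) * (cmod a)\<^sup>2 + (1 + 1 / d) * (cmod b)\<^sup>2"
proof -
  have "(cmod (a + b))\<^sup>2 \<le> (cmod a + cmod b)\<^sup>2"
    by (intro power_mono norm_triangle_ineq) simp
  also have "\<dots> = (cmod a)\<^sup>2 + (cmod b)\<^sup>2 + 2 * cmod a * cmod b"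
    by (simp add: power2_sum)
  also have "2 * cmod a * cmod b \<le> d * (cmod a)\<^sup>2 + (cmod b)\<^sup>2 / d"
    using assms sum_squares_bound[of "sqrt d * cmod a" "cmod b / sqrt d"]
    by (simp add: power_mult_distrib power_divide)
  finally show ?thesis by (simp add: algebra_simps)
qed

lemma energy_add_le:
  assumes [measurable]: "f \<in> borel_measurable lebesgue" "g \<in> borel_measurable lebesgue" and d: "d > 0"
  shows "energy (\<lambda>x. f x + g x) \<le> ennreal (1 + d) * energy f + ennreal (1 + 1 / d) * energy g"
proof -
  have "energy (\<lambda>x. f x + g x)
      \<le> (\<integral>\<^sup>+x. ennreal (1 + d) * ennreal ((cmod (f x))\<^sup>2) + ennreal (1 + 1 / d) * ennreal ((cmod (g x))\<^sup>2) \<partial>lebesgue)"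
    unfolding energy_def
  proof (rule nn_integral_mono)
    fix x
    show "ennreal ((cmod (f x + g x))\<^sup>2)
        \<le> ennreal (1 + d) * ennreal ((cmod (f x))\<^sup>2) + ennreal (1 + 1 / d) * ennreal ((cmod (g x))\<^sup>2)"
      using d cmod_add_square_le[OF d, of "f x" "g x"]
      by (simp add: ennreal_mult[symmetric] ennreal_plus[symmetric] ennreal_leI del: ennreal_plus)
  qed
  also have "\<dots> = ennreal (1 + d) * energy f + ennreal (1 + 1 / d) * energy g"
    unfolding energy_def by (subst nn_integral_add) (auto simp: nn_integral_cmult)
  finally show ?thesis .
qed

lemma energy_add_le2:
  assumes "f \<in> borel_measurable lebesgue" "g \<in> borel_measurable lebesgue"
  shows "energy (\<lambda>x. f x + g x) \<le> 2 * energy f + 2 * energy g"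
  using energy_add_le[OF assms, of 1] by simp

lemma energy_scale:
  assumes [measurable]: "f \<in> borel_measurable lebesgue"
  shows "energy (\<lambda>x. c * f x) = ennreal ((cmod c)\<^sup>2) * energy f"
  unfolding energy_def
  by (subst nn_integral_cmult[symmetric]) (auto simp: norm_mult power_mult_distrib ennreal_mult)

lemma L2_zero: "(\<lambda>x. 0) \<in> L2_space"
  by (simp add: L2_space_def)

lemma L2_scale:
  assumes "f \<in> L2_space" shows "(\<lambda>x. c * f x) \<in> L2_space"
  using assms by (auto simp: L2_space_iff energy_scale ennreal_mult_less_top)

lemma L2_add:
  assumes "f \<in> L2_space" "g \<in> L2_space"
  shows "(\<lambda>x. f x + g x) \<in> L2_space"
proof -
  have "energy (\<lambda>x. f x + g x) \<le> 2 * energy f + 2 * energy g"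
    using assms by (intro energy_add_le2) auto
  also have "\<dots> < \<infinity>" using assms by (simp add: L2_space_iff ennreal_mult_less_top)
  finally show ?thesis using assms by (auto simp: L2_space_iff)
qed

lemma L2_diff: "f \<in> L2_space \<Longrightarrow> g \<in> L2_space \<Longrightarrow> (\<lambda>x. f x - g x) \<in> L2_space"
  using L2_add[of f "\<lambda>x. (- 1) * g x"] L2_scale[of g "- 1"] by simp

lemma L2_sum: "(\<And>p. p \<in> F \<Longrightarrow> f p \<in> L2_space) \<Longrightarrow> (\<lambda>x. \<Sum>p\<in>F. f p x) \<in> L2_space"
  by (induction F rule: infinite_finite_induct) (auto intro: L2_zero L2_add)

lemma L2_bounded:
  assumes "g \<in> L2_space" "f \<in> borel_measurable lebesgue" "\<And>x. cmod (f x) \<le> cmod (g x)"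
  shows "f \<in> L2_space"
  using assms energy_mono[of f g] by (auto simp: L2_space_iff)

lemma borel_measurable_cnj [measurable (raw)]:
  "f \<in> borel_measurable M \<Longrightarrow> (\<lambda>x. cnj (f x)) \<in> borel_measurable M"
  by (rule measurable_compose[OF _ borel_measurable_continuous_onI]) (auto intro: continuous_intros)

lemma L2_cnj: "f \<in> L2_space \<Longrightarrow> (\<lambda>x. cnj (f x)) \<in> L2_space"
  by (rule L2_bounded[of f]) auto

lemma L2_mult_indicator:
  assumes "f \<in> L2_space" "S \<in> sets lebesgue"
  shows "(\<lambda>x. f x * indicator S x) \<in> L2_space"
proof (rule L2_bounded[OF assms(1)])
  show "(\<lambda>x. f x * indicator S x) \<in> borel_measurable lebesgue"
    using assms by measurable
qed (auto simp: indicator_def)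

lemma energy_indicator: "S \<in> sets lebesgue \<Longrightarrow> energy (indicator S) = emeasure lebesgue S"
proof -
  assume S: "S \<in> sets lebesgue"
  have "energy (indicator S) = (\<integral>\<^sup>+x. indicator S x \<partial>lebesgue)"
    unfolding energy_def by (rule nn_integral_cong) (simp add: indicator_def)
  also have "\<dots> = emeasure lebesgue S" using S by (rule nn_integral_indicator)
  finally show ?thesis .
qed

lemma L2_indicator: "S \<in> lmeasurable \<Longrightarrow> indicator S \<in> L2_space"
  by (auto simp: L2_space_iff energy_indicator fmeasurable_def)

lemma integrable_L2_mult:
  assumes "f \<in> L2_space" "g \<in> L2_space"
  shows "integrable lebesgue (\<lambda>x. f x * cnj (g x))"
proof (rule Bochner_Integration.integrable_bound)
  show "integrable lebesgue (\<lambda>x. (cmod (f x))\<^sup>2 + (cmod (g x))\<^sup>2)"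
    using assms by (auto simp: L2_space_def)
  show "(\<lambda>x. f x * cnj (g x)) \<in> borel_measurable lebesgue"
    using assms by measurable
  show "AE x in lebesgue. norm (f x * cnj (g x)) \<le> norm ((cmod (f x))\<^sup>2 + (cmod (g x))\<^sup>2)"
  proof (intro AE_I2)
    fix x
    have "cmod (f x) * cmod (g x) \<le> 2 * (cmod (f x) * cmod (g x))" by simp
    also have "\<dots> \<le> (cmod (f x))\<^sup>2 + (cmod (g x))\<^sup>2"
      using sum_squares_bound[of "cmod (f x)" "cmod (g x)"] by simp
    finally show "norm (f x * cnj (g x)) \<le> norm ((cmod (f x))\<^sup>2 + (cmod (g x))\<^sup>2)"
      by (simp add: norm_mult)
  qed
qed

lemma L2_inner_cnj: "L2_inner g f = cnj (L2_inner f g)"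
  unfolding L2_inner_def by (subst Bochner_Integration.integral_cnj[symmetric]) (simp add: mult.commute)

lemma L2_inner_add_left:
  assumes "f \<in> L2_space" "g \<in> L2_space" "h \<in> L2_space"
  shows "L2_inner (\<lambda>x. f x + g x) h = L2_inner f h + L2_inner g h"
  unfolding L2_inner_def
  using Bochner_Integration.integral_add[OF integrable_L2_mult integrable_L2_mult, OF assms(1,3,2,3)]
  by (simp add: distrib_right)

lemma L2_inner_scale_left: "L2_inner (\<lambda>x. c * f x) h = c * L2_inner f h"
  unfolding L2_inner_def by (simp add: mult.assoc)

lemma L2_inner_scale_right: "L2_inner f (\<lambda>x. c * h x) = cnj c * L2_inner f h"
  by (subst L2_inner_cnj, subst L2_inner_scale_left) (simp add: L2_inner_cnj[of h f])

lemma L2_inner_add_right: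
  assumes "f \<in> L2_space" "g \<in> L2_space" "h \<in> L2_space"
  shows "L2_inner h (\<lambda>x. f x + g x) = L2_inner h f + L2_inner h g"
  by (subst L2_inner_cnj, subst L2_inner_add_left[OF assms])
     (simp add: L2_inner_cnj[of h f] L2_inner_cnj[of h g])

lemma L2_inner_diff_left:
  assumes "f \<in> L2_space" "g \<in> L2_space" "h \<in> L2_space"
  shows "L2_inner (\<lambda>x. f x - g x) h = L2_inner f h - L2_inner g h"
  using L2_inner_add_left[OF assms(1) L2_scale[OF assms(2), of "- 1"] assms(3)]
    L2_inner_scale_left[of "- 1" g h] by simp

lemma L2_inner_diff_right:
  assumes "f \<in> L2_space" "g \<in> L2_space" "h \<in> L2_space"
  shows "L2_inner h (\<lambda>x. f x - g x) = L2_inner h f - L2_inner h g"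
  using L2_inner_add_right[OF assms(1) L2_scale[OF assms(2), of "- 1"] assms(3)]
    L2_inner_scale_right[of h "- 1" g] by simp

lemma L2_inner_sum_left:
  assumes "\<And>p. p \<in> F \<Longrightarrow> f p \<in> L2_space" "h \<in> L2_space"
  shows "L2_inner (\<lambda>x. \<Sum>p\<in>F. f p x) h = (\<Sum>p\<in>F. L2_inner (f p) h)"
  using assms(1)
proof (induction F rule: infinite_finite_induct)
  case (insert p F)
  then show ?case
    using L2_inner_add_left[of "f p" "\<lambda>x. \<Sum>p\<in>F. f p x" h] assms(2) L2_sum[of F f] by simp
qed (simp_all add: L2_inner_def)

lemma L2_inner_sum_right:
  assumes "\<And>p. p \<in> F \<Longrightarrow> f p \<in> L2_space" "h \<in> L2_space"
  shows "L2_inner h (\<lambda>x. \<Sum>p\<in>F. f p x) = (\<Sum>p\<in>F. L2_inner h (f p))"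
  by (subst L2_inner_cnj, subst L2_inner_sum_left[OF assms])
     (auto simp: L2_inner_cnj[of h] intro!: sum.cong)

lemma L2_inner_self: "L2_inner f f = of_real ((L2_norm f)\<^sup>2)"
proof -
  have "L2_inner f f = (LINT x|lebesgue. of_real ((cmod (f x))\<^sup>2))"
    unfolding L2_inner_def by (simp only: complex_norm_square)
  also have "\<dots> = of_real (LINT x|lebesgue. (cmod (f x))\<^sup>2)"
    by (rule integral_complex_of_real)
  also have "(LINT x|lebesgue. (cmod (f x))\<^sup>2) = (L2_norm f)\<^sup>2"
    by (simp add: L2_norm_def)
  finally show ?thesis .
qed

lemma L2_norm_diff_square:
  assumes "f \<in> L2_space" "g \<in> L2_space"
  shows "(L2_norm (\<lambda>x. f x - g x))\<^sup>2 = (L2_norm f)\<^sup>2 - 2 * Re (L2_inner f g) + (L2_norm g)\<^sup>2"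
proof -
  have "complex_of_real ((L2_norm (\<lambda>x. f x - g x))\<^sup>2)
      = of_real ((L2_norm f)\<^sup>2) - (L2_inner f g + cnj (L2_inner f g)) + of_real ((L2_norm g)\<^sup>2)"
    using assms
    by (simp add: L2_inner_self[symmetric] L2_inner_diff_left L2_inner_diff_right L2_diff L2_inner_cnj[of g f] del: of_real_power)
  also have "L2_inner f g + cnj (L2_inner f g) = of_real (2 * Re (L2_inner f g))"
    by (rule complex_add_cnj)
  finally have "complex_of_real ((L2_norm (\<lambda>x. f x - g x))\<^sup>2)
      = complex_of_real ((L2_norm f)\<^sup>2 - 2 * Re (L2_inner f g) + (L2_norm g)\<^sup>2)"
    by simp
  then show ?thesis by (simp only: of_real_eq_iff)
qed

lemma L2_norm_less_iff:
  assumes "f \<in> L2_space" "\<epsilon> > 0"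
  shows "L2_norm f < \<epsilon> \<longleftrightarrow> energy f < ennreal (\<epsilon>\<^sup>2)"
proof -
  have "L2_norm f < \<epsilon> \<longleftrightarrow> (L2_norm f)\<^sup>2 < \<epsilon>\<^sup>2"
    by (metis L2_norm_nonneg assms(2) less_imp_le power2_less_imp_less power_strict_mono zero_less_numeral)
  then show ?thesis using assms(1) by (simp add: energy_eq ennreal_less_iff)
qed

section \<open>Orthonormal families, spans and closed spans\<close>

definition L2_orthonormal :: "'i set \<Rightarrow> ('i \<Rightarrow> real^'n \<Rightarrow> complex) \<Rightarrow> bool" where
  "L2_orthonormal I g \<longleftrightarrow> (\<forall>p\<in>I. g p \<in> L2_space) \<and>
     (\<forall>p\<in>I. \<forall>q\<in>I. L2_inner (g p) (g q) = (if p = q then 1 else 0))"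

text \<open>Completing the square in the coefficients. Choosing the Fourier coefficients for c gives
  Bessel's inequality; dropping the last sum shows that no other choice approximates better, which
  is the hard half of Parseval.\<close>

lemma L2_orthonormal_diff_square:
  assumes on: "L2_orthonormal I g" and F: "finite F" "F \<subseteq> I" and f: "f \<in> L2_space"
  shows "(L2_norm (\<lambda>x. f x - (\<Sum>p\<in>F. c p * g p x)))\<^sup>2
       = (L2_norm f)\<^sup>2 - (\<Sum>p\<in>F. (cmod (L2_inner f (g p)))\<^sup>2) + (\<Sum>p\<in>F. (cmod (c p - L2_inner f (g p)))\<^sup>2)"
proof -
  have g: "g p \<in> L2_space" if "p \<in> F" for p
    using on that F by (auto simp: L2_orthonormal_def)
  have gg: "L2_inner (g p) (g q) = (if p = q then 1 else 0)" if "p \<in> F" "q \<in> F" for p q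
  proof -
    have "p \<in> I" "q \<in> I" using that F by auto
    with on show ?thesis by (simp add: L2_orthonormal_def)
  qed
  let ?s = "\<lambda>x. \<Sum>p\<in>F. c p * g p x"
  have s: "?s \<in> L2_space"
    by (intro L2_sum L2_scale g)
  have hs: "L2_inner h ?s = (\<Sum>p\<in>F. cnj (c p) * L2_inner h (g p))" if "h \<in> L2_space" for h
    using that by (subst L2_inner_sum_right) (auto intro: L2_scale g simp: L2_inner_scale_right)
  have gs: "L2_inner (g p) ?s = cnj (c p)" if "p \<in> F" for p
  proof -
    have "L2_inner (g p) ?s = (\<Sum>q\<in>F. if q = p then cnj (c q) else 0)"
      unfolding hs[OF g[OF that]] by (intro sum.cong) (auto simp: gg that)
    then show ?thesis using F that by simp
  qed
  have "L2_inner ?s ?s = (\<Sum>p\<in>F. L2_inner (\<lambda>x. c p * g p x) ?s)"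
    by (rule L2_inner_sum_left) (auto intro: L2_scale g s)
  also have "\<dots> = (\<Sum>p\<in>F. c p * cnj (c p))"
    unfolding L2_inner_scale_left by (intro sum.cong) (auto simp: gs)
  also have "\<dots> = complex_of_real (\<Sum>p\<in>F. (cmod (c p))\<^sup>2)"
    unfolding of_real_sum by (simp only: complex_norm_square)
  finally have "complex_of_real ((L2_norm ?s)\<^sup>2) = complex_of_real (\<Sum>p\<in>F. (cmod (c p))\<^sup>2)"
    by (simp only: L2_inner_self)
  then have ss: "(L2_norm ?s)\<^sup>2 = (\<Sum>p\<in>F. (cmod (c p))\<^sup>2)"
    by (simp only: of_real_eq_iff)
  have cd: "(cmod (a - b))\<^sup>2 = (cmod a)\<^sup>2 - 2 * Re (cnj a * b) + (cmod b)\<^sup>2" for a b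
    unfolding cmod_power2 by (simp add: power2_eq_square algebra_simps)
  show ?thesis
    unfolding L2_norm_diff_square[OF f s] hs[OF f] ss
    by (simp add: cd sum.distrib sum_subtractf sum_distrib_left)
qed

lemma L2_bessel_finite:
  assumes "L2_orthonormal I g" "finite F" "F \<subseteq> I" "f \<in> L2_space"
  shows "(\<Sum>p\<in>F. (cmod (L2_inner f (g p)))\<^sup>2) \<le> (L2_norm f)\<^sup>2"
  using L2_orthonormal_diff_square[OF assms, of "\<lambda>p. L2_inner f (g p)"] by simp (smt (verit) zero_le_power2)

text \<open>Linear span as a rule induction that adds one term at a time, so that closure properties
  are proved without handling finite supports.\<close>

inductive_set lspan :: "(real^'n \<Rightarrow> complex) set \<Rightarrow> (real^'n \<Rightarrow> complex) set" for G where
  lspan_zero: "(\<lambda>x. 0) \<in> lspan G"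
| lspan_step: "f \<in> G \<Longrightarrow> h \<in> lspan G \<Longrightarrow> (\<lambda>x. c * f x + h x) \<in> lspan G"

lemma lspan_base: "f \<in> G \<Longrightarrow> f \<in> lspan G"
  using lspan_step[OF _ lspan_zero, of f G 1] by simp

lemma lspan_add: "f \<in> lspan G \<Longrightarrow> h \<in> lspan G \<Longrightarrow> (\<lambda>x. f x + h x) \<in> lspan G"
proof (induction rule: lspan.induct)
  case (lspan_step f k c)
  then show ?case using lspan.lspan_step[of f G "\<lambda>x. k x + h x" c] by (simp add: add.assoc)
qed simp

lemma lspan_scale: "f \<in> lspan G \<Longrightarrow> (\<lambda>x. a * f x) \<in> lspan G"
proof (induction rule: lspan.induct)
  case (lspan_step f k c)
  then show ?case using lspan.lspan_step[of f G "\<lambda>x. a * k x" "a * c"] by (simp add: algebra_simps)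
qed (simp add: lspan_zero)

lemma lspan_L2: "f \<in> lspan G \<Longrightarrow> G \<subseteq> L2_space \<Longrightarrow> f \<in> L2_space"
  by (induction rule: lspan.induct) (auto intro!: L2_zero L2_add L2_scale)

lemma lspan_image_finite_sum:
  assumes "f \<in> lspan (g ` I)"
  shows "\<exists>F c. finite F \<and> F \<subseteq> I \<and> f = (\<lambda>x. \<Sum>p\<in>F. c p * g p x)"
  using assms
proof (induction rule: lspan.induct)
  case lspan_zero
  show ?case by (rule exI[of _ "{}"]) simp
next
  case (lspan_step f h a)
  then obtain p F c where p: "p \<in> I" "f = g p" and F: "finite F" "F \<subseteq> I" "h = (\<lambda>x. \<Sum>p\<in>F. c p * g p x)"
    by blast
  \<comment> \<open>The new index p may already occur in F; its coefficients then have to be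
    added.\<close>
  define d where "d q = (if q = p then a else 0) + (if q \<in> F then c q else 0)" for q
  have "a * f x + h x = (\<Sum>q\<in>insert p F. d q * g q x)" for x
  proof -
    have "(\<Sum>q\<in>insert p F. d q * g q x)
        = (\<Sum>q\<in>insert p F. (if q = p then a * g q x else 0)) + (\<Sum>q\<in>insert p F. (if q \<in> F then c q * g q x else 0))"
      unfolding sum.distrib[symmetric] by (intro sum.cong) (auto simp: d_def distrib_right)
    also have "(\<Sum>q\<in>insert p F. (if q \<in> F then c q * g q x else 0)) = (\<Sum>q\<in>F. c q * g q x)"
      using F(1) by (intro sum.mono_neutral_cong_right) auto
    finally show ?thesis using p F by simp
  qed
  then show ?case using F p by (intro exI[of _ "insert p F"] exI[of _ d]) auto
qed

lemma lspan_sum: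
  "finite F \<Longrightarrow> (\<And>p. p \<in> F \<Longrightarrow> f p \<in> lspan G) \<Longrightarrow> (\<lambda>x. \<Sum>p\<in>F. f p x) \<in> lspan G"
  by (induction F rule: finite_induct) (auto intro: lspan_zero lspan_add)

text \<open>Here \<epsilon> bounds the squared norm, not the norm. Members are functions rather than
  classes, and the set is closed under almost-everywhere modification within the measurable
  functions.\<close>

definition L2_closed_span :: "(real^'n \<Rightarrow> complex) set \<Rightarrow> (real^'n \<Rightarrow> complex) set" where
  "L2_closed_span G = {f \<in> L2_space. \<forall>\<epsilon>>0. \<exists>s\<in>lspan G. energy (\<lambda>x. f x - s x) < ennreal \<epsilon>}"

lemma closed_span_L2: "f \<in> L2_closed_span G \<Longrightarrow> f \<in> L2_space"
  by (simp add: L2_closed_span_def)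

lemma closed_spanD: "f \<in> L2_closed_span G \<Longrightarrow> \<epsilon> > 0 \<Longrightarrow> \<exists>s\<in>lspan G. energy (\<lambda>x. f x - s x) < ennreal \<epsilon>"
  by (simp add: L2_closed_span_def)

lemma lspan_closed_span:
  assumes "f \<in> lspan G" "G \<subseteq> L2_space" shows "f \<in> L2_closed_span G"
  unfolding L2_closed_span_def
proof (intro CollectI conjI allI impI)
  fix \<epsilon> :: real assume "\<epsilon> > 0"
  then show "\<exists>s\<in>lspan G. energy (\<lambda>x. f x - s x) < ennreal \<epsilon>"
    by (intro bexI[OF _ assms(1)]) (simp add: energy_def)
qed (rule lspan_L2[OF assms])

text \<open>The quarters compensate the factors 2 in \<open>energy_add_le2\<close>, the form in
  which the triangle inequality is used for energies.\<close>

lemma ennreal_quarters_less: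
  assumes "\<epsilon> > 0" "a < ennreal (\<epsilon> / 4)" "b < ennreal (\<epsilon> / 4)"
  shows "2 * a + 2 * b < ennreal \<epsilon>"
proof -
  have a: "a = ennreal (enn2real a)" and b: "b = ennreal (enn2real b)"
    using assms by (auto simp: ennreal_enn2real_if top_unique dest: order.strict_trans2)
  have r: "enn2real a < \<epsilon> / 4" "enn2real b < \<epsilon> / 4"
    using assms a b by (metis enn2real_nonneg ennreal_less_iff)+
  have "2 * a + 2 * b = ennreal (2 * enn2real a + 2 * enn2real b)"
    by (subst a, subst b) (simp add: ennreal_plus ennreal_mult)
  also have "\<dots> < ennreal \<epsilon>"
    using r assms(1) by (intro ennreal_lessI) auto
  finally show ?thesis .
qed

lemma closed_span_limit:
  assumes G: "G \<subseteq> L2_space" and f: "f \<in> L2_space"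
    and ap: "\<And>\<epsilon>. \<epsilon> > 0 \<Longrightarrow> \<exists>h\<in>L2_closed_span G. energy (\<lambda>x. f x - h x) < ennreal \<epsilon>"
  shows "f \<in> L2_closed_span G"
  unfolding L2_closed_span_def
proof (intro CollectI conjI allI impI f)
  fix \<epsilon> :: real assume e: "\<epsilon> > 0"
  obtain h where h: "h \<in> L2_closed_span G" "energy (\<lambda>x. f x - h x) < ennreal (\<epsilon> / 4)"
    using ap[of "\<epsilon> / 4"] e by auto
  obtain s where s: "s \<in> lspan G" "energy (\<lambda>x. h x - s x) < ennreal (\<epsilon> / 4)"
    using closed_spanD[OF h(1), of "\<epsilon> / 4"] e by auto
  have "energy (\<lambda>x. (f x - h x) + (h x - s x)) \<le> 2 * energy (\<lambda>x. f x - h x) + 2 * energy (\<lambda>x. h x - s x)"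
    using f closed_span_L2[OF h(1)] lspan_L2[OF s(1) G] by (intro energy_add_le2) (auto intro: L2_diff)
  also have "\<dots> < ennreal \<epsilon>"
    using e h(2) s(2) by (rule ennreal_quarters_less)
  finally show "\<exists>s\<in>lspan G. energy (\<lambda>x. f x - s x) < ennreal \<epsilon>"
    using s(1) by (intro bexI[of _ s]) simp_all
qed

lemma closed_span_add:
  assumes G: "G \<subseteq> L2_space" and f: "f \<in> L2_closed_span G" and g: "g \<in> L2_closed_span G"
  shows "(\<lambda>x. f x + g x) \<in> L2_closed_span G"
  unfolding L2_closed_span_def
proof (intro CollectI conjI allI impI)
  note L = f[THEN closed_span_L2] g[THEN closed_span_L2]
  show "(\<lambda>x. f x + g x) \<in> L2_space" using L by (rule L2_add)
  fix \<epsilon> :: real assume e: "\<epsilon> > 0"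
  obtain s where s: "s \<in> lspan G" "energy (\<lambda>x. f x - s x) < ennreal (\<epsilon> / 4)"
    using closed_spanD[OF f, of "\<epsilon> / 4"] e by auto
  obtain t where t: "t \<in> lspan G" "energy (\<lambda>x. g x - t x) < ennreal (\<epsilon> / 4)"
    using closed_spanD[OF g, of "\<epsilon> / 4"] e by auto
  have "energy (\<lambda>x. (f x - s x) + (g x - t x)) \<le> 2 * energy (\<lambda>x. f x - s x) + 2 * energy (\<lambda>x. g x - t x)"
    using L lspan_L2[OF s(1) G] lspan_L2[OF t(1) G] by (intro energy_add_le2) (auto intro: L2_diff)
  also have "\<dots> < ennreal \<epsilon>"
    using e s(2) t(2) by (rule ennreal_quarters_less)
  finally show "\<exists>s\<in>lspan G. energy (\<lambda>x. (f x + g x) - s x) < ennreal \<epsilon>"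
    using lspan_add[OF s(1) t(1)] by (intro bexI[of _ "\<lambda>x. s x + t x"]) (simp_all add: algebra_simps)
qed

lemma closed_span_scale:
  assumes G: "G \<subseteq> L2_space" and f: "f \<in> L2_closed_span G"
  shows "(\<lambda>x. a * f x) \<in> L2_closed_span G"
  unfolding L2_closed_span_def
proof (intro CollectI conjI allI impI)
  note L = f[THEN closed_span_L2]
  show "(\<lambda>x. a * f x) \<in> L2_space" using L by (rule L2_scale)
  fix \<epsilon> :: real assume e: "\<epsilon> > 0"
  \<comment> \<open>The summand 1 keeps the divisor positive when a = 0.\<close>
  define d where "d = (cmod a)\<^sup>2 + 1"
  have d: "d > 0" by (simp add: d_def add_nonneg_pos)
  obtain s where s: "s \<in> lspan G" "energy (\<lambda>x. f x - s x) < ennreal (\<epsilon> / d)"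
    using closed_spanD[OF f, of "\<epsilon> / d"] e d by auto
  have "energy (\<lambda>x. a * f x - a * s x) = energy (\<lambda>x. a * (f x - s x))"
    by (simp add: right_diff_distrib)
  also have "\<dots> = ennreal ((cmod a)\<^sup>2) * energy (\<lambda>x. f x - s x)"
    using L lspan_L2[OF s(1) G] by (intro energy_scale) auto
  also have "\<dots> \<le> ennreal d * energy (\<lambda>x. f x - s x)"
    by (intro mult_right_mono ennreal_leI) (auto simp: d_def)
  also have "\<dots> < ennreal d * ennreal (\<epsilon> / d)"
    using s(2) d by (intro ennreal_mult_strict_left_mono) auto
  also have "\<dots> = ennreal \<epsilon>"
    using d e by (simp add: ennreal_mult[symmetric])
  finally show "\<exists>s\<in>lspan G. energy (\<lambda>x. a * f x - s x) < ennreal \<epsilon>"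
    using lspan_scale[OF s(1)] by (intro bexI[of _ "\<lambda>x. a * s x"]) simp_all
qed

lemma closed_span_zero: "G \<subseteq> L2_space \<Longrightarrow> (\<lambda>x. 0) \<in> L2_closed_span G"
  by (intro lspan_closed_span lspan_zero)

lemma closed_span_sum:
  "G \<subseteq> L2_space \<Longrightarrow> (\<And>p. p \<in> F \<Longrightarrow> f p \<in> L2_closed_span G) \<Longrightarrow> (\<lambda>x. \<Sum>p\<in>F. f p x) \<in> L2_closed_span G"
  by (induction F rule: infinite_finite_induct) (auto intro: closed_span_zero closed_span_add)

lemma closed_span_trans:
  assumes G: "G \<subseteq> L2_space" and H: "H \<subseteq> L2_closed_span G" and f: "f \<in> L2_closed_span H"
  shows "f \<in> L2_closed_span G"
proof (rule closed_span_limit[OF G closed_span_L2[OF f]])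
  fix \<epsilon> :: real assume "\<epsilon> > 0"
  then obtain s where s: "s \<in> lspan H" "energy (\<lambda>x. f x - s x) < ennreal \<epsilon>"
    using closed_spanD[OF f] by blast
  have "s \<in> L2_closed_span G"
    using s(1) by (induction rule: lspan.induct)
      (use H in \<open>auto intro!: closed_span_zero[OF G] closed_span_add[OF G] closed_span_scale[OF G]\<close>)
  with s(2) show "\<exists>h\<in>L2_closed_span G. energy (\<lambda>x. f x - h x) < ennreal \<epsilon>" by blast
qed

lemma closed_span_cong_AE:
  assumes f: "f \<in> L2_closed_span G" and g: "g \<in> borel_measurable lebesgue"
    and ae: "AE x in lebesgue. f x = g x"
  shows "g \<in> L2_closed_span G"
proof -
  have eq: "energy (\<lambda>x. f x - s x) = energy (\<lambda>x. g x - s x)" for s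
    by (rule energy_cong_AE) (use ae in auto)
  from eq[of "\<lambda>x. 0"] have "g \<in> L2_space"
    using closed_span_L2[OF f] g by (simp add: L2_space_iff)
  with f show ?thesis by (simp add: L2_closed_span_def eq)
qed

text \<open>Converts pointwise limits into limits in norm: the squared errors are dominated by the
  square of 2w. All completeness arguments pass through it, for simple functions, for trigonometric
  polynomials and for the dilated tiles.\<close>

lemma closed_span_dominated_limit:
  fixes f w :: "real^'n \<Rightarrow> complex"
  assumes G: "G \<subseteq> L2_space" and f: "f \<in> borel_measurable lebesgue" and h: "\<And>m::nat. h m \<in> L2_closed_span G"
    and w: "w \<in> L2_space" and le: "\<And>m x. cmod (h m x) \<le> cmod (w x)"
    and lim: "AE x in lebesgue. (\<lambda>m. h m x) \<longlonglongrightarrow> f x"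
  shows "f \<in> L2_closed_span G"
proof -
  have fw: "AE x in lebesgue. cmod (f x) \<le> cmod (w x)"
    using lim by eventually_elim (rule Lim_bounded[OF tendsto_norm, of _ _ 0], use le in auto)
  have fL2: "f \<in> L2_space"
  proof -
    have "energy f \<le> energy w"
      unfolding energy_def using fw by (intro nn_integral_mono_AE) (auto elim!: eventually_mono intro!: ennreal_leI power_mono)
    with w f show ?thesis by (auto simp: L2_space_iff)
  qed
  have "(\<lambda>m. energy (\<lambda>x. f x - h m x)) \<longlonglongrightarrow> (\<integral>\<^sup>+x. 0 \<partial>(lebesgue :: (real^'n) measure))"
    unfolding energy_def
  proof (rule nn_integral_dominated_convergence[where w="\<lambda>x. ennreal ((cmod (2 * w x))\<^sup>2)"])
    show "(\<integral>\<^sup>+x. ennreal ((cmod (2 * w x))\<^sup>2) \<partial>lebesgue) < \<infinity>"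
      using L2_scale[OF w, of 2] by (simp add: L2_space_iff energy_def)
    show "AE x in lebesgue. ennreal ((cmod (f x - h j x))\<^sup>2) \<le> ennreal ((cmod (2 * w x))\<^sup>2)" for j
      using fw
    proof eventually_elim
      case (elim x)
      have "cmod (f x - h j x) \<le> cmod (f x) + cmod (h j x)" by (rule norm_triangle_ineq4)
      also have "\<dots> \<le> cmod (2 * w x)" using elim le[of j x] by (simp add: norm_mult)
      finally show ?case by (intro ennreal_leI power_mono) auto
    qed
    show "AE x in lebesgue. (\<lambda>i. ennreal ((cmod (f x - h i x))\<^sup>2)) \<longlonglongrightarrow> 0"
      using lim
    proof eventually_elim
      case (elim x)
      have "(\<lambda>i. ennreal ((cmod (f x - h i x))\<^sup>2)) \<longlonglongrightarrow> ennreal ((cmod (f x - f x))\<^sup>2)"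
        by (intro tendsto_intros elim tendsto_ennrealI)
      then show ?case by simp
    qed
  qed (use f h[THEN closed_span_L2] w in \<open>auto intro: L2_spaceD\<close>)
  then have lim0: "(\<lambda>m. energy (\<lambda>x. f x - h m x)) \<longlonglongrightarrow> 0" by simp
  show ?thesis
  proof (rule closed_span_limit[OF G fL2])
    fix \<epsilon> :: real assume "\<epsilon> > 0"
    then have "eventually (\<lambda>m. energy (\<lambda>x. f x - h m x) < ennreal \<epsilon>) sequentially"
      using order_tendstoD(2)[OF lim0, of "ennreal \<epsilon>"] by simp
    then obtain m where "energy (\<lambda>x. f x - h m x) < ennreal \<epsilon>"
      by (auto simp: eventually_sequentially)
    with h show "\<exists>h\<in>L2_closed_span G. energy (\<lambda>x. f x - h x) < ennreal \<epsilon>" by blast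
  qed
qed

text \<open>Exchanges explicit finite combinations for membership in a closed span. The passage
  between norm and energy replaces \<epsilon> by its square root or its square.\<close>

lemma L2_orthonormal_basis_iff:
  "L2_orthonormal_basis I g \<longleftrightarrow> L2_orthonormal I g \<and> L2_space \<subseteq> L2_closed_span (g ` I)"
proof -
  have e1: "L2_orthonormal_basis I g \<longleftrightarrow> L2_orthonormal I g \<and>
      (\<forall>f\<in>L2_space. \<forall>\<epsilon>>0. \<exists>F c. finite F \<and> F \<subseteq> I \<and> L2_norm (\<lambda>x. f x - (\<Sum>p\<in>F. c p * g p x)) < \<epsilon>)"
    unfolding L2_orthonormal_basis_def L2_orthonormal_def conj_assoc ..
  have e2: "(\<forall>f\<in>L2_space. \<forall>\<epsilon>>0. \<exists>F c. finite F \<and> F \<subseteq> I \<and> L2_norm (\<lambda>x. f x - (\<Sum>p\<in>F. c p * g p x)) < \<epsilon>) \<longleftrightarrow> L2_space \<subseteq> L2_closed_span (g ` I)" if True: "L2_orthonormal I g"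
  proof -
    from True have g: "g p \<in> L2_space" if "p \<in> I" for p using that by (auto simp: L2_orthonormal_def)
    have *: "(\<forall>\<epsilon>>0. \<exists>F c. finite F \<and> F \<subseteq> I \<and> L2_norm (\<lambda>x. f x - (\<Sum>p\<in>F. c p * g p x)) < \<epsilon>)
        \<longleftrightarrow> f \<in> L2_closed_span (g ` I)" if f: "f \<in> L2_space" for f
    proof
      assume A: "\<forall>\<epsilon>>0. \<exists>F c. finite F \<and> F \<subseteq> I \<and> L2_norm (\<lambda>x. f x - (\<Sum>p\<in>F. c p * g p x)) < \<epsilon>"
      show "f \<in> L2_closed_span (g ` I)"
        unfolding L2_closed_span_def
      proof (intro CollectI conjI allI impI f)
        fix \<epsilon> :: real assume e: "\<epsilon> > 0"
        obtain F c where F: "finite F" "F \<subseteq> I" and n: "L2_norm (\<lambda>x. f x - (\<Sum>p\<in>F. c p * g p x)) < sqrt \<epsilon>"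
          using A[rule_format, of "sqrt \<epsilon>"] e by auto
        have s: "(\<lambda>x. \<Sum>p\<in>F. c p * g p x) \<in> lspan (g ` I)"
          using F by (intro lspan_sum lspan_scale lspan_base) auto
        have "(\<lambda>x. f x - (\<Sum>p\<in>F. c p * g p x)) \<in> L2_space"
          using F g f by (intro L2_diff L2_sum L2_scale) auto
        with n e have "energy (\<lambda>x. f x - (\<Sum>p\<in>F. c p * g p x)) < ennreal \<epsilon>"
          by (simp add: L2_norm_less_iff)
        with s show "\<exists>s\<in>lspan (g ` I). energy (\<lambda>x. f x - s x) < ennreal \<epsilon>"
          by (intro bexI[of _ "\<lambda>x. \<Sum>p\<in>F. c p * g p x"])
      qed
    next
      assume A: "f \<in> L2_closed_span (g ` I)"
      show "\<forall>\<epsilon>>0. \<exists>F c. finite F \<and> F \<subseteq> I \<and> L2_norm (\<lambda>x. f x - (\<Sum>p\<in>F. c p * g p x)) < \<epsilon>"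
      proof (intro allI impI)
        fix \<epsilon> :: real assume e: "\<epsilon> > 0"
        then obtain s where s: "s \<in> lspan (g ` I)" "energy (\<lambda>x. f x - s x) < ennreal (\<epsilon>\<^sup>2)"
          using closed_spanD[OF A, of "\<epsilon>\<^sup>2"] by auto
        obtain F c where F: "finite F" "F \<subseteq> I" and seq: "s = (\<lambda>x. \<Sum>p\<in>F. c p * g p x)"
          using lspan_image_finite_sum[OF s(1)] by blast
        have "(\<lambda>x. f x - (\<Sum>p\<in>F. c p * g p x)) \<in> L2_space"
          using F g f by (intro L2_diff L2_sum L2_scale) auto
        with s e have "L2_norm (\<lambda>x. f x - (\<Sum>p\<in>F. c p * g p x)) < \<epsilon>"
          by (simp add: L2_norm_less_iff seq)
        with F show "\<exists>F c. finite F \<and> F \<subseteq> I \<and> L2_norm (\<lambda>x. f x - (\<Sum>p\<in>F. c p * g p x)) < \<epsilon>" by blast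
      qed
    qed
    show ?thesis unfolding subset_eq[of L2_space] by (intro ball_cong refl *)
  qed
  show ?thesis unfolding e1 by (rule conj_cong[OF refl e2])
qed

text \<open>The series is taken in the extended nonnegative reals, so that it can later be
  integrated termwise. Bessel bounds the partial sums; conversely an approximating combination with
  error below e shows that finitely many coefficients already account for the energy up to
  e.\<close>

lemma L2_parseval:
  fixes g :: "nat \<Rightarrow> real^'n \<Rightarrow> complex"
  assumes on: "L2_orthonormal UNIV g" and f: "f \<in> L2_closed_span (range g)"
  shows "(\<Sum>m. ennreal ((cmod (L2_inner f (g m)))\<^sup>2)) = energy f"
proof (rule antisym)
  have fL: "f \<in> L2_space" using f by (rule closed_span_L2)
  have gL: "g m \<in> L2_space" for m using on by (simp add: L2_orthonormal_def)
  show "(\<Sum>m. ennreal ((cmod (L2_inner f (g m)))\<^sup>2)) \<le> energy f"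
  proof (rule suminf_le_const)
    fix m
    have "(\<Sum>i<m. ennreal ((cmod (L2_inner f (g i)))\<^sup>2)) = ennreal (\<Sum>i<m. (cmod (L2_inner f (g i)))\<^sup>2)"
      by (simp add: sum_ennreal)
    also have "\<dots> \<le> ennreal ((L2_norm f)\<^sup>2)"
      by (intro ennreal_leI L2_bessel_finite[OF on]) (auto simp: fL)
    finally show "(\<Sum>i<m. ennreal ((cmod (L2_inner f (g i)))\<^sup>2)) \<le> energy f"
      by (simp add: energy_eq fL)
  qed simp
  show "energy f \<le> (\<Sum>m. ennreal ((cmod (L2_inner f (g m)))\<^sup>2))"
  proof (rule ennreal_le_epsilon)
    fix e :: real assume e: "e > 0"
    obtain s where s: "s \<in> lspan (range g)" "energy (\<lambda>x. f x - s x) < ennreal e"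
      using closed_spanD[OF f e] by blast
    obtain F c where F: "finite F" and seq: "s = (\<lambda>x. \<Sum>p\<in>F. c p * g p x)"
      using lspan_image_finite_sum[OF s(1)] by blast
    have dL: "(\<lambda>x. f x - (\<Sum>p\<in>F. c p * g p x)) \<in> L2_space"
      using F gL fL by (intro L2_diff L2_sum L2_scale) auto
    have "(L2_norm (\<lambda>x. f x - (\<Sum>p\<in>F. c p * g p x)))\<^sup>2 < e"
      using s(2) by (simp add: seq energy_eq[OF dL] ennreal_less_iff)
    then have "(L2_norm f)\<^sup>2 \<le> (\<Sum>p\<in>F. (cmod (L2_inner f (g p)))\<^sup>2) + e"
      using L2_orthonormal_diff_square[OF on F _ fL, of c]
        sum_nonneg[of F "\<lambda>p. (cmod (c p - L2_inner f (g p)))\<^sup>2"] by simp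
    then have "energy f \<le> ennreal ((\<Sum>p\<in>F. (cmod (L2_inner f (g p)))\<^sup>2) + e)"
      by (simp add: energy_eq fL ennreal_leI)
    also have "\<dots> = (\<Sum>p\<in>F. ennreal ((cmod (L2_inner f (g p)))\<^sup>2)) + ennreal e"
      using e by (simp add: sum_nonneg)
    also have "\<dots> \<le> (\<Sum>m. ennreal ((cmod (L2_inner f (g m)))\<^sup>2)) + ennreal e"
      by (intro add_right_mono sum_le_suminf F) auto
    finally show "energy f \<le> (\<Sum>m. ennreal ((cmod (L2_inner f (g m)))\<^sup>2)) + ennreal e" .
  qed
qed

lemma L2_closed_span_indicators:
  fixes f :: "real^'n \<Rightarrow> complex"
  assumes f: "f \<in> L2_space"
  shows "f \<in> L2_closed_span ((\<lambda>S. indicator S) ` lmeasurable)"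
proof -
  let ?G = "(\<lambda>S. indicator S) ` lmeasurable :: (real^'n \<Rightarrow> complex) set"
  have G: "?G \<subseteq> L2_space" by (auto intro: L2_indicator)
  obtain s where s: "\<And>i. simple_function lebesgue (s i)"
    and lim: "\<And>x. (\<lambda>i. s i x) \<longlonglongrightarrow> f x"
    and bd: "\<And>i x. dist (s i x) 0 \<le> 2 * dist (f x) 0"
    using borel_measurable_implies_sequence_metric[of f lebesgue 0] f by (auto simp: L2_space_def)
  have sG: "s i \<in> L2_closed_span ?G" for i
  proof -
    have eq: "s i x = (\<Sum>y\<in>s i ` UNIV. y * indicator (s i -` {y}) x)" for x
    proof -
      have "(\<Sum>y\<in>s i ` UNIV. y * indicator (s i -` {y}) x) = (\<Sum>y\<in>{s i x}. y * indicator (s i -` {y}) x)"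
        by (rule sum.mono_neutral_right) (use s[of i] in \<open>auto simp: simple_function_def indicator_def\<close>)
      then show ?thesis by simp
    qed
    have ind: "(\<lambda>x. y * indicator (s i -` {y}) x) \<in> L2_closed_span ?G" for y
    proof (cases "y = 0")
      case True
      then show ?thesis using closed_span_zero[OF G] by simp
    next
      case False
      have m: "s i -` {y} \<in> sets lebesgue"
        using simple_functionD(2)[OF s[of i], of "{y}"] by simp
      \<comment> \<open>Chebyshev: where s takes the value y, |y| is at most 2|f|, so a level set
        for a nonzero value has finite measure. The level set for 0 may be infinite and contributes
        nothing.\<close>
      have "energy (indicator (s i -` {y})) \<le> energy (\<lambda>x. 2 / cmod y * f x)"
      proof (rule energy_mono)
        fix x show "cmod (indicator (s i -` {y}) x) \<le> cmod (2 / cmod y * f x)"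
          using bd[of i x] False by (auto simp: indicator_def norm_mult norm_divide field_simps)
      qed
      also have "\<dots> < \<infinity>" using L2_scale[OF f, of "2 / cmod y"] unfolding L2_space_iff by blast
      finally have "s i -` {y} \<in> lmeasurable"
        using m by (simp add: energy_indicator fmeasurable_def)
      then show ?thesis
        by (intro closed_span_scale[OF G] lspan_closed_span[OF _ G] lspan_base) auto
    qed
    have "(\<lambda>x. \<Sum>y\<in>s i ` UNIV. y * indicator (s i -` {y}) x) \<in> L2_closed_span ?G"
      by (rule closed_span_sum[OF G ind])
    then show ?thesis unfolding eq[symmetric] .
  qed
  show ?thesis
  proof (rule closed_span_dominated_limit[OF G _ sG, where w="\<lambda>x. 2 * f x"])
    show "AE x in lebesgue. (\<lambda>m. s m x) \<longlonglongrightarrow> f x" using lim by simp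
    show "\<And>m x. cmod (s m x) \<le> cmod (2 * f x)" using bd by (simp add: norm_mult)
  qed (use f in \<open>auto intro: L2_scale\<close>)
qed

subsection \<open>Lattice tiles\<close>

lemma
  fixes M :: "real^'n^'n"
  assumes M: "invertible M"
  shows nn_integral_matrix: "f \<in> borel_measurable lebesgue \<Longrightarrow>
      (\<integral>\<^sup>+x. f x \<partial>lebesgue) = ennreal \<bar>det M\<bar> * (\<integral>\<^sup>+x. f (M *v x) \<partial>lebesgue)"
    and integral_matrix: "h \<in> borel_measurable lebesgue \<Longrightarrow>
      (LINT x|lebesgue. h x) = of_real \<bar>det M\<bar> * (LINT x|lebesgue. h (M *v x) :: complex)"
    and AE_matrix: "(AE x in lebesgue. P x) \<Longrightarrow> (AE x in lebesgue. P (M *v x))"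
    and measurable_matrix_comp: "g \<in> borel_measurable lebesgue \<Longrightarrow>
      (\<lambda>x. g (M *v x) :: 'b::topological_space) \<in> borel_measurable lebesgue"
proof -
  note m[measurable] = lebesgue_measurable_matrix_vector_mult[OF M]
  note eq = lebesgue_matrix_vector_mult[OF M]
  have d: "ennreal \<bar>det M\<bar> > 0" using M by (simp add: invertible_det_nz)
  show "(\<lambda>x. g (M *v x)) \<in> borel_measurable lebesgue" if "g \<in> borel_measurable lebesgue"
    using measurable_compose[OF m that] .
  show "(\<integral>\<^sup>+x. f x \<partial>lebesgue) = ennreal \<bar>det M\<bar> * (\<integral>\<^sup>+x. f (M *v x) \<partial>lebesgue)"
    if f[measurable]: "f \<in> borel_measurable lebesgue"
  proof -
    have "(\<integral>\<^sup>+x. f x \<partial>lebesgue) = (\<integral>\<^sup>+x. f x \<partial>density (distr lebesgue lebesgue ((*v) M)) (\<lambda>_. ennreal \<bar>det M\<bar>))"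
      using eq by (rule arg_cong)
    also have "\<dots> = ennreal \<bar>det M\<bar> * (\<integral>\<^sup>+x. f (M *v x) \<partial>lebesgue)"
      by (subst nn_integral_density) (auto simp: nn_integral_distr nn_integral_cmult)
    finally show ?thesis .
  qed
  show "(LINT x|lebesgue. h x) = of_real \<bar>det M\<bar> * (LINT x|lebesgue. h (M *v x) :: complex)"
    if h[measurable]: "h \<in> borel_measurable lebesgue"
  proof -
    have "(LINT x|lebesgue. h x) = (LINT x|density (distr lebesgue lebesgue ((*v) M)) (\<lambda>_. ennreal \<bar>det M\<bar>). h x)"
      using eq by (rule arg_cong)
    also have "\<dots> = of_real \<bar>det M\<bar> * (LINT x|lebesgue. h (M *v x))"
      by (subst integral_density) (auto simp: integral_distr scaleR_conv_of_real)
    finally show ?thesis .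
  qed
  show "AE x in lebesgue. P (M *v x)" if "AE x in lebesgue. P x"
  proof -
    have "AE x in density (distr lebesgue lebesgue ((*v) M)) (\<lambda>_. ennreal \<bar>det M\<bar>). P x"
      using that by (subst eq[symmetric])
    then have "AE x in distr lebesgue lebesgue ((*v) M). P x"
      using d by (subst (asm) AE_density) auto
    then show ?thesis using AE_distrD[OF m] by blast
  qed
qed

lemma
  fixes v :: "'a::euclidean_space"
  shows nn_integral_translate: "f \<in> borel_measurable lebesgue \<Longrightarrow>
      (\<integral>\<^sup>+x. f (v + x) \<partial>lebesgue) = (\<integral>\<^sup>+x. f x \<partial>lebesgue)"
    and integral_translate: "h \<in> borel_measurable lebesgue \<Longrightarrow>
      (LINT x|lebesgue. h (v + x) :: complex) = (LINT x|lebesgue. h x)"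
    and measurable_translate_comp: "g \<in> borel_measurable lebesgue \<Longrightarrow>
      (\<lambda>x. g (v + x) :: 'b::topological_space) \<in> borel_measurable lebesgue"
proof -
  note m[measurable] = lebesgue_measurable_translate[of v]
  show "(\<lambda>x. g (v + x)) \<in> borel_measurable lebesgue" if "g \<in> borel_measurable lebesgue"
    using measurable_compose[OF m that] .
  show "(\<integral>\<^sup>+x. f (v + x) \<partial>lebesgue) = (\<integral>\<^sup>+x. f x \<partial>lebesgue)" if f: "f \<in> borel_measurable lebesgue"
  proof -
    have "(\<integral>\<^sup>+x. f x \<partial>distr lebesgue lebesgue (\<lambda>x. v + x)) = (\<integral>\<^sup>+x. f (v + x) \<partial>lebesgue)"
      using m f by (intro nn_integral_distr) simp_all
    then show ?thesis unfolding lebesgue_translate[of v, symmetric] by simp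
  qed
  show "(LINT x|lebesgue. h (v + x) :: complex) = (LINT x|lebesgue. h x)" if h: "h \<in> borel_measurable lebesgue"
    using integral_distr[OF m h] unfolding lebesgue_translate[of v, symmetric] by simp
qed

lemma energy_matrix:
  fixes M :: "real^'n^'n"
  assumes "invertible M" and f: "f \<in> borel_measurable lebesgue"
  shows "energy f = ennreal \<bar>det M\<bar> * energy (\<lambda>x. f (M *v x))"
  unfolding energy_def using f by (intro nn_integral_matrix[OF assms(1)]) auto

lemma energy_translate:
  assumes f: "f \<in> borel_measurable lebesgue"
  shows "energy (\<lambda>x. f (v + x)) = energy f"
  unfolding energy_def using f by (intro nn_integral_translate[of "\<lambda>x. ennreal ((cmod (f x))\<^sup>2)"]) auto

lemma L2_matrix:
  fixes M :: "real^'n^'n"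
  assumes "invertible M" "f \<in> L2_space"
  shows "(\<lambda>x. f (M *v x)) \<in> L2_space"
proof -
  have "ennreal \<bar>det M\<bar> * energy (\<lambda>x. f (M *v x)) < \<infinity>"
    using energy_matrix[OF assms(1), of f] assms(2) by (simp add: L2_space_iff)
  moreover have "ennreal \<bar>det M\<bar> \<noteq> 0" using assms(1) by (simp add: invertible_det_nz)
  ultimately have "energy (\<lambda>x. f (M *v x)) < \<infinity>"
    by (auto simp: ennreal_mult_less_top)
  then show ?thesis
    using assms measurable_matrix_comp[OF assms(1), of f] by (simp add: L2_space_iff)
qed

lemma L2_translate: "f \<in> L2_space \<Longrightarrow> (\<lambda>x. f (v + x)) \<in> L2_space"
  using energy_translate[of f v] measurable_translate_comp[of f v] by (simp add: L2_space_iff)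

text \<open>The energy of f - g gives the real part of the inner product, that of i f - g the
  imaginary part. Isometries are therefore established for energies only, both for a change of tile
  and for the Fourier transform.\<close>

lemma L2_inner_polarization:
  assumes "f \<in> L2_space" "g \<in> L2_space" "f' \<in> L2_space" "g' \<in> L2_space"
    and "energy f = energy f'" "energy g = energy g'"
    and "energy (\<lambda>x. f x - g x) = energy (\<lambda>x. f' x - g' x)"
    and "energy (\<lambda>x. \<i> * f x - g x) = energy (\<lambda>x. \<i> * f' x - g' x)"
  shows "L2_inner f g = L2_inner f' g'"
proof -
  have norms: "(L2_norm a)\<^sup>2 = (L2_norm b)\<^sup>2"
    if "a \<in> L2_space" "b \<in> L2_space" "energy a = energy b" for a :: "real^'a \<Rightarrow> complex" and b :: "real^'b \<Rightarrow> complex"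
    using that by (simp add: energy_eq)
  note L = assms(1-4) L2_scale[OF assms(1), of \<i>] L2_scale[OF assms(3), of \<i>]
  have "Re (L2_inner f g) = Re (L2_inner f' g')"
    using L2_norm_diff_square[OF L(1,2)] L2_norm_diff_square[OF L(3,4)]
      norms[OF L(1,3) assms(5)] norms[OF L(2,4) assms(6)] norms[OF L2_diff[OF L(1,2)] L2_diff[OF L(3,4)] assms(7)]
    by simp
  moreover have "energy (\<lambda>x. \<i> * f x) = energy (\<lambda>x. \<i> * f' x)"
    using assms(5) L by (simp add: energy_scale L2_spaceD)
  from norms[OF L(5,6) this] have "Re (L2_inner (\<lambda>x. \<i> * f x) g) = Re (L2_inner (\<lambda>x. \<i> * f' x) g')"
    using L2_norm_diff_square[OF L(5,2)] L2_norm_diff_square[OF L(6,4)]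
      norms[OF L(2,4) assms(6)] norms[OF L2_diff[OF L(5,2)] L2_diff[OF L(6,4)] assms(8)]
    by simp
  then have "Im (L2_inner f g) = Im (L2_inner f' g')"
    by (simp add: L2_inner_scale_left)
  ultimately show ?thesis by (simp add: complex_eq_iff)
qed

text \<open>A bounded linear operator respects closed spans. Its domain D is explicit because the
  Fourier transform is an integral operator on \<open>L12\<close> only, while dilations and
  multiplication by an indicator act on all of \<open>L2_space\<close>.\<close>

lemma closed_span_map:
  assumes H: "H \<subseteq> L2_space" and G: "G \<subseteq> D" and D: "D \<subseteq> L2_space"
    and cl: "\<And>c f h. f \<in> D \<Longrightarrow> h \<in> D \<Longrightarrow> (\<lambda>x. c * f x + h x) \<in> D"
    and T: "\<And>f. f \<in> D \<Longrightarrow> T f \<in> L2_space"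
    and lin: "\<And>c f h. f \<in> D \<Longrightarrow> h \<in> D \<Longrightarrow> T (\<lambda>x. c * f x + h x) = (\<lambda>x. c * T f x + T h x)"
    and en: "\<And>f. f \<in> D \<Longrightarrow> energy (T f) \<le> ennreal C * energy f"
    and TG: "\<And>g. g \<in> G \<Longrightarrow> T g \<in> L2_closed_span H"
    and f: "f \<in> L2_closed_span G" "f \<in> D"
  shows "T f \<in> L2_closed_span H"
proof (rule closed_span_limit[OF H T[OF f(2)]])
  fix \<epsilon> :: real assume e: "\<epsilon> > 0"
  have diff: "(\<lambda>x. a x - b x) \<in> D" "T (\<lambda>x. a x - b x) = (\<lambda>x. T a x - T b x)" if "a \<in> D" "b \<in> D" for a b
    using cl[OF that(2,1), of "-1"] lin[OF that(2,1), of "-1"] by (simp_all add: algebra_simps)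
  have zero: "(\<lambda>x. 0) \<in> D" "T (\<lambda>x. 0) = (\<lambda>x. 0)"
    using diff[OF f(2) f(2)] by simp_all
  have "s \<in> D \<and> T s \<in> L2_closed_span H" if "s \<in> lspan G" for s
    using that
  proof (induction rule: lspan.induct)
    case lspan_zero
    then show ?case using zero closed_span_zero[OF H] by simp
  next
    case (lspan_step g h c)
    then have "g \<in> D" using G by blast
    with lspan_step show ?case
      using cl[of g h c] lin[of g h c] closed_span_add[OF H closed_span_scale[OF H TG]] by simp
  qed
  note s_cl = this
  define d where "d = \<bar>C\<bar> + 1"
  have d: "d > 0" by (simp add: d_def)
  obtain s where s: "s \<in> lspan G" "energy (\<lambda>x. f x - s x) < ennreal (\<epsilon> / d)"
    using closed_spanD[OF f(1), of "\<epsilon> / d"] e d by auto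
  have "energy (\<lambda>x. T f x - T s x) \<le> ennreal C * energy (\<lambda>x. f x - s x)"
    using en[OF diff(1)[OF f(2), of s]] diff(2)[OF f(2), of s] s_cl[OF s(1)] by simp
  also have "\<dots> \<le> ennreal d * energy (\<lambda>x. f x - s x)"
    by (intro mult_right_mono ennreal_leI) (auto simp: d_def)
  also have "\<dots> < ennreal d * ennreal (\<epsilon> / d)"
    using s(2) d by (intro ennreal_mult_strict_left_mono) auto
  also have "\<dots> = ennreal \<epsilon>"
    using d e by (simp add: ennreal_mult[symmetric])
  finally show "\<exists>h\<in>L2_closed_span H. energy (\<lambda>x. T f x - h x) < ennreal \<epsilon>"
    using s_cl[OF s(1)] by blast
qed

lemma closed_span_mult_indicator:
  assumes H: "H \<subseteq> L2_space" and K: "K \<in> sets lebesgue" and f: "f \<in> L2_space"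
    and ind: "\<And>S. S \<in> lmeasurable \<Longrightarrow> S \<subseteq> K \<Longrightarrow> indicator S \<in> L2_closed_span H"
  shows "(\<lambda>x. f x * indicator K x) \<in> L2_closed_span H"
proof (rule closed_span_map[where G="(\<lambda>S. indicator S) ` lmeasurable" and D=L2_space and C=1 and T="\<lambda>f x. f x * indicator K x", OF H])
  show "(\<lambda>S. indicator S) ` lmeasurable \<subseteq> L2_space" by (auto intro: L2_indicator)
  show "energy (\<lambda>x. f x * indicator K x) \<le> ennreal 1 * energy f" for f
    by (simp, rule energy_mono) (auto simp: indicator_def)
  show "(\<lambda>x. f x * indicator K x) \<in> L2_space" if "f \<in> L2_space" for f
    by (rule L2_mult_indicator[OF that K])
  fix g :: "real^'a \<Rightarrow> complex" assume "g \<in> (\<lambda>S. indicator S) ` lmeasurable"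
  then obtain S where S: "S \<in> lmeasurable" "g = indicator S" by blast
  have "(\<lambda>x. g x * indicator K x) = indicator (S \<inter> K)"
    by (auto simp: S indicator_def)
  then show "(\<lambda>x. g x * indicator K x) \<in> L2_closed_span H"
    using ind[of "S \<inter> K"] S K by (simp add: fmeasurable_Int_fmeasurable)
qed (use f L2_closed_span_indicators[OF f] in \<open>auto intro: L2_add L2_scale simp: algebra_simps\<close>)

section \<open>The integer lattice and its fundamental domains\<close>

lemma integer_lattice_zero: "0 \<in> integer_lattice"
  and integer_lattice_add: "a \<in> integer_lattice \<Longrightarrow> b \<in> integer_lattice \<Longrightarrow> a + b \<in> integer_lattice"
  and integer_lattice_uminus: "a \<in> integer_lattice \<Longrightarrow> - a \<in> integer_lattice"
  and integer_lattice_diff: "a \<in> integer_lattice \<Longrightarrow> b \<in> integer_lattice \<Longrightarrow> a - b \<in> integer_lattice"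
  and integer_lattice_axis: "axis i 1 \<in> integer_lattice"
  and integer_lattice_inner: "a \<in> integer_lattice \<Longrightarrow> b \<in> integer_lattice \<Longrightarrow> a \<bullet> b \<in> \<int>"
  by (auto simp: integer_lattice_def axis_def inner_vec_def)

lemma countable_integer_lattice: "countable (integer_lattice :: (real^'n) set)"
  unfolding integer_lattice_def by (rule countable_vector) (simp add: Ints_def)

lemma infinite_integer_lattice: "infinite (integer_lattice :: (real^'n) set)"
proof
  assume "finite (integer_lattice :: (real^'n) set)"
  moreover have "range (\<lambda>m::nat. (\<chi> i. real m) :: real^'n) \<subseteq> integer_lattice"
    by (auto simp: integer_lattice_def)
  ultimately have "finite (range (\<lambda>m::nat. (\<chi> i. real m) :: real^'n))"
    by (rule rev_finite_subset)
  then show False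
    by (rule range_inj_infinite[THEN notE, rotated]) (auto simp: inj_on_def vec_eq_iff)
qed

text \<open>Turns lattice sums into series over the naturals. Its order also serves later to rank
  the points of a coset.\<close>

definition lattice_enum :: "nat \<Rightarrow> real^'n" where
  "lattice_enum = from_nat_into integer_lattice"

lemma bij_betw_lattice_enum: "bij_betw (lattice_enum :: nat \<Rightarrow> real^'n) UNIV integer_lattice"
  unfolding lattice_enum_def
  by (rule bij_betw_from_nat_into[OF countable_integer_lattice infinite_integer_lattice])

lemma lattice_enum_in: "lattice_enum m \<in> integer_lattice"
  using bij_betw_lattice_enum by (auto simp: bij_betw_def)

lemma range_lattice_enum: "range lattice_enum = integer_lattice"
  using bij_betw_lattice_enum by (auto simp: bij_betw_def)

lemma lattice_enum_inj: "lattice_enum m = lattice_enum l \<longleftrightarrow> m = l"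
  using bij_betw_lattice_enum by (auto simp: bij_betw_def inj_on_def)

lemma ex1_lattice_enum: "(\<exists>!k. k \<in> integer_lattice \<and> P k) \<longleftrightarrow> (\<exists>!m. P (lattice_enum m))"
proof
  assume "\<exists>!k. k \<in> integer_lattice \<and> P k"
  then obtain k where k: "k \<in> integer_lattice" "P k" and u: "\<And>l. l \<in> integer_lattice \<Longrightarrow> P l \<Longrightarrow> l = k"
    by (rule ex1E) blast
  obtain m where m: "k = lattice_enum m"
    using k(1) unfolding range_lattice_enum[symmetric] by (rule imageE)
  show "\<exists>!m. P (lattice_enum m)"
  proof (rule ex1I[of _ m])
    fix l assume "P (lattice_enum l)"
    from u[OF lattice_enum_in this] show "l = m" by (simp add: m lattice_enum_inj)
  qed (use k(2) m in simp)
next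
  assume "\<exists>!m. P (lattice_enum m)"
  then obtain m where m: "P (lattice_enum m)" and u: "\<And>l. P (lattice_enum l) \<Longrightarrow> l = m"
    by (rule ex1E) blast
  show "\<exists>!k. k \<in> integer_lattice \<and> P k"
  proof (rule ex1I[of _ "lattice_enum m"])
    fix k assume k: "k \<in> integer_lattice \<and> P k"
    then obtain l where "k = lattice_enum l"
      unfolding range_lattice_enum[symmetric] by blast
    with k u[of l] show "k = lattice_enum m" by simp
  qed (simp add: m lattice_enum_in)
qed

text \<open>A fundamental domain in the strict sense, for every point and not just almost every one.
  Sums of indicators over the lattice are then identically 1.\<close>

definition lattice_tile :: "(real^'n) set \<Rightarrow> bool" where
  "lattice_tile K \<longleftrightarrow> K \<in> sets lebesgue \<and> (\<forall>x. \<exists>!k. k \<in> integer_lattice \<and> x + k \<in> K)"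

lemma lattice_tile_sets: "lattice_tile K \<Longrightarrow> K \<in> sets lebesgue"
  by (simp add: lattice_tile_def)

lemma lattice_tile_suminf:
  assumes "lattice_tile K"
  shows "(\<Sum>m. indicator K (x + lattice_enum m) :: ennreal) = 1"
    and "(\<Sum>m. indicator K (x - lattice_enum m) :: ennreal) = 1"
proof -
  have *: "(\<Sum>m. indicator K (g m) :: ennreal) = 1" if "\<exists>!m. g m \<in> K" for g :: "nat \<Rightarrow> real^'a"
  proof -
    from that obtain m where m: "g m \<in> K" "\<And>l. g l \<in> K \<Longrightarrow> l = m" by auto
    have "(\<Sum>m. indicator K (g m) :: ennreal) = (\<Sum>l\<in>{m}. indicator K (g l))"
      by (rule suminf_finite) (use m(2) in \<open>auto simp: indicator_def\<close>)
    then show ?thesis using m(1) by simp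
  qed
  have "\<exists>!m. x + lattice_enum m \<in> K"
    using assms by (simp add: lattice_tile_def ex1_lattice_enum)
  then show "(\<Sum>m. indicator K (x + lattice_enum m) :: ennreal) = 1" by (rule *)
  obtain k where k: "k \<in> integer_lattice" "x + k \<in> K" "\<And>l. l \<in> integer_lattice \<Longrightarrow> x + l \<in> K \<Longrightarrow> l = k"
    using assms unfolding lattice_tile_def by metis
  have "\<exists>!k. k \<in> integer_lattice \<and> x - k \<in> K"
  proof (rule ex1I[of _ "- k"])
    fix l assume l: "l \<in> integer_lattice \<and> x - l \<in> K"
    then have "- l = k" by (intro k(3)) (auto intro: integer_lattice_uminus)
    then show "l = - k" by auto
  qed (use k(1,2) in \<open>simp add: integer_lattice_uminus\<close>)
  then show "(\<Sum>m. indicator K (x - lattice_enum m) :: ennreal) = 1"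
    by (intro *) (simp add: ex1_lattice_enum)
qed

text \<open>The usual unfolding: insert the sum of the translated indicators of L, which is 1, shift
  each term by its lattice vector, and sum the translated indicators of K back to 1. Periodicity
  keeps f unchanged under the shifts.\<close>

lemma nn_integral_lattice_tile:
  assumes K: "lattice_tile K" and L: "lattice_tile L" and f[measurable]: "f \<in> borel_measurable lebesgue"
    and per: "\<And>x k. k \<in> integer_lattice \<Longrightarrow> f (x + k) = f x"
  shows "(\<integral>\<^sup>+x. f x * indicator K x \<partial>lebesgue) = (\<integral>\<^sup>+x. f x * indicator L x \<partial>lebesgue)"
proof -
  note [measurable] = lattice_tile_sets[OF K] lattice_tile_sets[OF L]
  have tr[measurable]: "(\<lambda>x. indicator A (x + a) :: ennreal) \<in> borel_measurable lebesgue"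
    if "A \<in> sets lebesgue" for A and a :: "real^'a"
    using measurable_translate_comp[of "indicator A :: _ \<Rightarrow> ennreal" a] that by (simp add: add.commute)
  have tr'[measurable]: "(\<lambda>x. indicator A (x - a) :: ennreal) \<in> borel_measurable lebesgue"
    if "A \<in> sets lebesgue" for A and a :: "real^'a"
    using tr[OF that, of "- a"] by simp
  have shift: "(\<integral>\<^sup>+x. f x * indicator K x * indicator L (x + lattice_enum m) \<partial>lebesgue)
      = (\<integral>\<^sup>+x. f x * indicator L x * indicator K (x - lattice_enum m) \<partial>lebesgue)" for m
  proof -
    have "(\<integral>\<^sup>+x. f x * indicator K x * indicator L (x + lattice_enum m) \<partial>lebesgue)
        = (\<integral>\<^sup>+x. f ((- lattice_enum m) + x) * indicator K ((- lattice_enum m) + x)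
            * indicator L (((- lattice_enum m) + x) + lattice_enum m) \<partial>lebesgue)"
      by (rule nn_integral_translate[symmetric]) measurable
    also have "\<dots> = (\<integral>\<^sup>+x. f x * indicator L x * indicator K (x - lattice_enum m) \<partial>lebesgue)"
      using per[OF integer_lattice_uminus[OF lattice_enum_in[of m]]]
      by (intro nn_integral_cong) (simp add: add.commute mult.assoc mult.commute mult.left_commute)
    finally show ?thesis .
  qed
  have "(\<integral>\<^sup>+x. f x * indicator K x \<partial>lebesgue)
      = (\<integral>\<^sup>+x. (\<Sum>m. f x * indicator K x * indicator L (x + lattice_enum m)) \<partial>lebesgue)"
    by (intro nn_integral_cong) (simp add: lattice_tile_suminf(1)[OF L])
  also have "\<dots> = (\<Sum>m. \<integral>\<^sup>+x. f x * indicator K x * indicator L (x + lattice_enum m) \<partial>lebesgue)"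
    by (rule nn_integral_suminf) measurable
  also have "\<dots> = (\<Sum>m. \<integral>\<^sup>+x. f x * indicator L x * indicator K (x - lattice_enum m) \<partial>lebesgue)"
    by (simp only: shift)
  also have "\<dots> = (\<integral>\<^sup>+x. (\<Sum>m. f x * indicator L x * indicator K (x - lattice_enum m)) \<partial>lebesgue)"
    by (rule nn_integral_suminf[symmetric]) measurable
  also have "\<dots> = (\<integral>\<^sup>+x. f x * indicator L x \<partial>lebesgue)"
    by (intro nn_integral_cong) (simp add: lattice_tile_suminf(2)[OF K])
  finally show ?thesis .
qed

lemma energy_lattice_tile:
  assumes K: "lattice_tile K" and L: "lattice_tile L" and f[measurable]: "f \<in> borel_measurable lebesgue"
    and per: "\<And>x k. k \<in> integer_lattice \<Longrightarrow> f (x + k) = f x"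
  shows "energy (\<lambda>x. f x * indicator K x) = energy (\<lambda>x. f x * indicator L x)"
proof -
  have *: "energy (\<lambda>x. f x * indicator S x) = (\<integral>\<^sup>+x. ennreal ((cmod (f x))\<^sup>2) * indicator S x \<partial>lebesgue)" for S
    unfolding energy_def by (rule nn_integral_cong) (simp add: indicator_def)
  show ?thesis
    unfolding * by (rule nn_integral_lattice_tile[OF K L]) (auto simp: per)
qed

section \<open>Characters and the unit cube\<close>

definition wave :: "real^'n \<Rightarrow> real^'n \<Rightarrow> complex" where
  "wave k x = cis (2 * pi * (k \<bullet> x))"

lemma wave_zero [simp]: "wave 0 x = 1" "wave k 0 = 1"
  and norm_wave [simp]: "cmod (wave k x) = 1"
  and wave_add_left: "wave (k + l) x = wave k x * wave l x"
  and wave_add_right: "wave k (x + y) = wave k x * wave k y"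
  and cnj_wave: "cnj (wave k x) = wave (- k) x"
  and wave_commute: "wave k x = wave x k"
  by (simp_all add: wave_def inner_add_left inner_add_right cis_mult distrib_left cis_cnj inner_commute)

lemma wave_integer: "k \<in> integer_lattice \<Longrightarrow> l \<in> integer_lattice \<Longrightarrow> wave k l = 1"
  by (simp add: wave_def integer_lattice_inner)

lemma continuous_on_wave: "continuous_on S (wave k)"
  unfolding wave_def[abs_def] cis_conv_exp by (intro continuous_intros)

lemma lebesgue_measurable_wave [measurable]: "wave k \<in> borel_measurable lebesgue"
  by (intro measurable_completion) (simp add: borel_measurable_continuous_onI continuous_on_wave)

definition unit_cube :: "(real^'n) set" where
  "unit_cube = {x. \<forall>i. 0 \<le> x $ i \<and> x $ i < 1}"

lemma unit_cube_borel: "unit_cube \<in> sets borel"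
proof -
  have "unit_cube = (\<Inter>i. {x::real^'n. 0 \<le> x $ i} \<inter> {x. x $ i < 1})"
    by (auto simp: unit_cube_def)
  also have "\<dots> \<in> sets borel"
    by (intro sets.finite_INT sets.Int borel_measurable_le borel_measurable_less borel_closed borel_open
        closed_Collect_le open_Collect_less continuous_intros) auto
  finally show ?thesis .
qed

lemma lattice_tile_unit_cube: "lattice_tile (unit_cube :: (real^'n) set)"
  unfolding lattice_tile_def
proof (intro conjI allI)
  show "unit_cube \<in> sets lebesgue" using unit_cube_borel by auto
  fix x :: "real^'n"
  show "\<exists>!k. k \<in> integer_lattice \<and> x + k \<in> unit_cube"
  proof (rule ex1I[of _ "\<chi> i. - of_int \<lfloor>x $ i\<rfloor>"])
    show "(\<chi> i. - of_int \<lfloor>x $ i\<rfloor>) \<in> integer_lattice \<and> x + (\<chi> i. - of_int \<lfloor>x $ i\<rfloor>) \<in> unit_cube"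
      by (auto simp: integer_lattice_def unit_cube_def) linarith
    fix k assume k: "k \<in> integer_lattice \<and> x + k \<in> unit_cube"
    have "k $ i = - of_int \<lfloor>x $ i\<rfloor>" for i
    proof -
      obtain z where z: "k $ i = of_int z"
        using k by (auto simp: integer_lattice_def elim: Ints_cases)
      have "0 \<le> x $ i + of_int z" "x $ i + of_int z < 1"
        using k z by (auto simp: unit_cube_def) (metis vector_add_component)+
      then have "\<lfloor>x $ i\<rfloor> = - z" by linarith
      then show ?thesis by (simp add: z)
    qed
    then show "k = (\<chi> i. - of_int \<lfloor>x $ i\<rfloor>)" by (simp add: vec_eq_iff)
  qed
qed

lemma unit_cube_subset_cbox: "unit_cube \<subseteq> cbox 0 (1 :: real^'n)"
  by (auto simp: unit_cube_def mem_box_cart less_imp_le)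

lemma energy_unit_cube: "energy (indicator (unit_cube :: (real^'n) set)) = 1"
proof -
  have "energy (indicator (unit_cube :: (real^'n) set)) = emeasure lebesgue (unit_cube :: (real^'n) set)"
    by (rule energy_indicator) (rule lattice_tile_sets[OF lattice_tile_unit_cube])
  also have "\<dots> = emeasure lborel (unit_cube :: (real^'n) set)"
    using unit_cube_borel[where 'a='n] by simp
  also have "\<dots> = 1"
  proof (rule antisym)
    have "emeasure lborel (unit_cube :: (real^'n) set) \<le> emeasure lborel (cbox 0 (1::real^'n))"
      by (intro emeasure_mono unit_cube_subset_cbox) simp
    also have "\<dots> = 1"
    proof -
      have "(0::real^'n) \<bullet> b \<le> 1 \<bullet> b" if "b \<in> Basis" for b
        using that by (auto simp: Basis_vec_def inner_axis)
      then show ?thesis by (simp add: emeasure_lborel_cbox prod_Basis_cart inner_axis)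
    qed
    finally show "emeasure lborel (unit_cube :: (real^'n) set) \<le> 1" .
    have "1 = emeasure lborel (box 0 (1::real^'n))" by (subst emeasure_lborel_box_cart) auto
    also have "\<dots> \<le> emeasure lborel (unit_cube :: (real^'n) set)"
      using unit_cube_borel[where 'a='n] by (intro emeasure_mono) (auto simp: unit_cube_def mem_box_cart less_imp_le)
    finally show "1 \<le> emeasure lborel (unit_cube :: (real^'n) set)" .
  qed
  finally show ?thesis .
qed

lemma energy_indicator_tile: "lattice_tile K \<Longrightarrow> energy (indicator K) = 1"
  using energy_lattice_tile[OF _ lattice_tile_unit_cube, of K "\<lambda>x. 1"] energy_unit_cube
  by (simp add: indicator_def[abs_def] of_bool_def)

lemma tile_indicator_L2: "lattice_tile K \<Longrightarrow> indicator K \<in> L2_space"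
  using lattice_tile_sets[of K] by (simp add: L2_space_iff energy_indicator_tile)

lemma tile_lmeasurable: "lattice_tile K \<Longrightarrow> K \<in> lmeasurable"
  using energy_indicator_tile[of K] by (simp add: energy_indicator lattice_tile_sets fmeasurable_def)

lemma wave_tile_L2: "lattice_tile K \<Longrightarrow> (\<lambda>x. wave k x * indicator K x) \<in> L2_space"
proof (rule L2_bounded[OF tile_indicator_L2])
  assume "lattice_tile K"
  then have [measurable]: "K \<in> sets lebesgue" by (rule lattice_tile_sets)
  show "(\<lambda>x. wave k x * indicator K x) \<in> borel_measurable lebesgue" by measurable
qed (auto simp: norm_mult)

subsection \<open>Exponentials on lattice tiles\<close>

definition tile_wave :: "(real^'n) set \<Rightarrow> real^'n \<Rightarrow> real^'n \<Rightarrow> complex" where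
  "tile_wave K k x = wave k x * indicator K x"

lemma tile_wave_L2: "lattice_tile K \<Longrightarrow> tile_wave K k \<in> L2_space"
  using wave_tile_L2 by (simp add: tile_wave_def[abs_def])

lemma wave_periodic: "k \<in> integer_lattice \<Longrightarrow> l \<in> integer_lattice \<Longrightarrow> wave k (x + l) = wave k x"
  by (simp add: wave_add_right wave_integer)

text \<open>Combinations of the two waves are periodic, so their energies over K and L agree; the
  four combinations needed for polarization determine the inner product.\<close>

lemma tile_wave_inner_indep:
  assumes K: "lattice_tile K" and L: "lattice_tile L" and k: "k \<in> integer_lattice" "l \<in> integer_lattice"
  shows "L2_inner (tile_wave K k) (tile_wave K l) = L2_inner (tile_wave L k) (tile_wave L l)"
proof -
  have e: "energy (\<lambda>x. a * tile_wave K k x - b * tile_wave K l x)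
      = energy (\<lambda>x. a * tile_wave L k x - b * tile_wave L l x)" for a b
  proof -
    have *: "(\<lambda>x. a * tile_wave M k x - b * tile_wave M l x)
        = (\<lambda>x. (a * wave k x - b * wave l x) * indicator M x)" for M
      by (auto simp: tile_wave_def algebra_simps)
    show ?thesis
      unfolding * by (rule energy_lattice_tile[OF K L]) (auto simp: wave_periodic k)
  qed
  show ?thesis
    by (rule L2_inner_polarization)
       (use e[of 1 0] e[of 0 "-1"] e[of 1 1] e[of \<i> 1] in \<open>auto intro: tile_wave_L2 K L\<close>)
qed

lemma lattice_tile_translate:
  assumes K: "lattice_tile K"
  shows "lattice_tile {x. x - a \<in> K}"
  unfolding lattice_tile_def
proof (intro conjI allI)
  have "{x. x - a \<in> K} = (\<lambda>x. a + x) ` K"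
    by (auto simp: image_iff) (metis add_diff_cancel_left' diff_add_cancel add.commute)
  then show "{x. x - a \<in> K} \<in> sets lebesgue"
    using lebesgue_sets_translation[OF lattice_tile_sets[OF K]] by simp
  fix x
  have "\<exists>!k. k \<in> integer_lattice \<and> (x - a) + k \<in> K"
    using K unfolding lattice_tile_def by blast
  then show "\<exists>!k. k \<in> integer_lattice \<and> x + k \<in> {x. x - a \<in> K}"
    by (simp add: algebra_simps)
qed

text \<open>
  The inner product does not depend on the tile, but translating the tile by \<open>a\<close> multiplies it by the
  value at \<open>a\<close> of a nontrivial character, which can be made \<open>-1\<close>.
\<close>

lemma tile_wave_orthogonal:
  assumes K: "lattice_tile K" and k: "k \<in> integer_lattice" "l \<in> integer_lattice" "k \<noteq> l"
  shows "L2_inner (tile_wave K k) (tile_wave K l) = 0"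
proof -
  obtain i where i: "(k - l) $ i \<noteq> 0"
    using k(3) by (auto simp: vec_eq_iff)
  \<comment> \<open>Chosen so that (k - l) \<bullet> a = 1/2, where the character takes the value
    exp(i pi) = -1.\<close>
  define a where "a = axis i (1 / (2 * (k - l) $ i))"
  define L where "L = {x. x - a \<in> K}"
  have L: "lattice_tile L" unfolding L_def by (rule lattice_tile_translate[OF K])
  have w: "wave k a * cnj (wave l a) = -1"
  proof -
    have "wave k a * cnj (wave l a) = wave (k - l) a"
      by (simp add: cnj_wave wave_add_left[symmetric])
    also have "\<dots> = -1"
    proof -
      have "(k - l) \<bullet> a = 1 / 2"
        using i by (simp add: a_def inner_axis)
      then show ?thesis by (simp only: wave_def) simp
    qed
    finally show ?thesis .
  qed
  have tr: "tile_wave L m (a + x) = wave m a * tile_wave K m x" for m x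
    by (simp add: tile_wave_def L_def wave_add_right indicator_def)
  have meas: "(\<lambda>x. tile_wave L k x * cnj (tile_wave L l x)) \<in> borel_measurable lebesgue"
    using tile_wave_L2[OF L] by measurable
  have "L2_inner (tile_wave K k) (tile_wave K l) = L2_inner (tile_wave L k) (tile_wave L l)"
    by (rule tile_wave_inner_indep[OF K L k(1,2)])
  also have "\<dots> = (LINT x|lebesgue. tile_wave L k (a + x) * cnj (tile_wave L l (a + x)))"
    unfolding L2_inner_def by (rule integral_translate[OF meas, symmetric])
  also have "\<dots> = (wave k a * cnj (wave l a)) * L2_inner (tile_wave K k) (tile_wave K l)"
    unfolding L2_inner_def tr
    by (subst Bochner_Integration.integral_mult_right_zero[symmetric]) (simp add: algebra_simps)
  finally show ?thesis by (simp add: w)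
qed

lemma tile_wave_norm:
  assumes K: "lattice_tile K"
  shows "L2_inner (tile_wave K k) (tile_wave K k) = 1"
proof -
  have "energy (tile_wave K k) = energy (indicator K)"
    by (rule energy_cong_AE) (simp add: tile_wave_def norm_mult)
  then have "(L2_norm (tile_wave K k))\<^sup>2 = 1"
    using energy_eq[OF tile_wave_L2[OF K, of k]] by (simp add: energy_indicator_tile[OF K])
  then show ?thesis by (simp add: L2_inner_self)
qed

lemma tile_wave_orthonormal:
  assumes "lattice_tile K"
  shows "L2_orthonormal integer_lattice (tile_wave K)"
  using assms by (auto simp: L2_orthonormal_def tile_wave_L2 tile_wave_norm tile_wave_orthogonal)

section \<open>Trigonometric polynomials and Stone-Weierstrass\<close>

abbreviation trig_polynomials :: "(real^'n \<Rightarrow> complex) set" where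
  "trig_polynomials \<equiv> lspan (wave ` integer_lattice)"

lemma wave_trig: "k \<in> integer_lattice \<Longrightarrow> wave k \<in> trig_polynomials"
  by (intro lspan_base) blast

lemma wave_mult_trig:
  assumes "g \<in> trig_polynomials" "k \<in> integer_lattice"
  shows "(\<lambda>x. wave k x * g x) \<in> trig_polynomials"
  using assms(1)
proof (induction rule: lspan.induct)
  case (lspan_step f h c)
  then obtain l where l: "l \<in> integer_lattice" "f = wave l" by blast
  have "(\<lambda>x. wave k x * (c * f x + h x)) = (\<lambda>x. c * wave (k + l) x + wave k x * h x)"
    by (auto simp: l wave_add_left algebra_simps)
  then show ?case
    using lspan_step l assms(2) by (auto intro!: lspan.lspan_step integer_lattice_add)
qed (simp add: lspan_zero)

lemma trig_mult:
  assumes "f \<in> trig_polynomials" "g \<in> trig_polynomials"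
  shows "(\<lambda>x. f x * g x) \<in> trig_polynomials"
  using assms(1)
proof (induction rule: lspan.induct)
  case (lspan_step f h c)
  then obtain l where l: "l \<in> integer_lattice" "f = wave l" by blast
  have "(\<lambda>x. (c * f x + h x) * g x) = (\<lambda>x. c * (wave l x * g x) + h x * g x)"
    by (auto simp: l algebra_simps)
  then show ?case
    using lspan_add[OF lspan_scale[OF wave_mult_trig[OF assms(2) l(1)], of c] lspan_step.IH] by simp
qed (simp add: lspan_zero)

lemma trig_periodic:
  assumes "f \<in> trig_polynomials" "k \<in> integer_lattice"
  shows "f (x + k) = f x"
  using assms(1) by (induction rule: lspan.induct) (auto simp: wave_periodic assms(2))

lemma trig_measurable: "f \<in> trig_polynomials \<Longrightarrow> f \<in> borel_measurable lebesgue"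
  by (induction rule: lspan.induct) auto

lemma trig_tile_lspan:
  "f \<in> trig_polynomials \<Longrightarrow> (\<lambda>x. f x * indicator K x) \<in> lspan (tile_wave K ` integer_lattice)"
proof (induction rule: lspan.induct)
  case (lspan_step f h c)
  then obtain l where l: "l \<in> integer_lattice" "f = wave l" by blast
  have "(\<lambda>x. (c * f x + h x) * indicator K x) = (\<lambda>x. c * tile_wave K l x + h x * indicator K x)"
    by (auto simp: l tile_wave_def algebra_simps)
  then show ?case using lspan_step l by (auto intro: lspan.lspan_step)
qed (simp add: lspan_zero)

lemma lspan_tile_trig:
  "s \<in> lspan (tile_wave K ` integer_lattice) \<Longrightarrow> \<exists>f\<in>trig_polynomials. s = (\<lambda>x. f x * indicator K x)"
proof (induction rule: lspan.induct)
  case lspan_zero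
  show ?case by (rule bexI[of _ "\<lambda>x. 0"]) (auto intro: lspan.lspan_zero)
next
  case (lspan_step g h c)
  then obtain f l where f: "f \<in> trig_polynomials" "h = (\<lambda>x. f x * indicator K x)"
    and l: "l \<in> integer_lattice" "g = tile_wave K l" by blast
  have "(\<lambda>x. c * wave l x + f x) \<in> trig_polynomials"
    by (rule lspan.lspan_step) (use f l in auto)
  then show ?case
    by (rule bexI[rotated]) (simp add: f l tile_wave_def algebra_simps)
qed

text \<open>The quotient of R^n by the integer lattice, realized as a compact subset of C^n.
  Stone-Weierstrass for real polynomials on this set yields periodic approximations, which a direct
  approximation on the cube would not.\<close>

definition torus_point :: "real^'n \<Rightarrow> complex^'n" where
  "torus_point x = (\<chi> i. cis (2 * pi * x $ i))"

lemma continuous_on_torus_point: "continuous_on S torus_point"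
  unfolding torus_point_def[abs_def] cis_conv_exp
  by (intro continuous_intros)

lemma torus_point_inj:
  assumes "x \<in> unit_cube" "y \<in> unit_cube" "torus_point x = torus_point y"
  shows "x = y"
proof -
  have "x $ i = y $ i" for i
  proof -
    have "cis (2 * pi * x $ i) = cis (2 * pi * y $ i)"
      using assms(3) by (simp add: torus_point_def vec_eq_iff)
    then have "cis (2 * pi * x $ i) / cis (2 * pi * y $ i) = 1" by simp
    then have "cis (2 * pi * (x $ i - y $ i)) = 1"
      by (simp add: cis_divide right_diff_distrib)
    then have "cos (2 * pi * (x $ i - y $ i)) = 1"
      by (simp add: complex_eq_iff)
    then obtain m where "2 * pi * (x $ i - y $ i) = of_int m * 2 * pi"
      by (auto simp: cos_one_2pi_int)
    then have m: "x $ i - y $ i = of_int m" by simp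
    have "0 \<le> x $ i" "x $ i < 1" "0 \<le> y $ i" "y $ i < 1"
      using assms(1,2) by (auto simp: unit_cube_def)
    with m have "m = 0" by linarith
    with m show ?thesis by simp
  qed
  then show ?thesis by (simp add: vec_eq_iff)
qed

lemma bounded_linear_complex_vec:
  fixes f :: "complex^'n \<Rightarrow> real"
  assumes "bounded_linear f"
  shows "f z = (\<Sum>i\<in>UNIV. Re (z $ i) * f (axis i 1) + Im (z $ i) * f (axis i \<i>))"
proof -
  interpret bounded_linear f by fact
  have "z = (\<Sum>i\<in>UNIV. Re (z $ i) *\<^sub>R axis i 1 + Im (z $ i) *\<^sub>R axis i \<i>)"
    by (simp add: vec_eq_iff axis_def complex_eq_iff sum.distrib if_distrib cong: if_cong)
  then have "f z = f (\<Sum>i\<in>UNIV. Re (z $ i) *\<^sub>R axis i 1 + Im (z $ i) *\<^sub>R axis i \<i>)"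
    by (rule arg_cong)
  then show ?thesis by (simp add: sum add scaleR)
qed

text \<open>A real-linear functional on C^n restricts to a combination of cosines and sines on the
  torus, and these are half-sums and half-differences of conjugate waves. Products are covered
  because trigonometric polynomials form an algebra.\<close>

lemma polynomial_torus_trig:
  assumes "real_polynomial_function p"
  shows "(\<lambda>x. complex_of_real (p (torus_point x))) \<in> trig_polynomials"
  using assms
proof (induction rule: real_polynomial_function.induct)
  case (linear f)
  have c: "(\<lambda>x. complex_of_real (Re (torus_point x $ i))) \<in> trig_polynomials"
    and s: "(\<lambda>x. complex_of_real (Im (torus_point x $ i))) \<in> trig_polynomials" for i :: 'a
  proof -
    let ?e = "axis i 1 :: real^'a"
    have w: "wave ?e x = torus_point x $ i" "wave (- ?e) x = cnj (torus_point x $ i)" for x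
      by (simp_all add: wave_def torus_point_def inner_axis' cis_cnj)
    have e: "?e \<in> integer_lattice" "- ?e \<in> integer_lattice"
      by (auto intro: integer_lattice_axis integer_lattice_uminus)
    have "(\<lambda>x. (1/2) * wave ?e x + (1/2) * wave (- ?e) x) \<in> trig_polynomials"
      "(\<lambda>x. (- \<i>/2) * wave ?e x + (\<i>/2) * wave (- ?e) x) \<in> trig_polynomials"
      by (intro lspan_add lspan_scale wave_trig e)+
    moreover have "(1/2) * z + (1/2) * cnj z = complex_of_real (Re z)"
      "(- \<i>/2) * z + (\<i>/2) * cnj z = complex_of_real (Im z)" for z
      by (simp_all add: complex_eq_iff)
    ultimately show "(\<lambda>x. complex_of_real (Re (torus_point x $ i))) \<in> trig_polynomials"
      "(\<lambda>x. complex_of_real (Im (torus_point x $ i))) \<in> trig_polynomials"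
      unfolding w by simp_all
  qed
  have "(\<lambda>x. \<Sum>i\<in>UNIV. of_real (f (axis i 1)) * of_real (Re (torus_point x $ i))
      + of_real (f (axis i \<i>)) * complex_of_real (Im (torus_point x $ i))) \<in> trig_polynomials"
    by (intro lspan_sum lspan_add lspan_scale c s) simp
  then show ?case
    by (subst bounded_linear_complex_vec[OF linear]) (simp add: mult.commute)
next
  case (const c)
  then show ?case
    using lspan_scale[OF wave_trig[OF integer_lattice_zero], of "complex_of_real c"] by simp
next
  case (add f g)
  then show ?case using lspan_add by (simp add: lspan_add)
next
  case (mult f g)
  then show ?case by (simp add: trig_mult)
qed

lemma tile_wave_subset: "lattice_tile K \<Longrightarrow> tile_wave K ` integer_lattice \<subseteq> L2_space"
  by (auto intro: tile_wave_L2)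

text \<open>The image D of C is closed, and inside the half-open cube the torus map is injective, so
  a point outside C has positive distance to D. The resulting approximations converge at every point
  of the cube.\<close>

lemma compact_indicator_closed_span:
  fixes C :: "(real^'n) set"
  assumes C: "compact C" "C \<subseteq> unit_cube"
  shows "indicator C \<in> L2_closed_span (tile_wave unit_cube ` integer_lattice)"
proof (cases "C = {}")
  case True
  then show ?thesis
    using closed_span_zero[OF tile_wave_subset[OF lattice_tile_unit_cube]] by (simp add: indicator_def[abs_def])
next
  case False
  define D where "D = torus_point ` C"
  have D: "closed D" "D \<noteq> {}"
    unfolding D_def using compact_continuous_image[OF continuous_on_torus_point C(1)] False
    by (auto intro: compact_imp_closed)
  define F where "F m z = max 0 (1 - real m * infdist z D)" for m :: nat and z
    \<comment> \<open>continuous on the torus and decreasing to the indicator of \<open>D\<close>, so Stone--Weierstrass applies\<close>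
  have T: "compact (torus_point ` cbox 0 (1 :: real^'n))"
    by (intro compact_continuous_image continuous_on_torus_point compact_cbox)
  have "\<exists>p. real_polynomial_function p \<and> (\<forall>z\<in>torus_point ` cbox 0 (1 :: real^'n). \<bar>F m z - p z\<bar> < 1 / (real m + 1))" for m
  proof -
    have "continuous_on (torus_point ` cbox 0 (1 :: real^'n)) (F m)"
      unfolding F_def by (intro continuous_intros)
    from Stone_Weierstrass_real_polynomial_function[OF T this, of "1 / (real m + 1)"]
    show ?thesis by (metis add_nonneg_pos divide_pos_pos of_nat_0_le_iff zero_less_one)
  qed
  then obtain p where p: "\<And>m. real_polynomial_function (p m)"
    and ap: "\<And>m z. z \<in> torus_point ` cbox 0 (1 :: real^'n) \<Longrightarrow> \<bar>F m z - p m z\<bar> < 1 / (real m + 1)"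
    by metis
  have ap': "\<bar>F m (torus_point x) - p m (torus_point x)\<bar> < 1 / (real m + 1)" if "x \<in> unit_cube" for m and x :: "real^'n"
    by (rule ap) (use that unit_cube_subset_cbox in blast)
  have F01: "0 \<le> F m z" "F m z \<le> 1" for m z
    by (auto simp: F_def infdist_nonneg)
  have Flim: "(\<lambda>m. F m (torus_point x)) \<longlonglongrightarrow> indicator C x" if x: "x \<in> unit_cube" for x
  proof (cases "x \<in> C")
    case True
    then have "infdist (torus_point x) D = 0" by (simp add: D_def)
    then show ?thesis using True by (simp add: F_def)
  next
    case notC: False
    have "torus_point x \<notin> D"
    proof
      assume "torus_point x \<in> D"
      then obtain y where "y \<in> C" "torus_point x = torus_point y" by (auto simp: D_def)
      with torus_point_inj[OF x, of y] C(2) notC show False by auto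
    qed
    then have d: "infdist (torus_point x) D > 0"
      by (rule infdist_pos_not_in_closed[OF D])
    then obtain N where N: "1 < real N * infdist (torus_point x) D"
      by (meson reals_Archimedean3)
    have "F m (torus_point x) = 0" if "m \<ge> N" for m
    proof -
      have "real N * infdist (torus_point x) D \<le> real m * infdist (torus_point x) D"
        using that d by (intro mult_right_mono) auto
      with N show ?thesis by (simp add: F_def)
    qed
    then show ?thesis
      using notC by (intro tendsto_eventually eventually_sequentiallyI[of N]) simp
  qed
  have lim1: "(\<lambda>m. 1 / (real m + 1)) \<longlonglongrightarrow> 0"
    using LIMSEQ_inverse_real_of_nat by (simp add: inverse_eq_divide add.commute)
  have plim: "(\<lambda>m. p m (torus_point x)) \<longlonglongrightarrow> indicator C x" if x: "x \<in> unit_cube" for x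
  proof -
    have "(\<lambda>m. F m (torus_point x) - p m (torus_point x)) \<longlonglongrightarrow> 0"
      by (rule Lim_null_comparison[OF _ lim1]) (use ap'[OF x] in \<open>auto intro!: always_eventually less_imp_le\<close>)
    from tendsto_diff[OF Flim[OF x] this] show ?thesis by simp
  qed
  show ?thesis
  proof (rule closed_span_dominated_limit[where
        h="\<lambda>m x. complex_of_real (p m (torus_point x)) * indicator unit_cube x"
        and w="\<lambda>x. 2 * indicator unit_cube x"])
    show "tile_wave unit_cube ` integer_lattice \<subseteq> L2_space"
      by (rule tile_wave_subset[OF lattice_tile_unit_cube])
    then show "(\<lambda>x. complex_of_real (p m (torus_point x)) * indicator unit_cube x)
        \<in> L2_closed_span (tile_wave unit_cube ` integer_lattice)" for m
      by (intro lspan_closed_span trig_tile_lspan polynomial_torus_trig p)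
    show "indicator C \<in> borel_measurable lebesgue"
      using C(1) by (intro borel_measurable_indicator lmeasurable_compact[THEN fmeasurableD])
    show "(\<lambda>x. 2 * indicator unit_cube x) \<in> L2_space"
      by (intro L2_scale tile_indicator_L2 lattice_tile_unit_cube)
    show "cmod (complex_of_real (p m (torus_point x)) * indicator unit_cube x) \<le> cmod (2 * indicator unit_cube x)" for m x
    proof (cases "x \<in> unit_cube")
      case True
      \<comment> \<open>Origin of the constant 2 in the dominating function: \<open>F\<close> has
        values in [0, 1], and the approximation error is less than 1.\<close>
      have "1 / (real m + 1) \<le> 1" by simp
      with ap'[OF True, of m] F01[of m "torus_point x"] have "\<bar>p m (torus_point x)\<bar> \<le> 2"
        by linarith
      with True show ?thesis by (simp add: norm_mult)
    qed simp
    show "AE x in lebesgue. (\<lambda>m. complex_of_real (p m (torus_point x)) * indicator unit_cube x) \<longlonglongrightarrow> indicator C x"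
    proof (intro AE_I2)
      fix x
      show "(\<lambda>m. complex_of_real (p m (torus_point x)) * indicator unit_cube x) \<longlonglongrightarrow> indicator C x"
      proof (cases "x \<in> unit_cube")
        case True
        from tendsto_of_real[OF plim[OF True], where 'a=complex] True show ?thesis
          by (simp add: indicator_def of_bool_def split: if_splits)
      next
        case False
        then have "x \<notin> C" using C(2) by blast
        with False show ?thesis by simp
      qed
    qed
  qed
qed

text \<open>Inner regularity: a measurable subset of the cube is bounded, so closed sets filling it
  up to \<epsilon> are compact.\<close>

lemma indicator_closed_span_cube:
  assumes S: "S \<in> sets lebesgue" "S \<subseteq> unit_cube"
  shows "indicator S \<in> L2_closed_span (tile_wave unit_cube ` integer_lattice)"
proof (rule closed_span_limit[OF tile_wave_subset[OF lattice_tile_unit_cube]])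
  have "bounded S" using S(2) unit_cube_subset_cbox by (meson bounded_cbox bounded_subset)
  then have Sm: "S \<in> lmeasurable" using S(1) by (rule bounded_set_imp_lmeasurable)
  then show "indicator S \<in> L2_space" by (rule L2_indicator)
  fix \<epsilon> :: real assume "\<epsilon> > 0"
  with S(1) obtain T where T: "closed T" "T \<subseteq> S" "S - T \<in> lmeasurable" "emeasure lebesgue (S - T) < ennreal \<epsilon>"
    by (rule sets_lebesgue_inner_closed)
  have "compact T" using T(1,2) \<open>bounded S\<close> by (meson bounded_subset compact_eq_bounded_closed)
  then have "indicator T \<in> L2_closed_span (tile_wave unit_cube ` integer_lattice)"
    using T(2) S(2) by (intro compact_indicator_closed_span) auto
  moreover have "(\<lambda>x. indicator S x - indicator T x :: complex) = indicator (S - T)"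
    by (rule ext) (use T(2) in \<open>auto simp: indicator_def\<close>)
  then have "energy (\<lambda>x. indicator S x - indicator T x) < ennreal \<epsilon>"
    using T(3,4) by (simp add: energy_indicator fmeasurableD)
  ultimately show "\<exists>h\<in>L2_closed_span (tile_wave unit_cube ` integer_lattice). energy (\<lambda>x. indicator S x - h x) < ennreal \<epsilon>"
    by blast
qed

text \<open>Completeness is carried from the cube to K by periodizing S to P. A trigonometric
  polynomial close to the indicator of P on the cube is equally close on K, because the error is
  periodic and its energy is the same over both tiles.\<close>

lemma tile_indicator_closed_span:
  assumes K: "lattice_tile K" and S: "S \<in> sets lebesgue" "S \<subseteq> K"
  shows "indicator S \<in> L2_closed_span (tile_wave K ` integer_lattice)"
  unfolding L2_closed_span_def
proof (intro CollectI conjI allI impI)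
  show "indicator S \<in> L2_space"
    using tile_lmeasurable[OF K] S by (intro L2_indicator) (blast intro: fmeasurableI2)
  define P where "P = (\<Union>m. (\<lambda>x. lattice_enum m + x) ` S)"
  have P: "P \<in> sets lebesgue"
    unfolding P_def using lebesgue_sets_translation[OF S(1)] by (intro sets.countable_UN) auto
  have P_iff: "x \<in> P \<longleftrightarrow> (\<exists>k\<in>integer_lattice. x + k \<in> S)" for x
  proof
    assume "x \<in> P"
    then obtain m y where "y \<in> S" "x = lattice_enum m + y" by (auto simp: P_def)
    then show "\<exists>k\<in>integer_lattice. x + k \<in> S"
      using integer_lattice_uminus[OF lattice_enum_in[of m]] by (intro bexI[of _ "- lattice_enum m"]) auto
  next
    assume "\<exists>k\<in>integer_lattice. x + k \<in> S"
    then obtain k where k: "k \<in> integer_lattice" "x + k \<in> S" by blast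
    then obtain m where "- k = lattice_enum m"
      using integer_lattice_uminus[OF k(1)] unfolding range_lattice_enum[symmetric] by blast
    then have "x = lattice_enum m + (x + k)" by (simp add: \<open>- k = lattice_enum m\<close>[symmetric])
    with k(2) show "x \<in> P" unfolding P_def by blast
  qed
  have P_per: "x + k \<in> P \<longleftrightarrow> x \<in> P" if k: "k \<in> integer_lattice" for x k
  proof -
    have "(\<exists>l\<in>integer_lattice. x + k + l \<in> S) \<longleftrightarrow> (\<exists>l\<in>integer_lattice. x + l \<in> S)"
    proof
      assume "\<exists>l\<in>integer_lattice. x + k + l \<in> S"
      then obtain l where "l \<in> integer_lattice" "x + k + l \<in> S" by blast
      then show "\<exists>l\<in>integer_lattice. x + l \<in> S"
        using integer_lattice_add[OF k] by (intro bexI[of _ "k + l"]) (auto simp: add.assoc)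
    next
      assume "\<exists>l\<in>integer_lattice. x + l \<in> S"
      then obtain l where "l \<in> integer_lattice" "x + l \<in> S" by blast
      then show "\<exists>l\<in>integer_lattice. x + k + l \<in> S"
        using integer_lattice_diff[OF _ k] by (intro bexI[of _ "l - k"]) (auto simp: algebra_simps)
    qed
    then show ?thesis by (simp add: P_iff)
  qed
  \<comment> \<open>P meets K in S only: a point of P in K has a translate in S, hence in K, and K
    contains a single point of each coset.\<close>
  have PK: "indicator S x = (indicator P x * indicator K x :: complex)" for x
  proof (cases "x \<in> K \<and> x \<in> P")
    case True
    then obtain k where k: "k \<in> integer_lattice" "x + k \<in> S" by (auto simp: P_iff)
    have "x + k \<in> K" "x + 0 \<in> K" using k(2) S(2) True by auto
    then have "k = 0"
      using K k(1) integer_lattice_zero unfolding lattice_tile_def by metis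
    with k(2) True show ?thesis by simp
  next
    case False
    then have "x \<notin> S"
      using S(2) P_iff[of x] integer_lattice_zero by (metis add_0_right subsetD)
    with False show ?thesis by auto
  qed
  fix \<epsilon> :: real assume e: "\<epsilon> > 0"
  have "indicator (P \<inter> unit_cube) \<in> L2_closed_span (tile_wave unit_cube ` integer_lattice)"
    using P lattice_tile_sets[OF lattice_tile_unit_cube] by (intro indicator_closed_span_cube) auto
  from closed_spanD[OF this e] obtain s where
    s: "s \<in> lspan (tile_wave unit_cube ` integer_lattice)" "energy (\<lambda>x. indicator (P \<inter> unit_cube) x - s x) < ennreal \<epsilon>"
    by blast
  from lspan_tile_trig[OF s(1)] obtain f where f: "f \<in> trig_polynomials" "s = (\<lambda>x. f x * indicator unit_cube x)"
    by blast
  have "energy (\<lambda>x. indicator S x - f x * indicator K x) = energy (\<lambda>x. (indicator P x - f x) * indicator K x)"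
    by (simp add: PK algebra_simps)
  also have "\<dots> = energy (\<lambda>x. (indicator P x - f x) * indicator unit_cube x)"
  proof (rule energy_lattice_tile[OF K lattice_tile_unit_cube])
    show "(\<lambda>x. indicator P x - f x) \<in> borel_measurable lebesgue"
      by (intro borel_measurable_diff borel_measurable_indicator P trig_measurable f)
  qed (use f(1) in \<open>simp add: P_per trig_periodic indicator_def\<close>)
  also have "\<dots> = energy (\<lambda>x. indicator (P \<inter> unit_cube) x - s x)"
    by (simp add: f(2) indicator_inter_arith algebra_simps)
  also note s(2)
  finally show "\<exists>s\<in>lspan (tile_wave K ` integer_lattice). energy (\<lambda>x. indicator S x - s x) < ennreal \<epsilon>"
    by (rule bexI[OF _ trig_tile_lspan[OF f(1)]])
qed

lemma tile_closed_span:
  assumes K: "lattice_tile K" and f: "f \<in> L2_space"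
  shows "(\<lambda>x. f x * indicator K x) \<in> L2_closed_span (tile_wave K ` integer_lattice)"
  by (rule closed_span_mult_indicator[OF tile_wave_subset[OF K] lattice_tile_sets[OF K] f])
     (auto intro: tile_indicator_closed_span[OF K])

text \<open>The coefficients of f against waves cut off to K see only the restriction of f to K, so
  Parseval returns the energy of that restriction.\<close>

lemma tile_parseval:
  assumes K: "lattice_tile K" and f: "f \<in> L2_space"
  shows "(\<Sum>m. ennreal ((cmod (L2_inner f (tile_wave K (lattice_enum m))))\<^sup>2)) = energy (\<lambda>x. f x * indicator K x)"
proof -
  let ?g = "\<lambda>m. tile_wave K (lattice_enum m)"
  have "range ?g = tile_wave K ` integer_lattice"
    unfolding range_lattice_enum[symmetric] by (rule image_image[symmetric])
  moreover have "L2_orthonormal UNIV ?g"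
    using tile_wave_orthonormal[OF K] by (auto simp: L2_orthonormal_def lattice_enum_in lattice_enum_inj)
  ultimately have "(\<Sum>m. ennreal ((cmod (L2_inner (\<lambda>x. f x * indicator K x) (?g m)))\<^sup>2)) = energy (\<lambda>x. f x * indicator K x)"
    by (intro L2_parseval) (simp_all add: tile_closed_span[OF K f])
  moreover have "L2_inner (\<lambda>x. f x * indicator K x) (?g m) = L2_inner f (?g m)" for m
    unfolding L2_inner_def by (rule Bochner_Integration.integral_cong) (auto simp: tile_wave_def indicator_def)
  ultimately show ?thesis by simp
qed

subsection \<open>Plancherel's theorem\<close>

lemma sigma_finite_lebesgue: "sigma_finite_measure (lebesgue :: 'a::euclidean_space measure)"
proof
  obtain A :: "'a set set" where A: "countable A" "A \<subseteq> sets lborel" "\<Union>A = space lborel" "\<forall>a\<in>A. emeasure lborel a \<noteq> \<infinity>"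
    using sigma_finite_measure.sigma_finite_countable[OF sigma_finite_lborel] by metis
  show "\<exists>A::'a set set. countable A \<and> A \<subseteq> sets lebesgue \<and> \<Union>A = space lebesgue \<and> (\<forall>a\<in>A. emeasure lebesgue a \<noteq> \<infinity>)"
  proof (intro exI[of _ A] conjI ballI)
    fix a assume "a \<in> A"
    with A have "a \<in> sets lborel" "emeasure lborel a \<noteq> \<infinity>" by auto
    then show "emeasure lebesgue a \<noteq> \<infinity>" by simp
  qed (use A in auto)
qed

lemma pair_sigma_finite_lebesgue:
  "pair_sigma_finite (lebesgue :: 'a::euclidean_space measure) (lebesgue :: 'b::euclidean_space measure)"
  by (intro pair_sigma_finite.intro sigma_finite_lebesgue)

lemma lebesgue_pair_measurable_wave [measurable]:
  "(\<lambda>p. wave (fst p) (snd p)) \<in> borel_measurable (lebesgue \<Otimes>\<^sub>M lebesgue)"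
proof -
  have id: "(\<lambda>x. x) \<in> lebesgue \<rightarrow>\<^sub>M (borel :: (real^'a) measure)"
    by (rule measurable_completion) simp
  have f: "(\<lambda>p. fst p) \<in> (lebesgue :: (real^'a) measure) \<Otimes>\<^sub>M (lebesgue :: (real^'a) measure) \<rightarrow>\<^sub>M borel"
    by (rule measurable_compose[OF measurable_fst id])
  have s: "(\<lambda>p. snd p) \<in> (lebesgue :: (real^'a) measure) \<Otimes>\<^sub>M (lebesgue :: (real^'a) measure) \<rightarrow>\<^sub>M borel"
    by (rule measurable_compose[OF measurable_snd id])
  have c: "(\<lambda>t::real. cis (2 * pi * t)) \<in> borel_measurable borel"
    unfolding cis_conv_exp by (intro borel_measurable_continuous_onI continuous_intros)
  show ?thesis
    unfolding wave_def by (rule measurable_compose[OF borel_measurable_inner[OF f s] c])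
qed

text \<open>The exponent carries a plus sign: multiplication of h by \<open>wave k\<close> then
  translates the transform by +k, which is the form of the translations in
  \<open>wavelet_system\<close>.\<close>

definition fourier :: "(real^'n \<Rightarrow> complex) \<Rightarrow> real^'n \<Rightarrow> complex" where
  "fourier h x = (LINT t|lebesgue. h t * wave x t)"

text \<open>The class on which the transform is a convergent integral. Truncations, tile waves and
  their dilates all belong to it, so the abstract extension of the transform to L2 is
  avoided.\<close>

definition L12 :: "(real^'n \<Rightarrow> complex) set" where
  "L12 = {h \<in> L2_space. integrable lebesgue h}"

lemma L12_L2: "h \<in> L12 \<Longrightarrow> h \<in> L2_space"
  and L12_integrable: "h \<in> L12 \<Longrightarrow> integrable lebesgue h"
  by (auto simp: L12_def)

lemma L12_combine: "f \<in> L12 \<Longrightarrow> h \<in> L12 \<Longrightarrow> (\<lambda>x. c * f x + h x) \<in> L12"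
  unfolding L12_def by (simp add: L2_add L2_scale)

lemma L12_diff: "f \<in> L12 \<Longrightarrow> h \<in> L12 \<Longrightarrow> (\<lambda>x. f x - h x) \<in> L12"
  unfolding L12_def by (simp add: L2_diff)

lemma L12_cnj: "f \<in> L12 \<Longrightarrow> (\<lambda>x. cnj (f x)) \<in> L12"
  unfolding L12_def
  by (rule CollectI, rule conjI, rule L2_cnj, simp, rule integrable_bounded_linear[OF bounded_linear_cnj], simp)

lemma L12_bounded:
  assumes "g \<in> L12" "f \<in> borel_measurable lebesgue" "\<And>x. cmod (f x) \<le> cmod (g x)"
  shows "f \<in> L12"
proof -
  have "integrable lebesgue f"
    by (rule Bochner_Integration.integrable_bound[OF L12_integrable[OF assms(1)] assms(2)]) (simp add: assms(3))
  with L2_bounded[OF L12_L2[OF assms(1)] assms(2,3)] show ?thesis by (simp add: L12_def)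
qed

lemma L12_mult_indicator: "f \<in> L12 \<Longrightarrow> S \<in> sets lebesgue \<Longrightarrow> (\<lambda>x. f x * indicator S x) \<in> L12"
proof (rule L12_bounded[of f])
  assume "f \<in> L12" "S \<in> sets lebesgue"
  then show "(\<lambda>x. f x * indicator S x) \<in> borel_measurable lebesgue"
    by (intro L2_spaceD L2_mult_indicator L12_L2)
qed (auto simp: indicator_def)

lemma L2_finite_measure_L12:
  assumes "f \<in> L2_space" "S \<in> lmeasurable"
  shows "(\<lambda>x. f x * indicator S x) \<in> L12"
proof -
  have "cnj (indicator S x) = indicator S x" for x
    by (simp add: indicator_def)
  with integrable_L2_mult[OF assms(1) L2_indicator[OF assms(2)]] show ?thesis
    using assms by (simp add: L12_def L2_mult_indicator fmeasurableD)
qed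

lemma L12_wave: "h \<in> L12 \<Longrightarrow> (\<lambda>t. h t * wave x t) \<in> L12"
proof (rule L12_bounded[of h])
  assume "h \<in> L12"
  then have [measurable]: "h \<in> borel_measurable lebesgue" by (intro L2_spaceD L12_L2)
  show "(\<lambda>t. h t * wave x t) \<in> borel_measurable lebesgue" by measurable
qed (auto simp: norm_mult)

lemma L12_matrix:
  fixes M :: "real^'n^'n"
  assumes "invertible M" "h \<in> L12"
  shows "(\<lambda>x. h (M *v x)) \<in> L12"
proof -
  have "(\<integral>\<^sup>+x. ennreal (cmod (h x)) \<partial>lebesgue) = ennreal \<bar>det M\<bar> * (\<integral>\<^sup>+x. ennreal (cmod (h (M *v x))) \<partial>lebesgue)"
    using assms(1) L2_spaceD[OF L12_L2[OF assms(2)]] by (intro nn_integral_matrix) auto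
  moreover have "(\<integral>\<^sup>+x. ennreal (cmod (h x)) \<partial>lebesgue) < \<infinity>"
    using assms(2) by (simp add: L12_def integrable_iff_bounded)
  moreover have "ennreal \<bar>det M\<bar> \<noteq> 0" using assms(1) by (simp add: invertible_det_nz)
  ultimately have "(\<integral>\<^sup>+x. ennreal (cmod (h (M *v x))) \<partial>lebesgue) < \<infinity>"
    by (auto simp: ennreal_mult_less_top)
  moreover have "(\<lambda>x. h (M *v x)) \<in> L2_space"
    using assms by (intro L2_matrix L12_L2)
  ultimately show ?thesis
    using L2_spaceD unfolding L12_def integrable_iff_bounded by simp
qed

lemma fourier_combine:
  assumes "f \<in> L12" "h \<in> L12"
  shows "fourier (\<lambda>x. c * f x + h x) = (\<lambda>x. c * fourier f x + fourier h x)"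
proof
  fix x
  have i: "integrable lebesgue (\<lambda>t. f t * wave x t)" "integrable lebesgue (\<lambda>t. h t * wave x t)"
    by (intro L12_integrable L12_wave assms)+
  have "fourier (\<lambda>x. c * f x + h x) x = (LINT t|lebesgue. c * (f t * wave x t) + h t * wave x t)"
    by (simp add: fourier_def algebra_simps)
  also have "\<dots> = c * fourier f x + fourier h x"
    using i by (simp add: fourier_def)
  finally show "fourier (\<lambda>x. c * f x + h x) x = c * fourier f x + fourier h x" .
qed

lemma fourier_diff:
  assumes "f \<in> L12" "h \<in> L12"
  shows "fourier (\<lambda>x. f x - h x) = (\<lambda>x. fourier f x - fourier h x)"
  using fourier_combine[OF assms(2,1), of "-1"] by (simp add: algebra_simps)

lemma fourier_measurable [measurable]:
  assumes [measurable]: "h \<in> borel_measurable lebesgue"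
  shows "fourier h \<in> borel_measurable lebesgue"
proof -
  interpret sigma_finite_measure "lebesgue :: (real^'a) measure" by (rule sigma_finite_lebesgue)
  have "(\<lambda>(x, t). h t * wave x t) \<in> borel_measurable (lebesgue \<Otimes>\<^sub>M lebesgue)"
    unfolding split_beta by measurable
  then have "(\<lambda>x. LINT t|lebesgue. h t * wave x t) \<in> borel_measurable lebesgue"
    by (rule borel_measurable_lebesgue_integral)
  then show ?thesis by (simp add: fourier_def[abs_def])
qed

lemma inner_matrix_transpose: "(transpose A *v x) \<bullet> y = x \<bullet> (A *v y)" for A :: "real^'n^'n"
  by (simp add: dot_lmul_matrix)

lemma matrix_inv_inverse:
  assumes "invertible M"
  shows "M ** matrix_inv M = mat 1" "matrix_inv M ** M = mat 1"
  using someI_ex[OF assms[unfolded invertible_def]] unfolding matrix_inv_def by auto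

lemma invertible_matrix_inv: "invertible M \<Longrightarrow> invertible (matrix_inv M)"
  using matrix_inv_inverse[of M] unfolding invertible_def by blast

lemma matrix_inv_vector:
  fixes M :: "'a::semiring_1^'n^'n"
  assumes "invertible M"
  shows "M *v (matrix_inv M *v x) = x" "matrix_inv M *v (M *v x) = x"
  by (simp_all add: matrix_vector_mul_assoc matrix_inv_inverse[OF assms])

lemma det_matrix_inv:
  fixes M :: "real^'n^'n"
  assumes "invertible M"
  shows "det (matrix_inv M) = 1 / det M"
  using arg_cong[OF matrix_inv_inverse(1)[OF assms], of det] assms
  by (simp add: det_mul invertible_det_nz field_simps)

lemma fourier_matrix:
  fixes M :: "real^'n^'n"
  assumes M: "invertible M" and h: "h \<in> borel_measurable lebesgue"
  shows "fourier h (transpose (matrix_inv M) *v x) = of_real \<bar>det M\<bar> * fourier (\<lambda>t. h (M *v t)) x"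
proof -
  let ?N = "matrix_inv M"
  have "wave (transpose ?N *v x) (M *v t) = wave x t" for t
    unfolding wave_def inner_matrix_transpose by (simp add: matrix_inv_vector[OF M])
  moreover have "fourier h (transpose ?N *v x)
      = of_real \<bar>det M\<bar> * (LINT t|lebesgue. h (M *v t) * wave (transpose ?N *v x) (M *v t))"
    unfolding fourier_def using h by (intro integral_matrix[OF M]) auto
  ultimately show ?thesis by (simp add: fourier_def)
qed

lemma fourier_translate:
  assumes h: "h \<in> borel_measurable lebesgue"
  shows "fourier (\<lambda>t. h (v + t)) x = wave x (- v) * fourier h x"
proof -
  have [measurable]: "(\<lambda>t. wave x (t - v)) \<in> borel_measurable lebesgue"
    using measurable_translate_comp[of "wave x" "- v"] by simp
  have m: "(\<lambda>t. h t * wave x (t - v)) \<in> borel_measurable lebesgue"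
    using h by measurable
  have "fourier (\<lambda>t. h (v + t)) x = (LINT t|lebesgue. h (v + t) * wave x ((v + t) - v))"
    by (simp add: fourier_def)
  also have "\<dots> = (LINT t|lebesgue. h t * wave x (t - v))"
    by (rule integral_translate[OF m])
  also have "\<dots> = (LINT t|lebesgue. wave x (- v) * (h t * wave x t))"
    using wave_add_right[of x _ "- v"] by (intro Bochner_Integration.integral_cong) (auto simp: algebra_simps)
  finally show ?thesis by (simp add: fourier_def)
qed

lemma plancherel_unit_cube:
  assumes h: "h \<in> L2_space" and supp: "\<And>x. x \<notin> unit_cube \<Longrightarrow> h x = 0"
  shows "energy (fourier h) = energy h"
proof -
  let ?Q = "unit_cube :: (real^'a) set"
  note Q = lattice_tile_unit_cube
  note [measurable] = L2_spaceD[OF h] lattice_tile_sets[OF Q]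
  let ?\<phi> = "\<lambda>x. ennreal ((cmod (fourier h x))\<^sup>2)"
  have \<phi>[measurable]: "?\<phi> \<in> borel_measurable lebesgue" by measurable
  have \<phi>s[measurable]: "(\<lambda>x. ?\<phi> (x - a)) \<in> borel_measurable lebesgue" for a
    using measurable_translate_comp[OF \<phi>, of "- a"] by simp
  have ind[measurable]: "(\<lambda>x. indicator ?Q (x + a) :: ennreal) \<in> borel_measurable lebesgue" for a
    using measurable_translate_comp[of "indicator ?Q :: _ \<Rightarrow> ennreal" a] by (simp add: add.commute)
  have inner: "(\<Sum>m. ?\<phi> (x - lattice_enum m)) = energy h" for x
  proof -
    have hw: "(\<lambda>t. h t * wave x t) \<in> L2_space"
      by (rule L2_bounded[OF h]) (auto simp: norm_mult)
    \<comment> \<open>The values of the transform on the shifted frequency lattice through x are the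
      Fourier coefficients on the cube of h modulated by x. Parseval therefore gives the same sum
      for every x.\<close>
    have "L2_inner (\<lambda>t. h t * wave x t) (tile_wave ?Q k) = fourier h (x - k)" for k
      unfolding L2_inner_def fourier_def
    proof (rule Bochner_Integration.integral_cong[OF refl])
      fix t
      have "wave (x - k) t = wave x t * cnj (wave k t)"
        using wave_add_left[of x "- k" t] by (simp add: cnj_wave)
      then show "h t * wave x t * cnj (tile_wave ?Q k t) = h t * wave (x - k) t"
        using supp[of t] by (cases "t \<in> ?Q") (auto simp: tile_wave_def)
    qed
    then have "(\<Sum>m. ?\<phi> (x - lattice_enum m)) = energy (\<lambda>t. h t * wave x t * indicator ?Q t)"
      using tile_parseval[OF Q hw] by simp
    also have "\<dots> = energy h"
      by (rule energy_cong_AE) (use supp in \<open>auto simp: norm_mult indicator_def intro!: AE_I2\<close>)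
    finally show ?thesis .
  qed
  have shift: "(\<integral>\<^sup>+x. ?\<phi> x * indicator ?Q (x + lattice_enum m) \<partial>lebesgue)
      = (\<integral>\<^sup>+x. ?\<phi> (x - lattice_enum m) * indicator ?Q x \<partial>lebesgue)" for m
  proof -
    have "(\<integral>\<^sup>+x. ?\<phi> x * indicator ?Q (x + lattice_enum m) \<partial>lebesgue)
        = (\<integral>\<^sup>+x. ?\<phi> (- lattice_enum m + x) * indicator ?Q ((- lattice_enum m + x) + lattice_enum m) \<partial>lebesgue)"
      by (rule nn_integral_translate[symmetric]) measurable
    then show ?thesis by simp
  qed
  \<comment> \<open>The integral over frequency space is cut into translates of the cube and folded
    onto one of them, where the integrand has become constant.\<close>
  have "energy (fourier h) = (\<integral>\<^sup>+x. (\<Sum>m. ?\<phi> x * indicator ?Q (x + lattice_enum m)) \<partial>lebesgue)"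
    unfolding energy_def by (intro nn_integral_cong) (simp add: lattice_tile_suminf(1)[OF Q])
  also have "\<dots> = (\<Sum>m. \<integral>\<^sup>+x. ?\<phi> x * indicator ?Q (x + lattice_enum m) \<partial>lebesgue)"
    by (rule nn_integral_suminf) measurable
  also have "\<dots> = (\<Sum>m. \<integral>\<^sup>+x. ?\<phi> (x - lattice_enum m) * indicator ?Q x \<partial>lebesgue)"
    by (simp only: shift)
  also have "\<dots> = (\<integral>\<^sup>+x. (\<Sum>m. ?\<phi> (x - lattice_enum m) * indicator ?Q x) \<partial>lebesgue)"
    by (rule nn_integral_suminf[symmetric]) measurable
  also have "\<dots> = (\<integral>\<^sup>+x. energy h * indicator ?Q x \<partial>lebesgue)"
    by (intro nn_integral_cong) (simp only: ennreal_suminf_multc inner)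
  also have "\<dots> = energy h * emeasure lebesgue ?Q"
    by (rule nn_integral_cmult_indicator) measurable
  also have "emeasure lebesgue ?Q = 1"
    using energy_indicator_tile[OF Q] by (simp add: energy_indicator lattice_tile_sets[OF Q])
  finally show ?thesis by simp
qed

text \<open>The frequency change contributes the Jacobian 1/|det M| and the transform formula the
  factor |det M|^2; what remains is |det M|, the Jacobian in the original variable. With a scalar M
  this passes from the unit cube to larger ones.\<close>

lemma plancherel_matrix:
  fixes M :: "real^'n^'n"
  assumes M: "invertible M" and h: "h \<in> borel_measurable lebesgue"
    and eq: "energy (fourier (\<lambda>t. h (M *v t))) = energy (\<lambda>t. h (M *v t))"
  shows "energy (fourier h) = energy h"
proof -
  let ?N = "transpose (matrix_inv M)"
  have N: "invertible ?N" using M by (intro transpose_invertible invertible_matrix_inv)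
  have dM: "\<bar>det M\<bar> > 0" using M by (simp add: invertible_det_nz)
  have "energy (fourier h) = ennreal \<bar>det ?N\<bar> * energy (\<lambda>x. fourier h (?N *v x))"
    using h by (intro energy_matrix[OF N]) measurable
  also have "energy (\<lambda>x. fourier h (?N *v x)) = energy (\<lambda>x. of_real \<bar>det M\<bar> * fourier (\<lambda>t. h (M *v t)) x)"
    by (simp only: fourier_matrix[OF M h])
  also have "\<dots> = ennreal ((cmod (of_real \<bar>det M\<bar>))\<^sup>2) * energy (fourier (\<lambda>t. h (M *v t)))"
    using measurable_matrix_comp[OF M h] by (intro energy_scale) measurable
  also have "ennreal \<bar>det ?N\<bar> * \<dots> = ennreal \<bar>det M\<bar> * energy (\<lambda>t. h (M *v t))"
  proof -
    have "\<bar>det ?N\<bar> * (cmod (of_real \<bar>det M\<bar>))\<^sup>2 = \<bar>det M\<bar>"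
    proof -
      have "\<bar>det ?N\<bar> = 1 / \<bar>det M\<bar>" by (simp add: det_matrix_inv[OF M])
      then show ?thesis
        unfolding norm_of_real abs_abs power2_eq_square using dM by (simp del: abs_mult_self_eq)
    qed
    then have "ennreal \<bar>det ?N\<bar> * ennreal ((cmod (of_real \<bar>det M\<bar>))\<^sup>2) = ennreal \<bar>det M\<bar>"
      by (subst ennreal_mult[symmetric]) auto
    then show ?thesis by (simp only: eq mult.assoc[symmetric])
  qed
  also have "\<dots> = energy h" by (rule energy_matrix[OF M h, symmetric])
  finally show ?thesis .
qed

lemma plancherel_translate:
  assumes h: "h \<in> borel_measurable lebesgue"
    and eq: "energy (fourier (\<lambda>t. h (v + t))) = energy (\<lambda>t. h (v + t))"
  shows "energy (fourier h) = energy h"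
proof -
  have "energy (fourier h) = energy (fourier (\<lambda>t. h (v + t)))"
    by (rule energy_cong_AE) (simp add: fourier_translate[OF h] norm_mult)
  then show ?thesis by (simp add: eq energy_translate[OF h])
qed

text \<open>An exhaustion by cubes that are affine images of \<open>unit_cube\<close>. N + 1 in
  place of N keeps the scaling invertible at N = 0.\<close>

definition big_cube :: "nat \<Rightarrow> (real^'n) set" where
  "big_cube N = {x. \<forall>i. - (real N + 1) \<le> x $ i \<and> x $ i < real N + 1}"

lemma mat_vector_scale: "mat r *v x = r *\<^sub>R x" for x :: "real^'n"
  by (simp add: matrix_vector_mult_def mat_def vec_eq_iff if_distrib[of "\<lambda>a. a * _"] cong: if_cong)

lemma invertible_mat: "r \<noteq> 0 \<Longrightarrow> invertible (mat r :: real^'n^'n)"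
  unfolding invertible_def
  by (intro exI[of _ "mat (1 / r)"]) (simp add: matrix_eq matrix_vector_mul_assoc[symmetric] mat_vector_scale)

lemma big_cube_eq:
  "t \<in> unit_cube \<longleftrightarrow> (\<chi> i. - (real N + 1)) + mat (2 * (real N + 1)) *v t \<in> big_cube N" for t :: "real^'n"
proof -
  have "0 \<le> a \<and> a < 1 \<longleftrightarrow> - b \<le> - b + 2 * b * a \<and> - b + 2 * b * a < b" if "b > 0" for a b :: real
  proof -
    have "- b + 2 * b * a < b \<longleftrightarrow> 2 * b * (a - 1) < 0" by (simp add: algebra_simps)
    with that show ?thesis by (simp add: zero_le_mult_iff mult_less_0_iff)
  qed
  from this[of "real N + 1"]
  have "0 \<le> a \<and> a < 1 \<longleftrightarrow> - (real N + 1) \<le> - (real N + 1) + 2 * (real N + 1) * a \<and>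
      - (real N + 1) + 2 * (real N + 1) * a < real N + 1" for a :: real by simp
  then show ?thesis
    unfolding unit_cube_def big_cube_def mem_Collect_eq mat_vector_scale vector_add_component
      vec_lambda_beta vector_scaleR_component by simp
qed

lemma plancherel_big_cube:
  assumes h: "h \<in> L2_space" and supp: "\<And>x. x \<notin> big_cube N \<Longrightarrow> h x = 0"
  shows "energy (fourier h) = energy h"
proof -
  let ?v = "(\<chi> i. - (real N + 1)) :: real^'a" and ?M = "mat (2 * (real N + 1)) :: real^'a^'a"
  have M: "invertible ?M" by (rule invertible_mat) simp
  have h': "(\<lambda>t. h (?v + t)) \<in> L2_space" by (rule L2_translate[OF h])
  show ?thesis
  proof (rule plancherel_translate[of h ?v], rule L2_spaceD[OF h], rule plancherel_matrix[OF M])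
    show "(\<lambda>t. h (?v + t)) \<in> borel_measurable lebesgue" using h' by (rule L2_spaceD)
    show "energy (fourier (\<lambda>t. h (?v + ?M *v t))) = energy (\<lambda>t. h (?v + ?M *v t))"
    proof (rule plancherel_unit_cube)
      show "(\<lambda>t. h (?v + ?M *v t)) \<in> L2_space" using L2_matrix[OF M h'] .
      show "h (?v + ?M *v t) = 0" if "t \<notin> unit_cube" for t
        by (rule supp) (use that big_cube_eq[of t N] in blast)
    qed
  qed
qed

lemma big_cube_lmeasurable: "big_cube N \<in> lmeasurable"
proof (rule bounded_set_imp_lmeasurable)
  have "big_cube N = (\<Inter>i. {x::real^'a. - (real N + 1) \<le> x $ i} \<inter> {x. x $ i < real N + 1})"
    by (auto simp: big_cube_def)
  also have "\<dots> \<in> sets borel"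
    by (intro sets.finite_INT sets.Int borel_closed borel_open closed_Collect_le open_Collect_less continuous_intros) auto
  finally show "big_cube N \<in> sets (lebesgue :: (real^'a) measure)" by auto
  show "bounded (big_cube N :: (real^'a) set)"
    by (rule bounded_subset[OF bounded_cbox[of "\<chi> i. - (real N + 1)" "\<chi> i. real N + 1"]])
       (auto simp: big_cube_def mem_box_cart less_imp_le)
qed

lemma big_cube_eventually: "eventually (\<lambda>N. x \<in> big_cube N) sequentially"
proof -
  obtain N :: nat where N: "norm x \<le> real N" using real_arch_simple by blast
  have "x \<in> big_cube M" if "M \<ge> N" for M
  proof -
    have "\<bar>x $ i\<bar> < real M + 1" for i
      using component_le_norm_cart[of x i] N that by (simp add: le_less_trans)
    then show ?thesis by (auto simp: big_cube_def abs_less_iff less_imp_le) (smt (verit))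
  qed
  then show ?thesis by (rule eventually_sequentiallyI)
qed

lemma tendsto_big_cube: "(\<lambda>N. f x * indicator (big_cube N) x :: complex) \<longlonglongrightarrow> f x"
  by (rule tendsto_eventually, rule eventually_mono[OF big_cube_eventually[of x]]) simp

lemma energy_big_cube_diff:
  fixes h :: "real^'n \<Rightarrow> complex"
  assumes h: "h \<in> L2_space"
  shows "(\<lambda>N. energy (\<lambda>x. h x - h x * indicator (big_cube N) x)) \<longlonglongrightarrow> 0"
proof -
  have "(\<lambda>N. energy (\<lambda>x. h x - h x * indicator (big_cube N) x)) \<longlonglongrightarrow> (\<integral>\<^sup>+x. 0 \<partial>(lebesgue :: (real^'n) measure))"
    unfolding energy_def
  proof (rule nn_integral_dominated_convergence[where w="\<lambda>x. ennreal ((cmod (h x))\<^sup>2)"])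
    show "(\<integral>\<^sup>+x. ennreal ((cmod (h x))\<^sup>2) \<partial>lebesgue) < \<infinity>"
      using h by (simp add: L2_space_iff energy_def)
    show "AE x in lebesgue. ennreal ((cmod (h x - h x * indicator (big_cube j) x))\<^sup>2) \<le> ennreal ((cmod (h x))\<^sup>2)" for j
      by (auto simp: indicator_def)
    show "AE x in lebesgue. (\<lambda>i. ennreal ((cmod (h x - h x * indicator (big_cube i) x))\<^sup>2)) \<longlonglongrightarrow> 0"
    proof (intro AE_I2)
      fix x
      have "(\<lambda>i. ennreal ((cmod (h x - h x * indicator (big_cube i) x))\<^sup>2)) \<longlonglongrightarrow> ennreal ((cmod (h x - h x))\<^sup>2)"
        by (intro tendsto_intros tendsto_ennrealI tendsto_big_cube)
      then show "(\<lambda>i. ennreal ((cmod (h x - h x * indicator (big_cube i) x))\<^sup>2)) \<longlonglongrightarrow> 0" by simp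
    qed
    show "(\<lambda>x. ennreal ((cmod (h x - h x * indicator (big_cube j) x))\<^sup>2)) \<in> borel_measurable lebesgue" for j
      using L2_diff[OF h L2_mult_indicator[OF h fmeasurableD[OF big_cube_lmeasurable[of j]]]] by measurable
  qed (use h in \<open>auto intro: L2_spaceD\<close>)
  then show ?thesis by simp
qed

lemma fourier_big_cube_tendsto:
  fixes h :: "real^'n \<Rightarrow> complex"
  assumes h: "h \<in> L12"
  shows "(\<lambda>N. fourier (\<lambda>t. h t * indicator (big_cube N) t) x) \<longlonglongrightarrow> fourier h x"
  unfolding fourier_def
proof (rule integral_dominated_convergence[where w="\<lambda>t. cmod (h t)"])
  note [measurable] = L2_spaceD[OF L12_L2[OF h]] fmeasurableD[OF big_cube_lmeasurable]
  show "(\<lambda>t. h t * wave x t) \<in> borel_measurable lebesgue" by measurable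
  show "(\<lambda>t. h t * indicator (big_cube i) t * wave x t) \<in> borel_measurable lebesgue" for i by measurable
  show "integrable lebesgue (\<lambda>t. cmod (h t))" by (rule integrable_norm[OF L12_integrable[OF h]])
  show "AE t in lebesgue. (\<lambda>i. h t * indicator (big_cube i) t * wave x t) \<longlonglongrightarrow> h t * wave x t"
    by (intro AE_I2 tendsto_intros tendsto_big_cube)
  show "AE t in lebesgue. norm (h t * indicator (big_cube i) t * wave x t) \<le> cmod (h t)" for i
    by (auto simp: norm_mult indicator_def)
qed

text \<open>Truncations to big cubes satisfy Plancherel exactly, and their transforms converge
  pointwise by dominated convergence. Fatou's lemma preserves only one inequality in this
  limit.\<close>

lemma energy_fourier_le:
  assumes h: "h \<in> L12"
  shows "energy (fourier h) \<le> energy h"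
proof -
  let ?h = "\<lambda>N t. h t * indicator (big_cube N) t"
  note [measurable] = L2_spaceD[OF L12_L2[OF h]] fmeasurableD[OF big_cube_lmeasurable]
  have "energy (fourier h) = (\<integral>\<^sup>+x. liminf (\<lambda>N. ennreal ((cmod (fourier (?h N) x))\<^sup>2)) \<partial>lebesgue)"
    unfolding energy_def
  proof (rule nn_integral_cong)
    fix x
    have "(\<lambda>N. ennreal ((cmod (fourier (?h N) x))\<^sup>2)) \<longlonglongrightarrow> ennreal ((cmod (fourier h x))\<^sup>2)"
      by (intro tendsto_ennrealI tendsto_intros fourier_big_cube_tendsto[OF h])
    then show "ennreal ((cmod (fourier h x))\<^sup>2) = liminf (\<lambda>N. ennreal ((cmod (fourier (?h N) x))\<^sup>2))"
      by (intro lim_imp_Liminf[symmetric]) auto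
  qed
  also have "\<dots> \<le> liminf (\<lambda>N. energy (fourier (?h N)))"
    unfolding energy_def by (rule nn_integral_liminf) measurable
  also have "\<dots> \<le> liminf (\<lambda>N. energy h)"
  proof (intro Liminf_mono always_eventually allI)
    fix N
    have "energy (fourier (?h N)) = energy (?h N)"
      by (rule plancherel_big_cube[of _ N]) (auto intro: L2_mult_indicator L12_L2[OF h])
    also have "\<dots> \<le> energy h"
      by (rule energy_mono) (auto simp: norm_mult indicator_def)
    finally show "energy (fourier (?h N)) \<le> energy h" .
  qed
  also have "\<dots> = energy h" by (simp add: Liminf_const)
  finally show ?thesis .
qed

lemma fourier_L2: "h \<in> L12 \<Longrightarrow> fourier h \<in> L2_space"
  using energy_fourier_le[of h] L12_L2[of h] by (auto simp: L2_space_iff)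

text \<open>For the reverse inequality h is split into a truncation and a remainder, and the
  transform of the truncation is compared with that of h. The inequality already known, applied to
  the remainder, makes both errors vanish as the cubes grow; only a factor (1 + d)^2 is
  left.\<close>

theorem plancherel:
  assumes h: "h \<in> L12"
  shows "energy (fourier h) = energy h"
proof (rule antisym[OF energy_fourier_le[OF h]])
  let ?h = "\<lambda>N t. h t * indicator (big_cube N) t"
  let ?a = "(L2_norm h)\<^sup>2" and ?b = "(L2_norm (fourier h))\<^sup>2"
  have hN: "?h N \<in> L12" for N
    by (rule L12_mult_indicator[OF h fmeasurableD[OF big_cube_lmeasurable]])
  have dN: "(\<lambda>t. h t - ?h N t) \<in> L12" for N by (rule L12_diff[OF h hN])
  have le: "energy h \<le> ennreal ((1 + d) * (1 + d)) * energy (fourier h)" if d: "d > 0" for d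
  proof (rule LIMSEQ_le_const)
    let ?R = "\<lambda>N. ennreal ((1 + d) * (1 + d)) * energy (fourier h)
        + (ennreal ((1 + d) * (1 + 1 / d)) + ennreal (1 + 1 / d)) * energy (\<lambda>x. h x - ?h N x)"
    have "?R \<longlonglongrightarrow> ennreal ((1 + d) * (1 + d)) * energy (fourier h)
        + (ennreal ((1 + d) * (1 + 1 / d)) + ennreal (1 + 1 / d)) * 0"
      by (intro tendsto_add tendsto_const ennreal_tendsto_cmult energy_big_cube_diff L12_L2 h)
         (auto simp: ennreal_add_eq_top less_top)
    then show "?R \<longlonglongrightarrow> ennreal ((1 + d) * (1 + d)) * energy (fourier h)" by simp
    show "\<exists>N. \<forall>n\<ge>N. energy h \<le> ?R n"
    proof (intro exI allI impI)
      fix N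
      have d1: "energy (\<lambda>x. fourier (?h N) x - fourier h x) \<le> energy (\<lambda>x. h x - ?h N x)"
      proof -
        have "energy (\<lambda>x. fourier (?h N) x - fourier h x) = energy (\<lambda>x. fourier h x - fourier (?h N) x)"
          by (rule energy_cong_AE) (simp add: norm_minus_commute)
        also have "\<dots> \<le> energy (\<lambda>x. h x - ?h N x)"
          using energy_fourier_le[OF dN, of N] by (simp add: fourier_diff[OF h hN])
        finally show ?thesis .
      qed
      have "energy h = energy (\<lambda>x. ?h N x + (h x - ?h N x))" by simp
      also have "\<dots> \<le> ennreal (1 + d) * energy (?h N) + ennreal (1 + 1 / d) * energy (\<lambda>x. h x - ?h N x)"
        by (intro energy_add_le d L2_spaceD L12_L2 hN dN)
      also have "energy (?h N) = energy (fourier (?h N))"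
        by (rule plancherel_big_cube[of _ N, symmetric]) (auto intro: L12_L2 hN)
      also have "\<dots> = energy (\<lambda>x. fourier h x + (fourier (?h N) x - fourier h x))" by simp
      also have "\<dots> \<le> ennreal (1 + d) * energy (fourier h)
          + ennreal (1 + 1 / d) * energy (\<lambda>x. fourier (?h N) x - fourier h x)"
        by (intro energy_add_le d L2_spaceD L2_diff fourier_L2 h hN)
      also have "\<dots> \<le> ennreal (1 + d) * energy (fourier h) + ennreal (1 + 1 / d) * energy (\<lambda>x. h x - ?h N x)"
        by (intro add_mono mult_left_mono d1) auto
      finally have "energy h \<le> ennreal (1 + d) * (ennreal (1 + d) * energy (fourier h)
          + ennreal (1 + 1 / d) * energy (\<lambda>x. h x - ?h N x)) + ennreal (1 + 1 / d) * energy (\<lambda>x. h x - ?h N x)"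
        by (simp add: mult_left_mono add_mono)
      also have "\<dots> = ?R N"
      proof -
        have m: "ennreal ((1 + d) * (1 + d)) = ennreal (1 + d) * ennreal (1 + d)"
          "ennreal ((1 + d) * (1 + 1 / d)) = ennreal (1 + d) * ennreal (1 + 1 / d)"
          by (rule ennreal_mult; use d in simp)+
        show ?thesis
          unfolding m by (simp only: distrib_left distrib_right mult.assoc add.assoc)
      qed
      finally show "energy h \<le> ?R N" .
    qed
  qed
  have ab: "?a \<le> (1 + d) * (1 + d) * ?b" if "d > 0" for d
  proof -
    have "ennreal ?a \<le> ennreal ((1 + d) * (1 + d) * ?b)"
      using le[OF that] that by (simp add: energy_eq L12_L2 h fourier_L2 ennreal_mult)
    then show ?thesis by (subst (asm) ennreal_le_iff) (use that in auto)
  qed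
  \<comment> \<open>Now d tends to 0 along 1/(m + 1).\<close>
  have "?a \<le> ?b"
  proof (rule LIMSEQ_le_const)
    have "(\<lambda>m. (1 + 1 / real (Suc m)) * (1 + 1 / real (Suc m)) * ?b) \<longlonglongrightarrow> (1 + 0) * (1 + 0) * ?b"
      by (intro tendsto_intros LIMSEQ_Suc[OF lim_1_over_n])
    then show "(\<lambda>m. (1 + 1 / real (Suc m)) * (1 + 1 / real (Suc m)) * ?b) \<longlonglongrightarrow> ?b" by simp
    show "\<exists>N. \<forall>n\<ge>N. ?a \<le> (1 + 1 / real (Suc n)) * (1 + 1 / real (Suc n)) * ?b"
      using ab[of "1 / real (Suc _)"] by (intro exI allI impI ab) simp
  qed
  then show "energy h \<le> energy (fourier h)"
    by (simp add: energy_eq L12_L2 h fourier_L2 ennreal_leI)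
qed

text \<open>Fubini, legitimate because f and g are integrable. The function on the right is the
  inverse transform of f, written with two conjugations so that no second transform has to be
  defined.\<close>

lemma fourier_dual:
  assumes f: "f \<in> L12" and g: "g \<in> L12"
  shows "L2_inner f (fourier g) = L2_inner (\<lambda>t. cnj (fourier (\<lambda>x. cnj (f x)) t)) g"
proof -
  interpret pair_sigma_finite "lebesgue :: (real^'a) measure" "lebesgue :: (real^'a) measure"
    by (rule pair_sigma_finite_lebesgue)
  note [measurable] = L2_spaceD[OF L12_L2[OF f]] L2_spaceD[OF L12_L2[OF g]]
  let ?k = "\<lambda>x t. f x * cnj (g t) * cnj (wave x t)"
  have i: "integrable (lebesgue \<Otimes>\<^sub>M lebesgue) (case_prod ?k)"
  proof (rule Fubini_integrable)
    show "case_prod ?k \<in> borel_measurable (lebesgue \<Otimes>\<^sub>M lebesgue)"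
      unfolding split_beta by measurable
    have "(\<lambda>x. LINT t|lebesgue. norm (case (x, t) of (x, t) \<Rightarrow> ?k x t)) = (\<lambda>x. cmod (f x) * (LINT t|lebesgue. cmod (g t)))"
      by (simp add: norm_mult)
    then show "integrable lebesgue (\<lambda>x. LINT t|lebesgue. norm (case (x, t) of (x, t) \<Rightarrow> ?k x t))"
      using integrable_norm[OF L12_integrable[OF f]] by simp
    show "AE x in lebesgue. integrable lebesgue (\<lambda>t. case (x, t) of (x, t) \<Rightarrow> ?k x t)"
    proof (intro AE_I2)
      fix x
      have "integrable lebesgue (\<lambda>t. f x * cnj (g t * wave x t))"
        by (rule integrable_mult_right, rule integrable_bounded_linear[OF bounded_linear_cnj],
            rule L12_integrable[OF L12_wave[OF g]])
      then show "integrable lebesgue (\<lambda>t. case (x, t) of (x, t) \<Rightarrow> ?k x t)"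
        by (simp add: mult.assoc)
    qed
  qed
  have "L2_inner f (fourier g) = (LINT x|lebesgue. LINT t|lebesgue. ?k x t)"
    unfolding L2_inner_def fourier_def
    by (simp flip: Bochner_Integration.integral_cnj Bochner_Integration.integral_mult_right_zero add: mult.assoc)
  also have "\<dots> = (LINT t|lebesgue. LINT x|lebesgue. ?k x t)"
    by (rule Fubini_integral[OF i, symmetric])
  also have "\<dots> = L2_inner (\<lambda>t. cnj (fourier (\<lambda>x. cnj (f x)) t)) g"
  proof -
    have "(LINT x|lebesgue. ?k x t) = cnj (fourier (\<lambda>x. cnj (f x)) t) * cnj (g t)" for t
    proof -
      have "(LINT x|lebesgue. ?k x t) = (LINT x|lebesgue. (f x * cnj (wave t x)) * cnj (g t))"
        by (simp add: wave_commute[of t] mult_ac)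
      also have "\<dots> = (LINT x|lebesgue. f x * cnj (wave t x)) * cnj (g t)"
        by (rule Bochner_Integration.integral_mult_left_zero)
      also have "(LINT x|lebesgue. f x * cnj (wave t x)) = cnj (fourier (\<lambda>x. cnj (f x)) t)"
        unfolding fourier_def by (simp flip: Bochner_Integration.integral_cnj)
      finally show ?thesis .
    qed
    then show ?thesis by (simp add: L2_inner_def)
  qed
  finally show ?thesis .
qed

section \<open>Density of the range of the Fourier transform\<close>

lemma fourier_range_subset: "fourier ` L12 \<subseteq> L2_space"
  by (auto intro: fourier_L2)

text \<open>Takes the place of an inversion theorem. The inverse transform \<phi> of f need not be
  integrable, so it is truncated. By duality the inner product of f with the transform of the
  truncation is the squared norm of the truncation, exactly as for \<phi>; hence the two
  approximation errors have equal energy.\<close>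

lemma L12_fourier_dense:
  fixes f :: "real^'n \<Rightarrow> complex"
  assumes f: "f \<in> L12"
  shows "f \<in> L2_closed_span (fourier ` L12)"
proof (rule closed_span_limit[OF fourier_range_subset L12_L2[OF f]])
  define \<phi> where "\<phi> t = cnj (fourier (\<lambda>x. cnj (f x)) t)" for t
  define \<phi>' where "\<phi>' N t = \<phi> t * indicator (big_cube N) t" for N t
  have \<phi>L: "\<phi> \<in> L2_space"
    unfolding \<phi>_def[abs_def] by (intro L2_cnj fourier_L2 L12_cnj f)
  have "energy \<phi> = energy (fourier (\<lambda>x. cnj (f x)))"
    by (rule energy_cong_AE) (simp add: \<phi>_def)
  also have "\<dots> = energy (\<lambda>x. cnj (f x))" by (rule plancherel[OF L12_cnj[OF f]])
  also have "\<dots> = energy f" by (rule energy_cong_AE) simp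
  finally have e: "energy \<phi> = energy f" .
  have \<phi>': "\<phi>' N \<in> L12" for N
    unfolding \<phi>'_def[abs_def] by (rule L2_finite_measure_L12[OF \<phi>L big_cube_lmeasurable])
  have in1: "L2_inner \<phi> (\<phi>' N) = of_real ((L2_norm (\<phi>' N))\<^sup>2)" for N
    unfolding L2_inner_self[symmetric] unfolding L2_inner_def
    by (rule Bochner_Integration.integral_cong) (auto simp: \<phi>'_def indicator_def)
  have in2: "L2_inner f (fourier (\<phi>' N)) = of_real ((L2_norm (\<phi>' N))\<^sup>2)" for N
    unfolding fourier_dual[OF f \<phi>'] in1[symmetric] by (simp add: \<phi>_def[abs_def])
  have key: "energy (\<lambda>x. f x - fourier (\<phi>' N) x) = energy (\<lambda>x. \<phi> x - \<phi>' N x)" for N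
  proof -
    have a: "(L2_norm f)\<^sup>2 = (L2_norm \<phi>)\<^sup>2"
      using e by (simp add: energy_eq \<phi>L L12_L2[OF f])
    have b: "(L2_norm (fourier (\<phi>' N)))\<^sup>2 = (L2_norm (\<phi>' N))\<^sup>2"
      using plancherel[OF \<phi>'[of N]] by (simp add: energy_eq L12_L2[OF \<phi>'] fourier_L2[OF \<phi>'])
    have "(L2_norm (\<lambda>x. f x - fourier (\<phi>' N) x))\<^sup>2 = (L2_norm (\<lambda>x. \<phi> x - \<phi>' N x))\<^sup>2"
      by (simp add: L2_norm_diff_square L12_L2[OF f] \<phi>L L12_L2[OF \<phi>'] fourier_L2[OF \<phi>'] in1 in2 a b)
    then show ?thesis
      by (simp add: energy_eq L2_diff L12_L2[OF f] \<phi>L L12_L2[OF \<phi>'] fourier_L2[OF \<phi>'])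
  qed
  fix \<epsilon> :: real assume "\<epsilon> > 0"
  then have "eventually (\<lambda>N. energy (\<lambda>x. \<phi> x - \<phi>' N x) < ennreal \<epsilon>) sequentially"
    using order_tendstoD(2)[OF energy_big_cube_diff[OF \<phi>L], of "ennreal \<epsilon>"] by (simp add: \<phi>'_def)
  then obtain N where "energy (\<lambda>x. \<phi> x - \<phi>' N x) < ennreal \<epsilon>"
    by (auto simp: eventually_sequentially)
  then have "energy (\<lambda>x. f x - fourier (\<phi>' N) x) < ennreal \<epsilon>" by (simp add: key)
  moreover have "fourier (\<phi>' N) \<in> L2_closed_span (fourier ` L12)"
    by (intro lspan_closed_span lspan_base imageI \<phi>' fourier_range_subset)
  ultimately show "\<exists>h\<in>L2_closed_span (fourier ` L12). energy (\<lambda>x. f x - h x) < ennreal \<epsilon>"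
    by (intro bexI[of _ "fourier (\<phi>' N)"])
qed

lemma fourier_dense:
  assumes f: "f \<in> L2_space"
  shows "f \<in> L2_closed_span (fourier ` L12)"
proof (rule closed_span_limit[OF fourier_range_subset f])
  fix \<epsilon> :: real assume "\<epsilon> > 0"
  then have "eventually (\<lambda>N. energy (\<lambda>x. f x - f x * indicator (big_cube N) x) < ennreal \<epsilon>) sequentially"
    using order_tendstoD(2)[OF energy_big_cube_diff[OF f], of "ennreal \<epsilon>"] by simp
  then obtain N where N: "energy (\<lambda>x. f x - f x * indicator (big_cube N) x) < ennreal \<epsilon>"
    by (auto simp: eventually_sequentially)
  show "\<exists>h\<in>L2_closed_span (fourier ` L12). energy (\<lambda>x. f x - h x) < ennreal \<epsilon>"
    by (rule bexI[of _ "\<lambda>x. f x * indicator (big_cube N) x"])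
       (fact N, rule L12_fourier_dense[OF L2_finite_measure_L12[OF f big_cube_lmeasurable]])
qed

lemma fourier_inner:
  assumes f: "f \<in> L12" and g: "g \<in> L12"
  shows "L2_inner (fourier f) (fourier g) = L2_inner f g"
proof (rule L2_inner_polarization)
  have "fourier (\<lambda>x. \<i> * f x + (- 1) * g x) = (\<lambda>x. \<i> * fourier f x - fourier g x)"
    using fourier_combine[OF f L12_combine[OF g L12_diff[OF g g], of "-1"], of \<i>]
      fourier_combine[OF g L12_diff[OF g g], of "-1"] fourier_diff[OF g g] by simp
  moreover have "(\<lambda>x. \<i> * f x + (- 1) * g x) \<in> L12"
    using L12_combine[OF f L12_combine[OF g L12_diff[OF g g], of "-1"], of \<i>] by simp
  ultimately show "energy (\<lambda>x. \<i> * fourier f x - fourier g x) = energy (\<lambda>x. \<i> * f x - g x)"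
    using plancherel[of "\<lambda>x. \<i> * f x + (- 1) * g x"] by simp
  show "energy (\<lambda>x. fourier f x - fourier g x) = energy (\<lambda>x. f x - g x)"
    using plancherel[OF L12_diff[OF f g]] by (simp add: fourier_diff[OF f g])
qed (auto intro: fourier_L2 L12_L2 plancherel f g)

text \<open>Isometry preserves orthonormality, and density of the range gives completeness. Since
  \<open>fourier\<close> is used on \<open>L12\<close>, every member of the family has to lie
  there.\<close>

theorem fourier_orthonormal_basis:
  fixes G :: "'i \<Rightarrow> real^'n \<Rightarrow> complex"
  assumes G: "L2_orthonormal_basis I G" and L: "\<And>p. p \<in> I \<Longrightarrow> G p \<in> L12"
  shows "L2_orthonormal_basis I (\<lambda>p. fourier (G p))"
proof -
  have on: "L2_orthonormal I (\<lambda>p. fourier (G p))"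
    using G L by (auto simp: L2_orthonormal_basis_iff L2_orthonormal_def fourier_inner intro: fourier_L2)
  have sub: "(\<lambda>p. fourier (G p)) ` I \<subseteq> L2_space"
    using L by (auto intro: fourier_L2)
  have "fourier ` (L12 :: (real^'n \<Rightarrow> complex) set) \<subseteq> L2_closed_span ((\<lambda>p. fourier (G p)) ` I)"
  proof
    fix k :: "real^'n \<Rightarrow> complex" assume "k \<in> fourier ` L12"
    then obtain h where h: "h \<in> L12" "k = fourier h" by blast
    have "fourier h \<in> L2_closed_span ((\<lambda>p. fourier (G p)) ` I)"
    proof (rule closed_span_map[where G="G ` I" and D=L12 and C=1 and T=fourier, OF sub])
      show "h \<in> L2_closed_span (G ` I)"
        using G h by (auto simp: L2_orthonormal_basis_iff intro: L12_L2)
      show "fourier g \<in> L2_closed_span ((\<lambda>p. fourier (G p)) ` I)" if "g \<in> G ` I" for g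
        using that by (intro lspan_closed_span[OF lspan_base sub]) auto
      show "energy (fourier f) \<le> ennreal 1 * energy f" if "f \<in> L12" for f
        using energy_fourier_le[OF that] by simp
    qed (use L h in \<open>auto intro: L12_L2 L12_combine fourier_L2 fourier_combine\<close>)
    then show "k \<in> L2_closed_span ((\<lambda>p. fourier (G p)) ` I)" by (simp add: h)
  qed
  then have "L2_space \<subseteq> L2_closed_span ((\<lambda>p. fourier (G p)) ` I)"
    using closed_span_trans[OF sub] fourier_dense by blast
  with on show ?thesis by (simp add: L2_orthonormal_basis_iff)
qed

subsection \<open>Dilations and dilation tiles\<close>

lemma matrix_powi_0 [simp]: "matrix_powi A 0 = mat 1"
  by (simp add: matrix_powi_def)

lemma matrix_powi_step:
  assumes A: "invertible A"
  shows "matrix_powi A (j + 1) = A ** matrix_powi A j"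
proof (cases "j \<ge> 0")
  case True
  then have "nat (j + 1) = Suc (nat j)" by simp
  with True show ?thesis by (simp add: matrix_powi_def)
next
  case False
  define m where "m = nat (- (j + 1))"
  have "nat (- j) = Suc m" using False by (simp add: m_def)
  then have j: "matrix_powi A j = matrix_inv A ** (((**) (matrix_inv A)) ^^ m) (mat 1)"
    using False by (simp add: matrix_powi_def)
  have "matrix_powi A (j + 1) = (((**) (matrix_inv A)) ^^ m) (mat 1)"
    using False by (cases "j = -1") (auto simp: matrix_powi_def m_def)
  then show ?thesis
    by (simp add: j matrix_mul_assoc matrix_inv_inverse(1)[OF A])
qed

lemma matrix_powi_step_minus:
  assumes A: "invertible A"
  shows "matrix_powi A (j - 1) = matrix_inv A ** matrix_powi A j"
  using matrix_powi_step[OF A, of "j - 1"] by (simp add: matrix_mul_assoc matrix_inv_inverse(2)[OF A])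

lemma matrix_powi_invertible:
  fixes A :: "real^'n^'n"
  assumes A: "invertible A"
  shows "invertible (matrix_powi A j)"
proof (induction j rule: int_induct[of _ 0])
  case base
  show ?case by (simp add: invertible_det_nz)
next
  case (step1 i)
  then show ?case by (simp add: matrix_powi_step[OF A] invertible_mult A)
next
  case (step2 i)
  then show ?case by (simp add: matrix_powi_step_minus[OF A] invertible_mult A invertible_matrix_inv)
qed

lemma matrix_powi_commute:
  assumes A: "invertible A"
  shows "A ** matrix_powi A j = matrix_powi A j ** A"
proof (induction j rule: int_induct[of _ 0])
  case (step1 i)
  then show ?case by (metis matrix_powi_step[OF A] matrix_mul_assoc)
next
  case (step2 i)
  have "A ** matrix_powi A (i - 1) = matrix_powi A i"
    using matrix_powi_step[OF A, of "i - 1"] by simp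
  also have "\<dots> = matrix_inv A ** (A ** matrix_powi A i)"
    by (simp add: matrix_mul_assoc matrix_inv_inverse(2)[OF A])
  also have "\<dots> = matrix_inv A ** (matrix_powi A i ** A)" by (simp only: step2)
  also have "\<dots> = matrix_powi A (i - 1) ** A"
    by (simp add: matrix_powi_step_minus[OF A] matrix_mul_assoc)
  finally show ?case .
qed simp

lemma matrix_powi_add:
  assumes A: "invertible A"
  shows "matrix_powi A (i + j) = matrix_powi A i ** matrix_powi A j"
proof (induction i rule: int_induct[of _ 0])
  case (step1 i)
  then show ?case
    using matrix_powi_step[OF A, of "i + j"] matrix_powi_step[OF A, of i]
    by (simp add: matrix_mul_assoc algebra_simps)
next
  case (step2 i)
  then show ?case
    using matrix_powi_step_minus[OF A, of "i + j"] matrix_powi_step_minus[OF A, of i]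
    by (simp add: matrix_mul_assoc algebra_simps)
qed simp

lemma matrix_powi_vector_add:
  "invertible A \<Longrightarrow> matrix_powi A i *v (matrix_powi A j *v x) = matrix_powi A (i + j) *v x"
  by (simp add: matrix_powi_add matrix_vector_mul_assoc)

lemma matrix_inv_eqI:
  fixes A :: "'a::field^'n^'n"
  assumes "A ** B = mat 1"
  shows "matrix_inv A = B"
proof -
  have BA: "B ** A = mat 1" using assms by (simp add: matrix_left_right_inverse)
  then have A: "invertible A" using assms unfolding invertible_def by blast
  have "matrix_inv A = (B ** A) ** matrix_inv A" by (simp add: BA)
  then show ?thesis by (simp add: matrix_mul_assoc[symmetric] matrix_inv_inverse(1)[OF A])
qed

lemma matrix_inv_powi:
  fixes A :: "real^'n^'n"
  assumes A: "invertible A"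
  shows "matrix_inv (matrix_powi A j) = matrix_powi A (- j)"
  by (rule matrix_inv_eqI) (simp add: matrix_powi_add[OF A, symmetric])

lemma matrix_powi_transpose:
  fixes A :: "real^'n^'n"
  assumes A: "invertible A"
  shows "matrix_powi (transpose A) j = transpose (matrix_powi A j)"
proof -
  have T: "invertible (transpose A)" by (rule transpose_invertible[OF A])
  have inv: "matrix_inv (transpose A) = transpose (matrix_inv A)"
    by (rule matrix_inv_eqI)
       (simp add: matrix_transpose_mul[symmetric] matrix_inv_inverse(2)[OF A] transpose_mat)
  have c: "matrix_inv A ** matrix_powi A i = matrix_powi A i ** matrix_inv A" for i
  proof -
    have "matrix_inv A ** matrix_powi A i = matrix_inv A ** (matrix_powi A i ** A) ** matrix_inv A"
      by (simp add: matrix_mul_assoc[symmetric] matrix_inv_inverse(1)[OF A])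
    also have "\<dots> = matrix_powi A i ** matrix_inv A"
      by (simp add: matrix_powi_commute[OF A, symmetric] matrix_mul_assoc matrix_inv_inverse(2)[OF A])
    finally show ?thesis .
  qed
  show ?thesis
  proof (induction j rule: int_induct[of _ 0])
    case base
    show ?case by (simp add: transpose_mat)
  next
    case (step1 i)
    then show ?case
      by (simp add: matrix_powi_step[OF A] matrix_powi_step[OF T] matrix_transpose_mul[symmetric] matrix_powi_commute[OF A])
  next
    case (step2 i)
    then show ?case
      by (simp add: matrix_powi_step_minus[OF A] matrix_powi_step_minus[OF T] inv matrix_transpose_mul[symmetric] c)
  qed
qed

lemma matrix_powi_similar:
  fixes A B P :: "real^'n^'n"
  assumes A: "invertible A" and P: "invertible P" and B: "B = P ** A ** matrix_inv P"
  shows "matrix_powi B j = P ** matrix_powi A j ** matrix_inv P"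
proof -
  have iB: "invertible B" unfolding B by (intro invertible_mult A P invertible_matrix_inv)
  have inv: "matrix_inv B = P ** matrix_inv A ** matrix_inv P"
  proof (rule matrix_inv_eqI)
    have "B ** (P ** matrix_inv A ** matrix_inv P)
        = P ** A ** (matrix_inv P ** P) ** matrix_inv A ** matrix_inv P"
      by (simp add: B matrix_mul_assoc)
    then show "B ** (P ** matrix_inv A ** matrix_inv P) = mat 1"
      by (simp add: matrix_inv_inverse[OF P] matrix_mul_assoc[symmetric] matrix_inv_inverse[OF A])
  qed
  have mid: "(P ** X ** matrix_inv P) ** (P ** Y ** matrix_inv P) = P ** (X ** Y) ** matrix_inv P" for X Y :: "real^'n^'n"
  proof -
    have "(P ** X ** matrix_inv P) ** (P ** Y ** matrix_inv P) = P ** X ** (matrix_inv P ** P) ** Y ** matrix_inv P"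
      by (simp add: matrix_mul_assoc)
    then show ?thesis by (simp add: matrix_inv_inverse[OF P] matrix_mul_assoc)
  qed
  show ?thesis
  proof (induction j rule: int_induct[of _ 0])
    case base
    show ?case by (simp add: matrix_inv_inverse[OF P])
  next
    case (step1 i)
    then show ?case unfolding matrix_powi_step[OF A] matrix_powi_step[OF iB] by (simp only: mid[symmetric] B[symmetric])
  next
    case (step2 i)
    then show ?case
      unfolding matrix_powi_step_minus[OF A] matrix_powi_step_minus[OF iB] by (simp only: mid[symmetric] inv[symmetric])
  qed
qed

lemma abs_det_matrix_powi:
  fixes A :: "real^'n^'n"
  assumes A: "invertible A"
  shows "\<bar>det (matrix_powi A j)\<bar> = \<bar>det A\<bar> powr real_of_int j"
proof -
  have d: "\<bar>det A\<bar> > 0" using A by (simp add: invertible_det_nz)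
  show ?thesis
  proof (induction j rule: int_induct[of _ 0])
    case base
    show ?case using d by simp
  next
    case (step1 i)
    then show ?case using d by (simp add: matrix_powi_step[OF A] det_mul abs_mult powr_add)
  next
    case (step2 i)
    then show ?case using d
      by (simp add: matrix_powi_step_minus[OF A] det_mul abs_mult powr_diff det_matrix_inv[OF A])
  qed
qed

section \<open>Unitary dilations\<close>

definition dilate :: "real^'n^'n \<Rightarrow> (real^'n \<Rightarrow> complex) \<Rightarrow> real^'n \<Rightarrow> complex" where
  "dilate N f x = of_real (sqrt \<bar>det N\<bar>) * f (N *v x)"

lemma dilate_L2: "invertible N \<Longrightarrow> f \<in> L2_space \<Longrightarrow> dilate N f \<in> L2_space"
  unfolding dilate_def[abs_def] by (intro L2_scale L2_matrix)

lemma dilate_L12: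
  assumes "invertible N" "f \<in> L12"
  shows "dilate N f \<in> L12"
  using L12_combine[OF L12_matrix[OF assms] L12_diff[OF assms(2) assms(2)], of "of_real (sqrt \<bar>det N\<bar>)"]
  by (simp add: dilate_def[abs_def])

lemma energy_dilate:
  assumes N: "invertible N" and f: "f \<in> L2_space"
  shows "energy (dilate N f) = energy f"
proof -
  have "energy (dilate N f) = ennreal ((cmod (of_real (sqrt \<bar>det N\<bar>)))\<^sup>2) * energy (\<lambda>x. f (N *v x))"
    unfolding dilate_def[abs_def] by (rule energy_scale) (rule L2_spaceD[OF L2_matrix[OF N f]])
  also have "\<dots> = energy f"
    by (simp add: energy_matrix[OF N L2_spaceD[OF f]])
  finally show ?thesis .
qed

lemma dilate_inner:
  assumes N: "invertible N" and f: "f \<in> L2_space" and g: "g \<in> L2_space"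
  shows "L2_inner (dilate N f) (dilate N g) = L2_inner f g"
proof -
  have "L2_inner (dilate N f) (dilate N g) = (LINT x|lebesgue. of_real \<bar>det N\<bar> * (f (N *v x) * cnj (g (N *v x))))"
    unfolding L2_inner_def
  proof (rule Bochner_Integration.integral_cong[OF refl])
    fix x
    have "dilate N f x * cnj (dilate N g x) = of_real (sqrt \<bar>det N\<bar> * sqrt \<bar>det N\<bar>) * (f (N *v x) * cnj (g (N *v x)))"
      by (simp add: dilate_def del: real_sqrt_mult_self)
    then show "dilate N f x * cnj (dilate N g x) = of_real \<bar>det N\<bar> * (f (N *v x) * cnj (g (N *v x)))"
      by simp
  qed
  also have "\<dots> = L2_inner f g"
    using integral_matrix[OF N borel_measurable_integrable[OF integrable_L2_mult[OF f g]]]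
    by (simp add: L2_inner_def)
  finally show ?thesis .
qed

lemma dilate_combine: "dilate N (\<lambda>x. c * f x + h x) = (\<lambda>x. c * dilate N f x + dilate N h x)"
  by (simp add: dilate_def fun_eq_iff algebra_simps)

lemma dilate_closed_span:
  assumes N: "invertible N" and H: "H \<subseteq> L2_space" and G: "G \<subseteq> L2_space"
    and GH: "\<And>g. g \<in> G \<Longrightarrow> dilate N g \<in> L2_closed_span H" and f: "f \<in> L2_closed_span G"
  shows "dilate N f \<in> L2_closed_span H"
  by (rule closed_span_map[where G=G and D=L2_space and C=1, OF H G])
     (use N GH f in \<open>auto intro: L2_add L2_scale dilate_L2 closed_span_L2 simp: dilate_combine energy_dilate\<close>)

lemma dilate_dilate_inv:
  assumes N: "invertible N"
  shows "dilate N (dilate (matrix_inv N) f) = f"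
proof
  fix x
  have "sqrt \<bar>det N\<bar> * sqrt \<bar>det (matrix_inv N)\<bar> = 1"
    using N by (simp add: real_sqrt_mult[symmetric] det_matrix_inv[OF N] invertible_det_nz)
  then have "complex_of_real (sqrt \<bar>det N\<bar>) * of_real (sqrt \<bar>det (matrix_inv N)\<bar>) = 1"
    by (metis of_real_1 of_real_mult)
  then show "dilate N (dilate (matrix_inv N) f) x = f x"
    by (simp add: dilate_def matrix_inv_vector[OF N] mult.assoc[symmetric])
qed

lemma dilate_orthonormal_basis:
  assumes N: "invertible N" and g: "L2_orthonormal_basis I g"
  shows "L2_orthonormal_basis I (\<lambda>p. dilate N (g p))"
proof -
  have gL: "g p \<in> L2_space" if "p \<in> I" for p
    using g that by (simp add: L2_orthonormal_basis_def)
  have sub: "(\<lambda>p. dilate N (g p)) ` I \<subseteq> L2_space" by (auto intro: dilate_L2 N gL)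
  have "f \<in> L2_closed_span ((\<lambda>p. dilate N (g p)) ` I)" if f: "f \<in> L2_space" for f
  proof -
    have "dilate N (dilate (matrix_inv N) f) \<in> L2_closed_span ((\<lambda>p. dilate N (g p)) ` I)"
    proof (rule dilate_closed_span[OF N sub, of "g ` I"])
      show "dilate (matrix_inv N) f \<in> L2_closed_span (g ` I)"
        using g dilate_L2[OF invertible_matrix_inv[OF N] f] by (auto simp: L2_orthonormal_basis_iff)
      show "dilate N h \<in> L2_closed_span ((\<lambda>p. dilate N (g p)) ` I)" if "h \<in> g ` I" for h
        using that by (intro lspan_closed_span[OF lspan_base sub]) auto
    qed (auto intro: gL)
    then show ?thesis by (simp add: dilate_dilate_inv[OF N])
  qed
  moreover have "L2_orthonormal I (\<lambda>p. dilate N (g p))"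
    using g by (auto simp: L2_orthonormal_def L2_orthonormal_basis_def dilate_inner[OF N] dilate_L2[OF N])
  ultimately show ?thesis by (auto simp: L2_orthonormal_basis_iff)
qed

lemma L2_orthonormal_basis_reindex:
  assumes g: "L2_orthonormal_basis I (\<lambda>p. h (\<phi> p))" and inj: "inj_on \<phi> I"
  shows "L2_orthonormal_basis (\<phi> ` I) h"
  using g inj unfolding L2_orthonormal_basis_iff L2_orthonormal_def
  by (auto simp: image_image inj_on_eq_iff)

lemma fourier_dilate:
  assumes N: "invertible N" and f: "f \<in> borel_measurable lebesgue"
  shows "fourier (dilate N f) x = of_real (1 / sqrt \<bar>det N\<bar>) * fourier f (transpose (matrix_inv N) *v x)"
proof -
  have d: "\<bar>det N\<bar> > 0" using N by (simp add: invertible_det_nz)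
  have "fourier (dilate N f) x = of_real (sqrt \<bar>det N\<bar>) * fourier (\<lambda>t. f (N *v t)) x"
    by (simp add: fourier_def dilate_def mult.assoc)
  also have "sqrt \<bar>det N\<bar> = 1 / sqrt \<bar>det N\<bar> * \<bar>det N\<bar>"
    using d by (simp add: real_div_sqrt)
  finally show ?thesis
    by (simp only: fourier_matrix[OF N f] of_real_mult mult.assoc)
qed

text \<open>Almost everywhere is unavoidable: the origin is fixed by all powers, so no unique j can
  exist for it.\<close>

definition dilation_tile :: "real^'n^'n \<Rightarrow> (real^'n) set \<Rightarrow> bool" where
  "dilation_tile M W \<longleftrightarrow> W \<in> sets lebesgue \<and> (AE x in lebesgue. \<exists>!j. matrix_powi M j *v x \<in> W)"

text \<open>Stands in for the condition that every coset of the lattice meets W infinitely often.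
  Unlike that condition, it is visibly stable under invertible linear maps, which is needed when the
  tile moves from J to a similar matrix.\<close>

definition large_balls :: "(real^'n) set \<Rightarrow> bool" where
  "large_balls W \<longleftrightarrow> (\<forall>r. \<exists>x. ball x r \<subseteq> W)"

text \<open>The i-th element, counted from 0, of an infinite set of naturals. Describing it by the
  number of smaller elements makes it a finite sum of indicators, hence measurable when the set
  depends on a point.\<close>

lemma infinite_ex1_card_less:
  fixes S :: "nat set"
  assumes S: "infinite S"
  shows "\<exists>!m. m \<in> S \<and> card {l \<in> S. l < m} = i"
proof -
  have mono: "card {l \<in> S. l < m} < card {l \<in> S. l < m'}" if "m \<in> S" "m < m'" for m m'
    by (rule psubset_card_mono) (use that in auto)
  have ex: "\<exists>m. m \<in> S \<and> card {l \<in> S. l < m} = i"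
  proof (induction i)
    case 0
    have "(LEAST m. m \<in> S) \<in> S" using S by (metis LeastI finite.emptyI ex_in_conv)
    moreover have "{l \<in> S. l < (LEAST m. m \<in> S)} = {}" using not_less_Least by auto
    ultimately show ?case by (metis card.empty)
  next
    case (Suc i)
    then obtain m where m: "m \<in> S" "card {l \<in> S. l < m} = i" by blast
    have ex': "\<exists>l. l \<in> S \<and> m < l" using S infinite_nat_iff_unbounded by blast
    define l where "l = (LEAST l. l \<in> S \<and> m < l)"
    have l: "l \<in> S" "m < l" unfolding l_def using LeastI_ex[OF ex'] by auto
    have "{k \<in> S. k < l} = insert m {k \<in> S. k < m}"
    proof (intro set_eqI iffI)
      fix k assume k: "k \<in> {k \<in> S. k < l}"
      then have "\<not> (k \<in> S \<and> m < k)" using not_less_Least[of k "\<lambda>l. l \<in> S \<and> m < l"] by (simp add: l_def)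
      with k show "k \<in> insert m {k \<in> S. k < m}" by auto
    qed (use l m(1) in auto)
    then have "card {k \<in> S. k < l} = Suc i" using m(2) by simp
    with l(1) show ?case by blast
  qed
  show ?thesis
  proof (rule ex_ex1I[OF ex])
    fix m m' assume "m \<in> S \<and> card {l \<in> S. l < m} = i" "m' \<in> S \<and> card {l \<in> S. l < m'} = i"
    then show "m = m'" using mono[of m m'] mono[of m' m] by (metis less_irrefl nat_neq_iff)
  qed
qed

lemma large_balls_infinite:
  fixes W :: "(real^'n) set"
  assumes W: "large_balls W"
  shows "infinite {m. y + lattice_enum m \<in> W}"
proof
  let ?S = "{m. y + lattice_enum m \<in> W}"
  assume fin: "finite ?S"
  define c where "c = card ?S"
  \<comment> \<open>The radius has room for c + 1 points of the coset, one more than the set is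
    assumed to have: \<open>CARD('n)\<close> bounds the error of rounding to a point y + a near the
    centre, c is the length of the walk from there along one axis, and 1 makes the inequality
    strict.\<close>
  obtain x0 where x0: "ball x0 (real CARD('n) + real c + 1) \<subseteq> W"
    using W unfolding large_balls_def by blast
  define a :: "real^'n" where "a = (\<chi> i. of_int \<lfloor>x0 $ i - y $ i\<rfloor>)"
  have a: "a \<in> integer_lattice" by (simp add: integer_lattice_def a_def)
  obtain i0 :: 'n where True by blast
  let ?p = "\<lambda>t::nat. a + real t *\<^sub>R axis i0 1"
  have p: "?p t \<in> integer_lattice" for t
    using a by (auto simp: integer_lattice_def axis_def)
  have inW: "y + ?p t \<in> W" if "t \<le> c" for t
  proof -
    have "norm (x0 - (y + a)) \<le> (\<Sum>i\<in>UNIV. \<bar>(x0 - (y + a)) $ i\<bar>)" by (rule norm_le_l1_cart)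
    also have "\<dots> \<le> (\<Sum>i\<in>(UNIV :: 'n set). 1)"
    proof (rule sum_mono)
      fix i
      have "0 \<le> x0 $ i - y $ i - of_int \<lfloor>x0 $ i - y $ i\<rfloor>" "x0 $ i - y $ i - of_int \<lfloor>x0 $ i - y $ i\<rfloor> \<le> 1"
        by linarith+
      then show "\<bar>(x0 - (y + a)) $ i\<bar> \<le> 1"
        unfolding a_def vector_minus_component vector_add_component vec_lambda_beta by linarith
    qed
    finally have b1: "norm (x0 - (y + a)) \<le> real CARD('n)" by simp
    have b2: "norm (real t *\<^sub>R axis i0 (1::real)) \<le> real c" using that by (simp add: norm_axis_1)
    have e: "x0 - (y + ?p t) = (x0 - (y + a)) - real t *\<^sub>R axis i0 1" by (simp add: algebra_simps)
    have "norm (x0 - (y + ?p t)) \<le> real CARD('n) + real c"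
      unfolding e using norm_triangle_ineq4[of "x0 - (y + a)" "real t *\<^sub>R axis i0 1"] b1 b2 by linarith
    then have "y + ?p t \<in> ball x0 (real CARD('n) + real c + 1)" by (simp add: dist_norm)
    with x0 show ?thesis by blast
  qed
  define q where "q t = (SOME m. lattice_enum m = ?p t)" for t
  have q: "lattice_enum (q t) = ?p t" for t
    unfolding q_def by (rule someI_ex) (use p[of t] in \<open>unfold range_lattice_enum[symmetric], metis rangeE\<close>)
  have "inj_on q {..c}"
  proof (rule inj_onI)
    fix s t assume "q s = q t"
    then have "?p s = ?p t" by (metis q)
    then have "(?p s) $ i0 = (?p t) $ i0" by (rule arg_cong)
    then show "s = t" by (simp add: axis_def)
  qed
  moreover have "q ` {..c} \<subseteq> ?S" using inW q by auto
  ultimately have "card {..c} \<le> card ?S" using card_inj_on_le[OF _ _ fin] by blast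
  then show False by (simp add: c_def)
qed

lemma lattice_tile_partition:
  fixes W :: "(real^'n) set"
  assumes W: "W \<in> sets lebesgue" and inf: "\<And>y. infinite {m. y + lattice_enum m \<in> W}"
  obtains K :: "nat \<Rightarrow> (real^'n) set" where "\<And>i. lattice_tile (K i)" "disjoint_family K" "(\<Union>i. K i) = W"
proof -
  let ?Q = "unit_cube :: (real^'n) set"
  let ?C = "\<lambda>m x. card {l. x - lattice_enum m + lattice_enum l \<in> W \<and> l < m}"
  define K where "K i = {x \<in> W. \<exists>m. x - lattice_enum m \<in> ?Q \<and> ?C m x = i}" for i
    \<comment> \<open>the points of \<open>W\<close> that come \<open>i\<close>-th among the points of \<open>W\<close> in their coset, in the order of the enumeration\<close>
  have Qu: "\<exists>!m. x - lattice_enum m \<in> ?Q" for x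
  proof -
    obtain k where k: "k \<in> integer_lattice" "x + k \<in> ?Q" "\<And>l. l \<in> integer_lattice \<Longrightarrow> x + l \<in> ?Q \<Longrightarrow> l = k"
      using lattice_tile_unit_cube unfolding lattice_tile_def by metis
    obtain m where m: "- k = lattice_enum m"
      using integer_lattice_uminus[OF k(1)] unfolding range_lattice_enum[symmetric] by (rule imageE)
    show ?thesis
    proof (rule ex1I[of _ m])
      show "x - lattice_enum m \<in> ?Q" using k(2) by (simp add: m[symmetric])
      fix l assume "x - lattice_enum l \<in> ?Q"
      then have "- lattice_enum l = k" by (intro k(3) integer_lattice_uminus lattice_enum_in) simp
      then show "l = m" using m by (metis lattice_enum_inj minus_minus)
    qed
  qed
  have tile: "lattice_tile (K i)" for i
    unfolding lattice_tile_def
  proof (intro conjI allI)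
    \<comment> \<open>Measurability: on the piece where the index m of the translation into the cube
      is fixed, the rank is a finite sum of indicators of translates of W.\<close>
    have "K i = (\<Union>m. W \<inter> ({x. x - lattice_enum m \<in> ?Q} \<inter>
        ((\<lambda>x. \<Sum>l<m. indicator W (x - lattice_enum m + lattice_enum l) :: real) -` {real i})))"
    proof -
      have "(\<Sum>l<m. indicator W (x - lattice_enum m + lattice_enum l) :: real) = real (?C m x)" for m :: nat and x
      proof -
        have "(\<Sum>l<m. indicator W (x - lattice_enum m + lattice_enum l) :: real)
            = (\<Sum>l<m. of_bool (x - lattice_enum m + lattice_enum l \<in> W))"
          by (simp add: indicator_def)
        also have "\<dots> = real (card ({..<m} \<inter> {l. x - lattice_enum m + lattice_enum l \<in> W}))"
          by (intro sum_of_bool_eq finite_lessThan)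
        also have "{..<m} \<inter> {l. x - lattice_enum m + lattice_enum l \<in> W}
            = {l. x - lattice_enum m + lattice_enum l \<in> W \<and> l < m}" by auto
        finally show ?thesis .
      qed
      then show ?thesis by (auto simp: K_def)
    qed
    also have "\<dots> \<in> sets lebesgue"
    proof (intro sets.countable_nat_UN image_subsetI sets.Int[OF W])
      fix m :: nat
      have "(\<lambda>x. indicator W (x - lattice_enum m + lattice_enum l) :: real) \<in> borel_measurable lebesgue" for l
        using measurable_translate_comp[of "indicator W :: _ \<Rightarrow> real" "lattice_enum l - lattice_enum m"] W
        by (simp add: algebra_simps)
      then have "(\<lambda>x. \<Sum>l<m. indicator W (x - lattice_enum m + lattice_enum l) :: real) \<in> borel_measurable lebesgue"
        by (intro borel_measurable_sum)
      from measurable_sets[OF this, of "{real i}"]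
      have "(\<lambda>x. \<Sum>l<m. indicator W (x - lattice_enum m + lattice_enum l) :: real) -` {real i} \<in> sets lebesgue"
        by simp
      then show "{x. x - lattice_enum m \<in> ?Q} \<inter>
          ((\<lambda>x. \<Sum>l<m. indicator W (x - lattice_enum m + lattice_enum l) :: real) -` {real i}) \<in> sets lebesgue"
        by (rule sets.Int[OF lattice_tile_sets[OF lattice_tile_translate[OF lattice_tile_unit_cube]]])
    qed
    finally show "K i \<in> sets lebesgue" .
    fix x :: "real^'n"
    obtain a where a: "x - lattice_enum a \<in> ?Q" "\<And>b. x - lattice_enum b \<in> ?Q \<Longrightarrow> b = a"
      using Qu[of x] by metis
    define y where "y = x - lattice_enum a"
    \<comment> \<open>Relative to the representative y in the cube, m itself is the index of the
      point y + \<open>lattice_enum m\<close>; membership in K i says that m is the i-th index that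
      leads into W.\<close>
    have Ki: "y + lattice_enum m \<in> K i \<longleftrightarrow>
        m \<in> {m. y + lattice_enum m \<in> W} \<and> card {l \<in> {m. y + lattice_enum m \<in> W}. l < m} = i" for m
    proof -
      have "y + lattice_enum m - lattice_enum b \<in> ?Q \<longleftrightarrow> b = m" for b
      proof -
        have "y + lattice_enum m - lattice_enum m \<in> ?Q" using a(1) by (simp add: y_def)
        with Qu[of "y + lattice_enum m"] show ?thesis by blast
      qed
      then show ?thesis by (simp add: K_def)
    qed
    have "\<exists>!m. y + lattice_enum m \<in> K i"
      unfolding Ki by (rule infinite_ex1_card_less[OF inf])
    then have "\<exists>!k. k \<in> integer_lattice \<and> y + k \<in> K i" by (simp only: ex1_lattice_enum)
    then obtain k where k: "k \<in> integer_lattice" "y + k \<in> K i" "\<And>l. l \<in> integer_lattice \<Longrightarrow> y + l \<in> K i \<Longrightarrow> l = k"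
      by metis
    show "\<exists>!k. k \<in> integer_lattice \<and> x + k \<in> K i"
    proof (rule ex1I[of _ "k - lattice_enum a"])
      show "k - lattice_enum a \<in> integer_lattice \<and> x + (k - lattice_enum a) \<in> K i"
        using k(1,2) by (auto simp: y_def algebra_simps intro: integer_lattice_diff lattice_enum_in)
      fix l assume l: "l \<in> integer_lattice \<and> x + l \<in> K i"
      then have "l + lattice_enum a = k"
        by (intro k(3)) (auto simp: y_def algebra_simps intro: integer_lattice_add lattice_enum_in)
      then show "l = k - lattice_enum a" by auto
    qed
  qed
  show thesis
  proof (rule that[OF tile])
    show "disjoint_family K"
      unfolding disjoint_family_on_def K_def using Qu by fastforce
    show "(\<Union>i. K i) = W"
      unfolding K_def using Qu by fastforce
  qed
qed

subsection \<open>From dilation tiles to wavelets\<close>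

text \<open>The system before the Fourier transform. M will be the transpose of A; since the
  transform inverts and transposes a dilation, the exponent -j becomes
  \<open>matrix_powi A j\<close> in the wavelet system.\<close>

definition frequency_system ::
    "real^'n^'n \<Rightarrow> (nat \<Rightarrow> (real^'n) set) \<Rightarrow> int \<times> (real^'n) \<times> nat \<Rightarrow> real^'n \<Rightarrow> complex" where
  "frequency_system M K = (\<lambda>(j, k, i). dilate (matrix_powi M (- j)) (tile_wave (K i) k))"

lemma tile_wave_L12: "lattice_tile K \<Longrightarrow> tile_wave K k \<in> L12"
proof -
  assume K: "lattice_tile K"
  have "(\<lambda>x. tile_wave K k x * indicator K x) \<in> L12"
    by (rule L2_finite_measure_L12[OF tile_wave_L2[OF K] tile_lmeasurable[OF K]])
  moreover have "(\<lambda>x. tile_wave K k x * indicator K x) = tile_wave K k"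
    by (auto simp: tile_wave_def indicator_def)
  ultimately show ?thesis by simp
qed

lemma frequency_system_L12:
  "invertible M \<Longrightarrow> (\<And>i. lattice_tile (K i)) \<Longrightarrow> frequency_system M K p \<in> L12"
  by (cases p) (auto simp: frequency_system_def intro!: dilate_L12 matrix_powi_invertible tile_wave_L12)

lemma L2_inner_disjoint:
  assumes "AE x in lebesgue. f x = 0 \<or> g x = 0"
  shows "L2_inner f g = 0"
proof -
  have "AE x in lebesgue. f x * cnj (g x) = 0"
    using assms by eventually_elim auto
  then show ?thesis unfolding L2_inner_def by (rule integral_eq_zero_AE)
qed

context
  fixes M :: "real^'n^'n" and W :: "(real^'n) set" and K :: "nat \<Rightarrow> (real^'n) set"
  assumes M: "invertible M" and W: "dilation_tile M W"
    and K: "\<And>i. lattice_tile (K i)" and disj: "disjoint_family K" and UK: "(\<Union>i. K i) = W"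
begin

text \<open>For equal j the dilation is unitary, which leaves exponentials on one tile or functions
  on disjoint tiles. For different j the supports are dilates of W by different powers and overlap
  in a null set only.\<close>

lemma frequency_system_orthonormal:
  "L2_orthonormal (wavelet_index integer_lattice \<infinity>) (frequency_system M K)"
  unfolding L2_orthonormal_def
proof (intro conjI ballI)
  fix p show "frequency_system M K p \<in> L2_space"
    by (rule L12_L2[OF frequency_system_L12[OF M K]])
next
  fix p q :: "int \<times> (real^'n) \<times> nat"
  assume p: "p \<in> wavelet_index integer_lattice \<infinity>" and q: "q \<in> wavelet_index integer_lattice \<infinity>"
  obtain j k i where pe: "p = (j, k, i)" by (cases p)
  obtain j' k' i' where qe: "q = (j', k', i')" by (cases q)
  have k: "k \<in> integer_lattice" "k' \<in> integer_lattice"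
    using p q by (auto simp: pe qe wavelet_index_def)
  note inv = matrix_powi_invertible[OF M]
  show "L2_inner (frequency_system M K p) (frequency_system M K q) = (if p = q then 1 else 0)"
  proof (cases "j = j'")
    case True
    have "L2_inner (frequency_system M K p) (frequency_system M K q) = L2_inner (tile_wave (K i) k) (tile_wave (K i') k')"
      by (simp add: pe qe True frequency_system_def dilate_inner[OF inv] tile_wave_L2[OF K])
    also have "\<dots> = (if p = q then 1 else 0)"
    proof (cases "i = i'")
      case True
      then show ?thesis
        using tile_wave_orthonormal[OF K, of i'] k \<open>j = j'\<close> by (auto simp: L2_orthonormal_def pe qe)
    next
      case False
      then have "K i \<inter> K i' = {}" using disj by (auto simp: disjoint_family_on_def)
      then have "L2_inner (tile_wave (K i) k) (tile_wave (K i') k') = 0"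
        by (intro L2_inner_disjoint AE_I2) (auto simp: tile_wave_def indicator_def)
      with False show ?thesis by (simp add: pe qe)
    qed
    finally show ?thesis .
  next
    case False
    have "AE x in lebesgue. \<exists>!j. matrix_powi M j *v x \<in> W"
      using W by (simp add: dilation_tile_def)
    then have "AE x in lebesgue. frequency_system M K p x = 0 \<or> frequency_system M K q x = 0"
    proof eventually_elim
      case (elim x)
      show ?case
      proof (rule ccontr)
        assume "\<not> ?thesis"
        then have "matrix_powi M (- j) *v x \<in> K i" "matrix_powi M (- j') *v x \<in> K i'"
          by (auto simp: pe qe frequency_system_def dilate_def tile_wave_def indicator_def split: if_splits)
        then have "matrix_powi M (- j) *v x \<in> W" "matrix_powi M (- j') *v x \<in> W"
          using UK by blast+
        with elim have "- j = - j'" by blast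
        with False show False by simp
      qed
    qed
    then show ?thesis using False by (simp add: L2_inner_disjoint pe qe)
  qed
qed

lemma frequency_system_subset: "frequency_system M K ` S \<subseteq> L2_space"
  by (rule image_subsetI, rule L12_L2, rule frequency_system_L12[OF M K])

lemma frequency_piece_closed_span:
  assumes f: "f \<in> L2_space"
  shows "(\<lambda>x. f x * indicator (K i) (matrix_powi M (- j) *v x))
    \<in> L2_closed_span (frequency_system M K ` wavelet_index integer_lattice \<infinity>)"
proof -
  let ?N = "matrix_powi M (- j)" and ?H = "frequency_system M K ` wavelet_index integer_lattice \<infinity>"
  have N: "invertible ?N" by (rule matrix_powi_invertible[OF M])
  let ?g = "dilate (matrix_inv ?N) f"
  have "dilate ?N (\<lambda>x. ?g x * indicator (K i) x) \<in> L2_closed_span ?H"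
  proof (rule dilate_closed_span[OF N frequency_system_subset tile_wave_subset[OF K[of i]]])
    show "(\<lambda>x. ?g x * indicator (K i) x) \<in> L2_closed_span (tile_wave (K i) ` integer_lattice)"
      by (rule tile_closed_span[OF K dilate_L2[OF invertible_matrix_inv[OF N] f]])
    fix g assume "g \<in> tile_wave (K i) ` integer_lattice"
    then obtain k where k: "k \<in> integer_lattice" "g = tile_wave (K i) k" by blast
    have "dilate ?N g = frequency_system M K (j, k, i)" by (simp add: k frequency_system_def)
    moreover have "(j, k, i) \<in> wavelet_index integer_lattice \<infinity>" by (simp add: wavelet_index_def k)
    ultimately show "dilate ?N g \<in> L2_closed_span ?H"
      by (intro lspan_closed_span[OF lspan_base frequency_system_subset]) auto
  qed
  also have "dilate ?N (\<lambda>x. ?g x * indicator (K i) x) = (\<lambda>x. dilate ?N ?g x * indicator (K i) (?N *v x))"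
    by (auto simp: dilate_def)
  finally show ?thesis by (simp add: dilate_dilate_inv[OF N])
qed

text \<open>Off a null set exactly one pair of a dilation j and a tile i captures x, so the finite
  sums over j and i equal 0 until that pair is included and the full value from then on.\<close>

lemma frequency_system_complete:
  assumes f: "f \<in> L2_space"
  shows "f \<in> L2_closed_span (frequency_system M K ` wavelet_index integer_lattice \<infinity>)"
proof -
  let ?H = "frequency_system M K ` wavelet_index integer_lattice \<infinity>"
  note H = frequency_system_subset[of "wavelet_index integer_lattice \<infinity>"]
  have "AE x in lebesgue. \<exists>!j. matrix_powi M j *v x \<in> W"
    using W by (simp add: dilation_tile_def)
  then obtain Z where Z: "{x \<in> space lebesgue. \<not> (\<exists>!j. matrix_powi M j *v x \<in> W)} \<subseteq> Z"
      "emeasure lebesgue Z = 0" "Z \<in> sets lebesgue"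
    by (rule AE_E)
  have good: "\<exists>!j. matrix_powi M j *v x \<in> W" if "x \<notin> Z" for x
    using Z(1) that by auto
  have AEZ: "AE x in lebesgue. x \<notin> Z"
    using Z(2,3) by (intro AE_not_in) (simp add: null_sets_def)
  \<comment> \<open>The function is set to 0 on the exceptional set, because
    \<open>closed_span_dominated_limit\<close> wants the domination at every point.\<close>
  define g where "g x = f x * indicator (- Z) x" for x
  have gL: "g \<in> L2_space"
    unfolding g_def[abs_def] using Z(3) by (intro L2_mult_indicator[OF f]) (simp add: Compl_in_sets_lebesgue)
  have fg: "AE x in lebesgue. g x = f x"
    using AEZ by eventually_elim (simp add: g_def)
  define h where "h m x = (\<Sum>j\<in>{- int m..int m}. \<Sum>i\<le>m. g x * indicator (K i) (matrix_powi M (- j) *v x))" for m x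
  have hcl: "h m \<in> L2_closed_span ?H" for m
    unfolding h_def[abs_def] by (intro closed_span_sum[OF H] frequency_piece_closed_span gL)
  have h_eq: "\<exists>j0 i0. \<forall>m. h m x = (if \<bar>j0\<bar> \<le> int m \<and> i0 \<le> m then g x else 0)" if x: "x \<notin> Z" for x
  proof -
    obtain j1 where j1: "matrix_powi M j1 *v x \<in> W" "\<And>j. matrix_powi M j *v x \<in> W \<Longrightarrow> j = j1"
      using good[OF x] by blast
    obtain i0 where i0: "matrix_powi M j1 *v x \<in> K i0" using j1(1) UK by blast
    have ind: "indicator (K i) (matrix_powi M (- j) *v x) = (if j = - j1 \<and> i = i0 then 1 else 0 :: complex)" for i j
    proof -
      have "matrix_powi M (- j) *v x \<in> K i \<longleftrightarrow> j = - j1 \<and> i = i0"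
      proof
        assume A: "matrix_powi M (- j) *v x \<in> K i"
        then have "matrix_powi M (- j) *v x \<in> W" using UK by blast
        then have j: "- j = j1" by (rule j1(2))
        with A have "matrix_powi M j1 *v x \<in> K i" by simp
        with i0 disj have "i = i0" by (auto simp: disjoint_family_on_def)
        with j show "j = - j1 \<and> i = i0" by simp
      qed (use i0 in auto)
      then show ?thesis by (simp add: indicator_def)
    qed
    have "h m x = (if \<bar>- j1\<bar> \<le> int m \<and> i0 \<le> m then g x else 0)" for m
    proof -
      have "(\<Sum>i\<le>m. g x * indicator (K i) (matrix_powi M (- j) *v x)) = (if j = - j1 then (if i0 \<le> m then g x else 0) else 0)" for j
        unfolding ind by (cases "j = - j1") (auto simp: if_distrib cong: if_cong)
      then have "h m x = (\<Sum>j\<in>{- int m..int m}. if j = - j1 then (if i0 \<le> m then g x else 0) else 0)"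
        by (simp add: h_def)
      also have "\<dots> = (if \<bar>- j1\<bar> \<le> int m \<and> i0 \<le> m then g x else 0)"
        by (subst sum.delta) auto
      finally show ?thesis .
    qed
    then show ?thesis by blast
  qed
  have "g \<in> L2_closed_span ?H"
  proof (rule closed_span_dominated_limit[OF H L2_spaceD[OF gL] hcl gL])
    show "cmod (h m x) \<le> cmod (g x)" for m x
    proof (cases "x \<in> Z")
      case True
      then show ?thesis by (simp add: h_def g_def)
    next
      case False
      then obtain j0 i0 where "\<forall>m. h m x = (if \<bar>j0\<bar> \<le> int m \<and> i0 \<le> m then g x else 0)"
        using h_eq by blast
      then show ?thesis by simp
    qed
    show "AE x in lebesgue. (\<lambda>m. h m x) \<longlonglongrightarrow> g x"
      using AEZ
    proof eventually_elim
      case (elim x)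
      then obtain j0 i0 where e: "\<And>m. h m x = (if \<bar>j0\<bar> \<le> int m \<and> i0 \<le> m then g x else 0)"
        using h_eq by blast
      have "h m x = g x" if "m \<ge> nat \<bar>j0\<bar> + i0" for m
        unfolding e using that by auto
      then show ?case by (intro tendsto_eventually eventually_sequentiallyI)
    qed
  qed
  then show ?thesis by (rule closed_span_cong_AE[OF _ L2_spaceD[OF f] fg])
qed

lemma frequency_orthonormal_basis:
  "L2_orthonormal_basis (wavelet_index integer_lattice \<infinity>) (frequency_system M K)"
  using frequency_system_orthonormal frequency_system_complete by (auto simp: L2_orthonormal_basis_iff)

end

text \<open>Modulations turn into translations and dilations into inverse transposed ones. The
  normalizing factors match because |det A| to the power -j is the determinant of the frequency
  dilation up to sign.\<close>

lemma fourier_frequency_system: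
  fixes A :: "real^'n^'n"
  assumes A: "invertible A" and K: "\<And>i. lattice_tile (K i)"
  shows "fourier (frequency_system (transpose A) K p) = wavelet_system A (\<lambda>i. fourier (tile_wave (K i) 0)) p"
proof
  fix x
  obtain j k i where p: "p = (j, k, i)" by (cases p)
  let ?N = "matrix_powi (transpose A) (- j)"
  have T: "invertible (transpose A)" by (rule transpose_invertible[OF A])
  have N: "invertible ?N" by (rule matrix_powi_invertible[OF T])
  have tinv: "transpose (matrix_inv ?N) = matrix_powi A j"
    by (simp only: matrix_inv_powi[OF T] minus_minus) (simp add: matrix_powi_transpose[OF A])
  have det: "1 / sqrt \<bar>det ?N\<bar> = \<bar>det A\<bar> powr (real_of_int j / 2)"
  proof -
    have d: "\<bar>det A\<bar> > 0" using A by (simp add: invertible_det_nz)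
    have "sqrt \<bar>det ?N\<bar> = (\<bar>det A\<bar> powr (- real_of_int j)) powr (1 / 2)"
      by (simp add: abs_det_matrix_powi[OF T] powr_half_sqrt)
    also have "\<dots> = \<bar>det A\<bar> powr (- (real_of_int j / 2))"
      by (simp add: powr_powr)
    finally have s: "sqrt \<bar>det ?N\<bar> = \<bar>det A\<bar> powr (- (real_of_int j / 2))" .
    show ?thesis by (simp only: s powr_minus divide_inverse inverse_inverse_eq mult_1_left)
  qed
  have shift: "fourier (tile_wave (K i) k) y = fourier (tile_wave (K i) 0) (y + k)" for y
    unfolding fourier_def
    by (intro Bochner_Integration.integral_cong) (auto simp: tile_wave_def wave_add_left)
  have "fourier (frequency_system (transpose A) K p) x
      = of_real (1 / sqrt \<bar>det ?N\<bar>) * fourier (tile_wave (K i) k) (transpose (matrix_inv ?N) *v x)"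
    unfolding p frequency_system_def prod.case
    by (rule fourier_dilate[OF N L2_spaceD[OF tile_wave_L2[OF K]]])
  also have "\<dots> = wavelet_system A (\<lambda>i. fourier (tile_wave (K i) 0)) p x"
    unfolding tinv det shift by (simp add: p wavelet_system_def)
  finally show "fourier (frequency_system (transpose A) K p) x
    = wavelet_system A (\<lambda>i. fourier (tile_wave (K i) 0)) p x" .
qed

theorem dilation_tile_wavelet:
  fixes A :: "real^'n^'n"
  assumes A: "invertible A" and W: "dilation_tile (transpose A) W" "large_balls W"
  shows "\<exists>\<psi>. orthonormal_wavelet A integer_lattice \<infinity> \<psi>"
proof -
  have T: "invertible (transpose A)" by (rule transpose_invertible[OF A])
  have Wm: "W \<in> sets lebesgue" using W(1) by (simp add: dilation_tile_def)
  show ?thesis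
  proof (rule lattice_tile_partition[OF Wm large_balls_infinite[OF W(2)]])
    fix K :: "nat \<Rightarrow> (real^'n) set"
    assume K: "\<And>i. lattice_tile (K i)" "disjoint_family K" "(\<Union>i. K i) = W"
    let ?\<psi> = "\<lambda>i. fourier (tile_wave (K i) 0)"
    have "L2_orthonormal_basis (wavelet_index integer_lattice \<infinity>) (\<lambda>p. fourier (frequency_system (transpose A) K p))"
      by (intro fourier_orthonormal_basis frequency_orthonormal_basis[OF T W(1) K] frequency_system_L12[OF T K(1)])
    then have "L2_orthonormal_basis (wavelet_index integer_lattice \<infinity>) (wavelet_system A ?\<psi>)"
      by (simp only: fourier_frequency_system[OF A K(1)])
    then show ?thesis
      unfolding orthonormal_wavelet_def
      by (intro exI[of _ ?\<psi>] conjI allI impI fourier_L2 tile_wave_L12 K(1))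
  qed
qed

text \<open>The substitution by B intertwines the two systems: up to the bijection k \<mapsto> B k
  of indices, one is a unitary dilation of the other. Conjugation leaves the determinant in the
  normalization unchanged.\<close>

lemma orthonormal_wavelet_change_lattice:
  fixes A B :: "real^'n^'n"
  assumes A: "invertible A" and B: "invertible B"
    and \<psi>: "orthonormal_wavelet (matrix_inv B ** A ** B) integer_lattice \<infinity> \<psi>"
  shows "orthonormal_wavelet A ((\<lambda>k. B *v k) ` integer_lattice) \<infinity> (\<lambda>i. dilate (matrix_inv B) (\<psi> i))"
proof -
  let ?C = "matrix_inv B ** A ** B" and ?I = "wavelet_index integer_lattice \<infinity>"
  let ?\<phi> = "\<lambda>(j :: int, k, i :: nat). (j, B *v k, i)"
  have iB: "invertible (matrix_inv B)" by (rule invertible_matrix_inv[OF B])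
  have C: "invertible ?C" by (intro invertible_mult A B iB)
  have BB: "matrix_inv (matrix_inv B) = B" by (rule matrix_inv_eqI[OF matrix_inv_inverse(2)[OF B]])
  have pow: "matrix_powi ?C j = matrix_inv B ** matrix_powi A j ** B" for j
    using matrix_powi_similar[OF A iB, of ?C j] by (simp add: BB)
  have detC: "\<bar>det ?C\<bar> = \<bar>det A\<bar>"
    using B by (simp add: det_mul det_matrix_inv[OF B] invertible_det_nz)
  have sys: "wavelet_system A (\<lambda>i. dilate (matrix_inv B) (\<psi> i)) (?\<phi> p) = dilate (matrix_inv B) (wavelet_system ?C \<psi> p)" for p
  proof
    fix x
    obtain j k i where p: "p = (j, k, i)" by (cases p)
    have "matrix_inv B *v (matrix_powi A j *v x + B *v k) = matrix_powi ?C j *v (matrix_inv B *v x) + k"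
      by (simp add: matrix_vector_right_distrib matrix_inv_vector[OF B] pow matrix_vector_mul_assoc[symmetric])
    then show "wavelet_system A (\<lambda>i. dilate (matrix_inv B) (\<psi> i)) (?\<phi> p) x = dilate (matrix_inv B) (wavelet_system ?C \<psi> p) x"
      by (simp add: p wavelet_system_def dilate_def detC)
  qed
  have L: "\<psi> i \<in> L2_space" for i
    using \<psi> by (simp add: orthonormal_wavelet_def)
  have "L2_orthonormal_basis ?I (wavelet_system ?C \<psi>)"
    using \<psi> by (simp add: orthonormal_wavelet_def)
  then have "L2_orthonormal_basis ?I (\<lambda>p. wavelet_system A (\<lambda>i. dilate (matrix_inv B) (\<psi> i)) (?\<phi> p))"
    unfolding sys by (rule dilate_orthonormal_basis[OF iB])
  then have "L2_orthonormal_basis (?\<phi> ` ?I) (wavelet_system A (\<lambda>i. dilate (matrix_inv B) (\<psi> i)))"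
  proof (rule L2_orthonormal_basis_reindex)
    show "inj_on ?\<phi> ?I"
      by (auto simp: inj_on_def) (metis matrix_inv_vector(2)[OF B])
  qed
  moreover have "?\<phi> ` ?I = wavelet_index ((\<lambda>k. B *v k) ` integer_lattice) \<infinity>"
    by (auto simp: wavelet_index_def image_iff)
  ultimately show ?thesis
    unfolding orthonormal_wavelet_def using dilate_L2[OF iB L] by simp
qed

text \<open>The tile is pulled back by the inverse of P, which stretches lengths by at most some c;
  a ball of radius c r in W thus provides one of radius r in the pullback.\<close>

lemma dilation_tile_similar:
  fixes A B P :: "real^'n^'n"
  assumes A: "invertible A" and P: "invertible P" and B: "B = P ** A ** matrix_inv P"
    and W: "dilation_tile A W" "large_balls W"
  shows "\<exists>V. dilation_tile B V \<and> large_balls V"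
proof (intro exI conjI)
  let ?Q = "matrix_inv P"
  let ?V = "{x. ?Q *v x \<in> W}"
  have Q: "invertible ?Q" by (rule invertible_matrix_inv[OF P])
  show "dilation_tile B ?V"
    unfolding dilation_tile_def
  proof
    have "?V = (*v) ?Q -` W \<inter> space lebesgue" by auto
    then show "?V \<in> sets lebesgue"
      using measurable_sets[OF lebesgue_measurable_matrix_vector_mult[OF Q], of W] W(1)
      by (simp add: dilation_tile_def)
    have "AE x in lebesgue. \<exists>!j. matrix_powi A j *v (?Q *v x) \<in> W"
      using W(1) by (intro AE_matrix[OF Q]) (simp add: dilation_tile_def)
    moreover have "?Q *v (matrix_powi B j *v x) = matrix_powi A j *v (?Q *v x)" for j x
      by (simp add: matrix_powi_similar[OF A P B] matrix_vector_mul_assoc[symmetric] matrix_inv_vector[OF P])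
    ultimately show "AE x in lebesgue. \<exists>!j. matrix_powi B j *v x \<in> ?V" by simp
  qed
  show "large_balls ?V"
    unfolding large_balls_def
  proof
    fix r :: real
    obtain c where c: "c > 0" "\<And>x. norm (?Q *v x) \<le> c * norm x"
      using linear_bounded_pos[OF matrix_vector_mul_linear[of ?Q]] by (metis mult.commute)
    obtain y where y: "ball y (c * r) \<subseteq> W" using W(2) by (auto simp: large_balls_def)
    have "ball (P *v y) r \<subseteq> ?V"
    proof
      fix x assume "x \<in> ball (P *v y) r"
      then have "norm (P *v y - x) < r" by (simp add: dist_norm)
      have "norm (y - ?Q *v x) = norm (?Q *v (P *v y - x))"
        by (simp add: matrix_vector_mult_diff_distrib matrix_inv_vector[OF P])
      also have "\<dots> \<le> c * norm (P *v y - x)" by (rule c(2))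
      also have "\<dots> < c * r" using \<open>norm (P *v y - x) < r\<close> c(1) by simp
      finally show "x \<in> ?V" using y by (auto simp: dist_norm)
    qed
    then show "\<exists>x. ball x r \<subseteq> ?V" by blast
  qed
qed

subsection \<open>Dilation tiles from the real Jordan form\<close>

lemma block_diag_entry_column:
  assumes "c < cell_size B"
  shows "block_diag_entry (pre @ B # post) r (sum_list (map cell_size pre) + c)
    = (if sum_list (map cell_size pre) \<le> r \<and> r < sum_list (map cell_size pre) + cell_size B
       then cell_entry B (r - sum_list (map cell_size pre)) c else 0)"
  using assms by (induction pre arbitrary: r) (auto simp: not_less)

text \<open>The cells that are orthogonal as matrices. A proper cell that is not of this kind has an
  eigenvalue off the unit circle or a Jordan chain of length at least two.\<close>

fun rotation_cell :: "jordan_cell \<Rightarrow> bool" where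
  "rotation_cell (Real_Block m a) \<longleftrightarrow> m = 1 \<and> \<bar>a\<bar> = 1"
| "rotation_cell (Complex_Block m a b) \<longleftrightarrow> m = 1 \<and> a\<^sup>2 + b\<^sup>2 = 1"

lemma rotation_cell_columns:
  assumes "rotation_cell B" "c < cell_size B" "d < cell_size B"
  shows "(\<Sum>r<cell_size B. cell_entry B r c * cell_entry B r d) = (if c = d then 1 else 0)"
proof (cases B)
  case (Real_Block m a)
  then have "a * a = 1" using assms(1) by (auto simp: abs_if split: if_splits)
  with assms show ?thesis by (simp add: Real_Block)
next
  case (Complex_Block m a b)
  then have s: "{..<cell_size B} = {0, 1}" and ab: "a * a + b * b = 1"
    using assms(1) by (auto simp: power2_eq_square)
  have cd: "c \<in> {0, 1}" "d \<in> {0, 1}" using assms(2,3) s by (auto simp: set_eq_iff)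
  show ?thesis
    unfolding s using cd
    by (elim insertE emptyE) (simp_all add: Complex_Block ab add.commute[of "b * b"] mult.commute[of b a])
qed

lemma rotation_cells_columns:
  assumes "\<forall>B\<in>set Bs. rotation_cell B" "c < sum_list (map cell_size Bs)" "d < sum_list (map cell_size Bs)"
  shows "(\<Sum>r<sum_list (map cell_size Bs). block_diag_entry Bs r c * block_diag_entry Bs r d) = (if c = d then 1 else 0)"
  using assms
proof (induction Bs arbitrary: c d)
  case (Cons B Bs)
  let ?s = "cell_size B" and ?N = "sum_list (map cell_size Bs)"
  let ?f = "\<lambda>r. block_diag_entry (B # Bs) r c * block_diag_entry (B # Bs) r d"
  have "{..<?s + ?N} = {..<?s} \<union> (\<lambda>r. ?s + r) ` {..<?N}"
  proof (intro set_eqI iffI)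
    fix r assume r: "r \<in> {..<?s + ?N}"
    show "r \<in> {..<?s} \<union> (\<lambda>r. ?s + r) ` {..<?N}"
    proof (cases "r < ?s")
      case False
      then have "r = ?s + (r - ?s)" "r - ?s \<in> {..<?N}" using r by auto
      then show ?thesis by (intro UnI2 image_eqI)
    qed simp
  qed auto
  moreover have "{..<?s} \<inter> (\<lambda>r. ?s + r) ` {..<?N} = {}" by auto
  ultimately have split: "(\<Sum>r<?s + ?N. ?f r) = (\<Sum>r<?s. ?f r) + (\<Sum>r<?N. ?f (?s + r))"
    by (simp add: sum.union_disjoint sum.reindex)
  consider "c < ?s" "d < ?s" | "c < ?s" "?s \<le> d" | "?s \<le> c" "d < ?s" | "?s \<le> c" "?s \<le> d"
    by linarith
  then have "(\<Sum>r<?s + ?N. ?f r) = (if c = d then 1 else 0)"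
  proof cases
    case 1
    have "(\<Sum>r<?s. ?f r) = (\<Sum>r<?s. cell_entry B r c * cell_entry B r d)"
      by (rule sum.cong) (use 1 in auto)
    also have "\<dots> = (if c = d then 1 else 0)"
      by (rule rotation_cell_columns) (use Cons.prems 1 in auto)
    finally show ?thesis unfolding split using 1 by simp
  next
    case 2
    then show ?thesis unfolding split by simp
  next
    case 3
    then show ?thesis unfolding split by simp
  next
    case 4
    have "(\<Sum>r<?N. ?f (?s + r)) = (\<Sum>r<?N. block_diag_entry Bs r (c - ?s) * block_diag_entry Bs r (d - ?s))"
      by (rule sum.cong) (use 4 in auto)
    also have "\<dots> = (if c - ?s = d - ?s then 1 else 0)"
      by (rule Cons.IH) (use Cons.prems 4 in auto)
    finally show ?thesis unfolding split using 4 by auto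
  qed
  then show ?case by simp
qed simp

definition jordan_layout :: "real^'n^'n \<Rightarrow> (nat \<Rightarrow> 'n) \<Rightarrow> jordan_cell list \<Rightarrow> bool" where
  "jordan_layout J e Bs \<longleftrightarrow> bij_betw e {..<CARD('n)} UNIV \<and>
     (\<forall>B \<in> set Bs. proper_cell B) \<and>
     sum_list (map cell_size Bs) = CARD('n) \<and>
     (\<forall>r < CARD('n). \<forall>c < CARD('n). J $ e r $ e c = block_diag_entry Bs r c)"

lemma sum_layout:
  fixes e :: "nat \<Rightarrow> 'n::finite"
  assumes "bij_betw e {..<CARD('n)} UNIV"
  shows "(\<Sum>i\<in>UNIV. f i) = (\<Sum>r<CARD('n). f (e r))"
  using sum.reindex_bij_betw[OF assms, of f] by simp

lemma rotation_cells_orthogonal: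
  fixes J :: "real^'n^'n"
  assumes J: "jordan_layout J e Bs" and rot: "\<forall>B\<in>set Bs. rotation_cell B"
  shows "orthogonal_matrix J"
proof -
  have e: "bij_betw e {..<CARD('n)} UNIV" using J by (simp add: jordan_layout_def)
  have "(transpose J ** J) $ i $ k = (if i = k then 1 else 0)" for i k
  proof -
    obtain c where c: "c < CARD('n)" "i = e c" using e by (auto simp: bij_betw_def)
    obtain d where d: "d < CARD('n)" "k = e d" using e by (auto simp: bij_betw_def)
    have "(transpose J ** J) $ i $ k = (\<Sum>r<CARD('n). J $ e r $ i * J $ e r $ k)"
      by (simp add: matrix_matrix_mult_def transpose_def sum_layout[OF e])
    also have "\<dots> = (\<Sum>r<CARD('n). block_diag_entry Bs r c * block_diag_entry Bs r d)"
      using J c d by (intro sum.cong) (auto simp: jordan_layout_def)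
    also have "\<dots> = (if c = d then 1 else 0)"
      using rotation_cells_columns[OF rot, of c d] c(1) d(1) J by (simp add: jordan_layout_def)
    also have "\<dots> = (if i = k then 1 else 0)"
      using e c d by (auto simp: bij_betw_def inj_on_def)
    finally show ?thesis .
  qed
  then show ?thesis
    unfolding orthogonal_matrix by (simp add: vec_eq_iff mat_def)
qed

text \<open>A coordinate of the transposed action pairs a column of J with x, and a column vanishes
  outside its own cell. Each cell can therefore be studied alone, from its offset p on.\<close>

lemma jordan_transpose_column:
  fixes J :: "real^'n^'n"
  assumes J: "jordan_layout J e (pre @ B # post)" and c: "c < cell_size B"
  defines "p \<equiv> sum_list (map cell_size pre)"
  shows "(transpose J *v x) $ e (p + c) = (\<Sum>q<cell_size B. cell_entry B q c * x $ e (p + q))"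
proof -
  let ?s = "cell_size B"
  have e: "bij_betw e {..<CARD('n)} UNIV" using J by (simp add: jordan_layout_def)
  have n: "p + ?s \<le> CARD('n)" using J by (simp add: jordan_layout_def p_def)
  have "(transpose J *v x) $ e (p + c) = (\<Sum>r<CARD('n). J $ e r $ e (p + c) * x $ e r)"
    by (simp add: matrix_vector_mult_def transpose_def sum_layout[OF e] del: transpose_matrix_vector)
  also have "\<dots> = (\<Sum>r<CARD('n). (if p \<le> r \<and> r < p + ?s then cell_entry B (r - p) c * x $ e r else 0))"
  proof (rule sum.cong[OF refl])
    fix r assume "r \<in> {..<CARD('n)}"
    then have "J $ e r $ e (p + c) = block_diag_entry (pre @ B # post) r (p + c)"
      using J n c by (simp add: jordan_layout_def)
    then show "J $ e r $ e (p + c) * x $ e r = (if p \<le> r \<and> r < p + ?s then cell_entry B (r - p) c * x $ e r else 0)"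
      unfolding p_def by (simp add: block_diag_entry_column[OF c])
  qed
  also have "\<dots> = (\<Sum>r\<in>{p..<p + ?s}. cell_entry B (r - p) c * x $ e r)"
    by (rule sum.mono_neutral_cong_right) (use n in auto)
  also have "\<dots> = (\<Sum>q<?s. cell_entry B q c * x $ e (p + q))"
    by (rule sum.reindex_bij_witness[of _ "\<lambda>q. p + q" "\<lambda>r. r - p"]) auto
  finally show ?thesis .
qed

lemma sum_lessThan_truncate:
  fixes f :: "nat \<Rightarrow> real"
  assumes "t \<le> s" "\<And>q. t \<le> q \<Longrightarrow> f q = 0"
  shows "(\<Sum>q<s. f q) = (\<Sum>q<t. f q)"
  by (rule sum.mono_neutral_right) (use assms in auto)

text \<open>The cells are block upper triangular, so the first column, or the first two for a
  complex pair, involves the diagonal block only. Hence l is the first coordinate, respectively the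
  first complex coordinate x_p + i x_(p+1), with eigenvalue a + i b. The next position in the cell
  gives m, where the 1 on the superdiagonal adds l. One basis vector v normalizes both.\<close>

lemma non_rotation_eigenfunctional:
  fixes J :: "real^'n^'n"
  assumes J: "jordan_layout J e Bs" and B: "B \<in> set Bs" "\<not> rotation_cell B"
  shows "\<exists>\<alpha> l v. linear l \<and> l v = (1::complex) \<and> (\<forall>x. l (transpose J *v x) = \<alpha> * l x) \<and>
    (cmod \<alpha> \<noteq> 1 \<or> (\<exists>m. linear m \<and> m v = (0::complex) \<and> (\<forall>x. m (transpose J *v x) = \<alpha> * m x + l x)))"
proof -
  obtain pre post where Bs: "Bs = pre @ B # post" using B(1) by (metis split_list)
  define p where "p = sum_list (map cell_size pre)"
  note col = jordan_transpose_column[OF J[unfolded Bs], folded p_def]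
  have col': "(transpose J *v x) $ e (p + c) = (\<Sum>q<t. cell_entry B q c * x $ e (p + q))"
    if "c < cell_size B" "t \<le> cell_size B" "\<And>q. t \<le> q \<Longrightarrow> cell_entry B q c = 0" for c t x
    unfolding col[OF that(1)] using that(2,3) by (intro sum_lessThan_truncate) auto
  have e: "bij_betw e {..<CARD('n)} UNIV" using J by (simp add: jordan_layout_def)
  have n: "p + cell_size B \<le> CARD('n)" using J by (simp add: jordan_layout_def p_def Bs)
  have inj: "e (p + c) = e (p + d) \<longleftrightarrow> c = d" if "c < cell_size B" "d < cell_size B" for c d
    using e n that by (auto simp: bij_betw_def inj_on_eq_iff)
  have proper: "proper_cell B" using J B(1) by (simp add: jordan_layout_def)
  let ?v = "axis (e p) 1 :: real^'n"
  show ?thesis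
  proof (cases B)
    case (Real_Block m a)
    have m: "m > 0" using proper Real_Block by simp
    let ?l = "\<lambda>x::real^'n. complex_of_real (x $ e p)"
    have c0: "(transpose J *v x) $ e p = a * x $ e p" for x
    proof -
      have "(transpose J *v x) $ e (p + 0) = (\<Sum>q<1. cell_entry B q 0 * x $ e (p + q))"
        by (rule col') (use m in \<open>auto simp: Real_Block\<close>)
      then show ?thesis by (simp add: Real_Block algebra_simps)
    qed
    have l: "linear ?l" "?l ?v = 1" "\<forall>x. ?l (transpose J *v x) = of_real a * ?l x"
      unfolding c0 by (auto intro!: linearI simp: scaleR_conv_of_real[where 'a=complex] axis_def)
    show ?thesis
    proof (cases "\<bar>a\<bar> = 1")
      case False
      then have "cmod (of_real a) \<noteq> 1" by simp
      with l show ?thesis by blast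
    next
      case True
      \<comment> \<open>A cell of size 1 with unimodular eigenvalue would be a rotation cell, so
        there is a second column.\<close>
      with B(2) m have m2: "m \<ge> 2" by (auto simp: Real_Block)
      let ?m = "\<lambda>x::real^'n. complex_of_real (x $ e (p + 1))"
      have c1: "(transpose J *v x) $ e (p + 1) = x $ e p + a * x $ e (p + 1)" for x
    proof -
      have "(transpose J *v x) $ e (p + 1) = (\<Sum>q<2. cell_entry B q 1 * x $ e (p + q))"
        by (rule col') (use m2 in \<open>auto simp: Real_Block\<close>)
      then show ?thesis by (simp add: Real_Block lessThan_Suc eval_nat_numeral algebra_simps)
    qed
      have "linear ?m" "?m ?v = 0" "\<forall>x. ?m (transpose J *v x) = of_real a * ?m x + ?l x"
        unfolding c1 using inj[of 0 1] m2
        by (auto intro!: linearI simp: scaleR_conv_of_real[where 'a=complex] axis_def Real_Block)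
      with l show ?thesis by blast
    qed
  next
    case (Complex_Block m a b)
    have m: "m > 0" using proper Complex_Block by simp
    let ?l = "\<lambda>x::real^'n. Complex (x $ e p) (x $ e (p + 1))"
    let ?\<alpha> = "Complex a b"
    have c0: "(transpose J *v x) $ e p = a * x $ e p - b * x $ e (p + 1)" for x
    proof -
      have "(transpose J *v x) $ e (p + 0) = (\<Sum>q<2. cell_entry B q 0 * x $ e (p + q))"
        by (rule col') (use m in \<open>auto simp: Complex_Block\<close>)
      then show ?thesis by (simp add: Complex_Block lessThan_Suc eval_nat_numeral algebra_simps)
    qed
    have c1: "(transpose J *v x) $ e (p + 1) = b * x $ e p + a * x $ e (p + 1)" for x
    proof -
      have "(transpose J *v x) $ e (p + 1) = (\<Sum>q<2. cell_entry B q 1 * x $ e (p + q))"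
        by (rule col') (use m in \<open>auto simp: Complex_Block\<close>)
      then show ?thesis by (simp add: Complex_Block lessThan_Suc eval_nat_numeral algebra_simps)
    qed
    have l: "linear ?l" "?l ?v = 1" "\<forall>x. ?l (transpose J *v x) = ?\<alpha> * ?l x"
      unfolding c0 c1 using inj[of 0 1] m
      by (auto intro!: linearI simp: complex_eq_iff axis_def Complex_Block)
    show ?thesis
    proof (cases "a\<^sup>2 + b\<^sup>2 = 1")
      case False
      then have "cmod ?\<alpha> \<noteq> 1" by (simp add: cmod_def)
      with l show ?thesis by blast
    next
      case True
      with B(2) m have m2: "m \<ge> 2" by (auto simp: Complex_Block)
      let ?m = "\<lambda>x::real^'n. Complex (x $ e (p + 2)) (x $ e (p + 3))"
      have s4: "{..<4::nat} = {0, 1, 2, 3}" by auto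
      have c2: "(transpose J *v x) $ e (p + 2) = x $ e p + a * x $ e (p + 2) - b * x $ e (p + 3)" for x
    proof -
      have "(transpose J *v x) $ e (p + 2) = (\<Sum>q<4. cell_entry B q 2 * x $ e (p + q))"
        by (rule col') (use m2 in \<open>auto simp: Complex_Block\<close>)
      then show ?thesis by (simp add: Complex_Block s4 algebra_simps)
    qed
      have c3: "(transpose J *v x) $ e (p + 3) = x $ e (p + 1) + b * x $ e (p + 2) + a * x $ e (p + 3)" for x
    proof -
      have "(transpose J *v x) $ e (p + 3) = (\<Sum>q<4. cell_entry B q 3 * x $ e (p + q))"
        by (rule col') (use m2 in \<open>auto simp: Complex_Block\<close>)
      then show ?thesis by (simp add: Complex_Block s4 algebra_simps)
    qed
      have "linear ?m" "?m ?v = 0" "\<forall>x. ?m (transpose J *v x) = ?\<alpha> * ?m x + ?l x"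
        unfolding c2 c3 using inj[of 0 2] inj[of 0 3] m2
        by (auto intro!: linearI simp: complex_eq_iff axis_def Complex_Block)
      with l show ?thesis by blast
    qed
  qed
qed

text \<open>
  On the orbit of a point the values of \<open>u\<close> form a class modulo 1; the function \<open>\<kappa>\<close> prescribes the integer
  part of the representative whose point is put into the tile.
\<close>

lemma dilation_tile_cocycle:
  fixes M :: "real^'n^'n" and \<kappa> :: "real \<Rightarrow> real"
  assumes M: "invertible M" and G: "G \<in> sets borel" "AE x in lebesgue. x \<in> G" "\<And>x. M *v x \<in> G \<longleftrightarrow> x \<in> G"
    and u[measurable]: "u \<in> borel_measurable borel" and um: "\<And>x. x \<in> G \<Longrightarrow> u (M *v x) = u x + of_int \<sigma>"
    and \<sigma>: "\<sigma> = 1 \<or> \<sigma> = - 1" and \<kappa>[measurable]: "\<kappa> \<in> borel_measurable borel"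
  shows "dilation_tile M {x \<in> G. \<lfloor>u x\<rfloor> = \<lfloor>\<kappa> (frac (u x))\<rfloor>}"
  unfolding dilation_tile_def
proof
  have [measurable]: "G \<in> sets borel" by (rule G)
  have "{x \<in> G. \<lfloor>u x\<rfloor> = \<lfloor>\<kappa> (frac (u x))\<rfloor>} = {x \<in> space borel. x \<in> G \<and> \<lfloor>u x\<rfloor> = \<lfloor>\<kappa> (u x - of_int \<lfloor>u x\<rfloor>)\<rfloor>}"
    by (auto simp: frac_def)
  also have "\<dots> \<in> sets borel" by measurable
  finally show "{x \<in> G. \<lfloor>u x\<rfloor> = \<lfloor>\<kappa> (frac (u x))\<rfloor>} \<in> sets lebesgue" by auto
  have iter: "matrix_powi M j *v x \<in> G \<and> u (matrix_powi M j *v x) = u x + of_int (\<sigma> * j)" if x: "x \<in> G" for j x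
  proof (induction j rule: int_induct[of _ 0])
    case base
    then show ?case using x by simp
  next
    case (step1 i)
    have s: "matrix_powi M (i + 1) *v x = M *v (matrix_powi M i *v x)"
      by (simp add: matrix_powi_step[OF M] matrix_vector_mul_assoc)
    show ?case unfolding s using step1.IH G(3) um by (auto simp: algebra_simps)
  next
    case (step2 i)
    have s: "matrix_powi M i *v x = M *v (matrix_powi M (i - 1) *v x)"
      using matrix_powi_step[OF M, of "i - 1"] by (simp add: matrix_vector_mul_assoc)
    have g: "matrix_powi M (i - 1) *v x \<in> G" using step2.IH unfolding s G(3) by blast
    from um[OF this] have "u (matrix_powi M i *v x) = u (matrix_powi M (i - 1) *v x) + of_int \<sigma>"
      unfolding s .
    with g step2.IH show ?case by (simp add: algebra_simps)
  qed
  show "AE x in lebesgue. \<exists>!j. matrix_powi M j *v x \<in> {x \<in> G. \<lfloor>u x\<rfloor> = \<lfloor>\<kappa> (frac (u x))\<rfloor>}"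
    using G(2)
  proof eventually_elim
    case (elim x)
    have frac: "frac (u x + of_int k) = frac (u x)" for k :: int
      by (simp add: frac_def)
    \<comment> \<open>The fractional part of u is constant along the orbit, so membership is a
      linear equation in j with coefficient 1 or -1, which has exactly one integer solution.\<close>
    have iff: "matrix_powi M j *v x \<in> {x \<in> G. \<lfloor>u x\<rfloor> = \<lfloor>\<kappa> (frac (u x))\<rfloor>} \<longleftrightarrow>
        \<lfloor>u x\<rfloor> + \<sigma> * j = \<lfloor>\<kappa> (frac (u x))\<rfloor>" for j
      using iter[OF elim, of j] by (simp add: frac del: of_int_mult)
    show ?case
      unfolding iff
    proof (rule ex1I[of _ "\<sigma> * (\<lfloor>\<kappa> (frac (u x))\<rfloor> - \<lfloor>u x\<rfloor>)"])
      show "\<lfloor>u x\<rfloor> + \<sigma> * (\<sigma> * (\<lfloor>\<kappa> (frac (u x))\<rfloor> - \<lfloor>u x\<rfloor>)) = \<lfloor>\<kappa> (frac (u x))\<rfloor>"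
        using \<sigma> by auto
      show "j = \<sigma> * (\<lfloor>\<kappa> (frac (u x))\<rfloor> - \<lfloor>u x\<rfloor>)" if "\<lfloor>u x\<rfloor> + \<sigma> * j = \<lfloor>\<kappa> (frac (u x))\<rfloor>" for j
        using \<sigma> that by auto
    qed
  qed
qed

section \<open>Tiles from eigenfunctionals and Jordan chains\<close>

lemma AE_functional_nonzero:
  fixes l :: "real^'n \<Rightarrow> complex"
  assumes l: "linear l" and v: "l v \<noteq> 0"
  shows "AE x in lebesgue. l x \<noteq> 0"
proof -
  have sub: "subspace {x. l x = 0}" using l by (rule linear_subspace_kernel)
  have "dim {x. l x = 0} < DIM(real^'n)"
  proof (rule ccontr)
    assume "\<not> ?thesis"
    then have "dim {x. l x = 0} = DIM(real^'n)"
      using dim_subset_UNIV[of "{x. l x = 0}"] by linarith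
    then have "span {x. l x = 0} = UNIV" by (simp only: dim_eq_full)
    then have "{x. l x = 0} = UNIV" using sub by (metis span_eq_iff)
    with v show False by blast
  qed
  then have "negligible {x. l x = 0}" by (rule negligible_lowdim)
  then have "{x. l x = 0} \<in> null_sets lebesgue" by (simp add: negligible_iff_null_sets)
  from AE_not_in[OF this] show ?thesis by simp
qed

text \<open>The exponents differ only by c/(m(m + 1)), but the exponential growth in m outweighs
  this quadratic decay.\<close>

lemma ex_large_exp_gap:
  fixes c R :: real
  assumes c: "c > 0"
  shows "\<exists>m::nat. m \<ge> 1 \<and> R \<le> exp (c * (real m + 1 - 1 / (real m + 1))) - exp (c * (real m + 1 - 1 / real m))"
proof -
  have "filterlim (\<lambda>m::nat. exp (c * (real m + 1 - 1 / (real m + 1))) - exp (c * (real m + 1 - 1 / real m))) at_top sequentially"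
    using c by real_asymp
  then have "eventually (\<lambda>m::nat. R \<le> exp (c * (real m + 1 - 1 / (real m + 1))) - exp (c * (real m + 1 - 1 / real m))) sequentially"
    by (simp add: filterlim_at_top)
  then have "eventually (\<lambda>m::nat. m \<ge> 1 \<and> R \<le> exp (c * (real m + 1 - 1 / (real m + 1))) - exp (c * (real m + 1 - 1 / real m))) sequentially"
    using eventually_ge_at_top[of "1::nat"] by eventually_elim simp
  from eventually_happens'[OF sequentially_bot this] show ?thesis .
qed

text \<open>Explains the choice 1/(1 - f) for \<kappa>. A single shell, with the integer part of u
  fixed, contains no large balls, so the tile has to visit every shell m; this \<kappa> assigns to
  it the fractional parts from 1 - 1/m up to 1 - 1/(m + 1).\<close>

lemma floor_frac_interval:
  fixes t :: real and m :: nat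
  assumes m: "m \<ge> 1" and t: "real m + 1 - 1 / real m < t" "t < real m + 1 - 1 / (real m + 1)"
  shows "\<lfloor>t\<rfloor> = \<lfloor>1 / (1 - frac t)\<rfloor>"
proof -
  have "1 / real m \<le> 1" "0 < 1 / (real m + 1)" using m by auto
  then have fl: "\<lfloor>t\<rfloor> = int m" using t by linarith
  then have fr: "1 - frac t = real m + 1 - t" by (simp add: frac_def)
  have "1 / (real m + 1) < 1 - frac t" "1 - frac t < 1 / real m" using t fr by linarith+
  moreover have "0 < 1 - frac t" using \<open>0 < 1 / (real m + 1)\<close> calculation by linarith
  ultimately have "real m < 1 / (1 - frac t)" "1 / (1 - frac t) < real m + 1"
    using m by (simp_all add: field_simps)
  then have "\<lfloor>1 / (1 - frac t)\<rfloor> = int m" by linarith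
  with fl show ?thesis by simp
qed

lemma linear_functional_bound:
  fixes l :: "real^'n \<Rightarrow> complex"
  assumes "linear l"
  obtains K where "K > 0" "\<And>x. cmod (l x) \<le> K * norm x"
  using linear_bounded_pos[OF assms] by metis

lemma eigenfunctional_dilation_tile:
  fixes M :: "real^'n^'n"
  assumes M: "invertible M" and l: "linear l" "l v = (1::complex)" "\<And>x. l (M *v x) = \<alpha> * l x" and \<alpha>: "cmod \<alpha> \<noteq> 1"
  shows "\<exists>W. dilation_tile M W \<and> large_balls W"
proof -
  have "l (M *v (matrix_inv M *v v)) = 1" using l(2) by (simp add: matrix_inv_vector[OF M])
  then have a0: "\<alpha> \<noteq> 0" using l(3)[of "matrix_inv M *v v"] by auto
  define c where "c = \<bar>ln (cmod \<alpha>)\<bar>"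
  have "ln (cmod \<alpha>) \<noteq> 0" using a0 \<alpha> by simp
  then have c: "c > 0" by (simp add: c_def)
  define \<sigma> :: int where "\<sigma> = (if ln (cmod \<alpha>) > 0 then 1 else - 1)"
  define u where "u x = ln (cmod (l x)) / c" for x
  define G where "G = {x. l x \<noteq> 0}"
  have cont: "continuous_on UNIV l" using l(1) by (simp add: linear_continuous_on linear_conv_bounded_linear)
  have lb[measurable]: "l \<in> borel_measurable borel" using cont by (rule borel_measurable_continuous_onI)
  \<comment> \<open>This tile contains all points with \<open>u\<close> between \<open>m + 1 - 1/m\<close> and \<open>m + 1 - 1/(m + 1)\<close>; the corresponding
    range of \<open>\<bar>l x\<bar>\<close> is an interval of length tending to infinity.\<close>
  let ?W = "{x \<in> G. \<lfloor>u x\<rfloor> = \<lfloor>1 / (1 - frac (u x))\<rfloor>}"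
  have tile: "dilation_tile M ?W"
  proof (rule dilation_tile_cocycle[OF M, of G u \<sigma> "\<lambda>f. 1 / (1 - f)"])
    have "{x. l x \<noteq> 0} = {x \<in> space borel. l x \<noteq> 0}" by simp
    also have "\<dots> \<in> sets borel" by measurable
    finally show "G \<in> sets borel" by (simp add: G_def)
    show "AE x in lebesgue. x \<in> G" using AE_functional_nonzero[OF l(1), of v] l(2) by (simp add: G_def)
    show "M *v x \<in> G \<longleftrightarrow> x \<in> G" for x by (simp add: G_def l(3) a0)
    show "u \<in> borel_measurable borel" unfolding u_def[abs_def] by measurable
    show "u (M *v x) = u x + of_int \<sigma>" if "x \<in> G" for x
      using that a0 c by (auto simp: u_def G_def l(3) norm_mult ln_mult \<sigma>_def c_def field_simps)
  qed (auto simp: \<sigma>_def)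
  obtain K where K: "K > 0" "\<And>x. cmod (l x) \<le> K * norm x" using linear_functional_bound[OF l(1)] by blast
  have "large_balls ?W"
    unfolding large_balls_def
  proof
    fix r :: real
    obtain m :: nat where m: "m \<ge> 1"
      "2 * K * \<bar>r\<bar> \<le> exp (c * (real m + 1 - 1 / (real m + 1))) - exp (c * (real m + 1 - 1 / real m))"
      using ex_large_exp_gap[OF c] by blast
    define p where "p = exp (c * (real m + 1 - 1 / real m))"
    define q where "q = exp (c * (real m + 1 - 1 / (real m + 1)))"
    have p0: "p > 0" by (simp add: p_def)
    define d where "d = K * \<bar>r\<bar>"
    have pq: "2 * d \<le> q - p" using m(2) by (simp add: p_def q_def d_def)
    \<comment> \<open>Its value under l is the midpoint of p and q. As l is Lipschitz with constant
      K, the ball of radius r keeps |l| strictly between p and q.\<close>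
    let ?x0 = "((p + q) / 2) *\<^sub>R v"
    have l0: "l ?x0 = of_real ((p + q) / 2)"
      using linear_cmul[OF l(1), of "(p + q) / 2" v] l(2) by (simp add: scaleR_conv_of_real)
    have q0: "q > 0" by (simp add: q_def)
    have "ball ?x0 r \<subseteq> ?W"
    proof
      fix x assume x: "x \<in> ball ?x0 r"
      then have "norm (x - ?x0) < \<bar>r\<bar>" by (simp add: dist_norm norm_minus_commute)
      then have "K * norm (x - ?x0) < d" using K(1) by (simp add: d_def)
      then have dist: "cmod (l x - l ?x0) < d"
        using K(2)[of "x - ?x0"] linear_diff[OF l(1), of x ?x0] by simp
      have tri: "cmod (l x) - cmod (l ?x0) \<le> cmod (l x - l ?x0)" "cmod (l ?x0) - cmod (l x) \<le> cmod (l x - l ?x0)"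
        using norm_triangle_ineq3[of "l x" "l ?x0"] by (auto simp: abs_le_iff)
      have mid: "cmod (l ?x0) = (p + q) / 2" unfolding l0 norm_of_real using p0 q0 by simp
      have "p < cmod (l x)" using dist tri(2) pq unfolding mid by argo
      moreover have "cmod (l x) < q" using dist tri(1) pq unfolding mid by argo
      ultimately have b: "p < cmod (l x)" "cmod (l x) < q" .
      then have nz: "cmod (l x) > 0" using p0 by linarith
      have "c * (real m + 1 - 1 / real m) < ln (cmod (l x))" "ln (cmod (l x)) < c * (real m + 1 - 1 / (real m + 1))"
        using b nz p0 q0 ln_less_cancel_iff[of p "cmod (l x)"] ln_less_cancel_iff[of "cmod (l x)" q]
        by (simp_all add: p_def q_def)
      then have "real m + 1 - 1 / real m < u x" "u x < real m + 1 - 1 / (real m + 1)"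
        using c by (simp_all add: u_def pos_less_divide_eq pos_divide_less_eq mult.commute)
      from floor_frac_interval[OF m(1) this] nz show "x \<in> ?W" by (simp add: G_def)
    qed
    then show "\<exists>x. ball x r \<subseteq> ?W" by blast
  qed
  with tile show ?thesis by blast
qed

text \<open>Here a single integer part already contains large balls: along the ray through v the
  functional l grows while m stays 0, so m / l is small on a ball of any fixed radius placed far
  out. Dividing m by l turns the chain relation into a translation by 1 after multiplication by
  \<alpha>.\<close>

lemma generalized_eigenfunctional_dilation_tile:
  fixes M :: "real^'n^'n"
  assumes M: "invertible M" and l: "linear l" "l v = (1::complex)" "\<And>x. l (M *v x) = \<alpha> * l x"
    and m: "linear m" "m v = (0::complex)" "\<And>x. m (M *v x) = \<alpha> * m x + l x" and \<alpha>: "cmod \<alpha> = 1"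
  shows "\<exists>W. dilation_tile M W \<and> large_balls W"
proof -
  have a0: "\<alpha> \<noteq> 0" using \<alpha> by auto
  \<comment> \<open>The shift by 1/2 puts the ray through v in the middle of the interval [0, 1),
    away from the jumps of the floor.\<close>
  define u where "u x = Re (\<alpha> * m x / l x) + 1 / 2" for x
  define G where "G = {x. l x \<noteq> 0}"
  have [measurable]: "l \<in> borel_measurable borel" "m \<in> borel_measurable borel"
    using l(1) m(1) by (auto intro!: borel_measurable_continuous_onI simp: linear_continuous_on linear_conv_bounded_linear)
  let ?W = "{x \<in> G. \<lfloor>u x\<rfloor> = \<lfloor>(\<lambda>f. 0::real) (frac (u x))\<rfloor>}"
  have tile: "dilation_tile M ?W"
  proof (rule dilation_tile_cocycle[OF M, of G u 1 "\<lambda>f. 0"])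
    have "{x. l x \<noteq> 0} = {x \<in> space borel. l x \<noteq> 0}" by simp
    also have "\<dots> \<in> sets borel" by measurable
    finally show "G \<in> sets borel" by (simp add: G_def)
    show "AE x in lebesgue. x \<in> G" using AE_functional_nonzero[OF l(1), of v] l(2) by (simp add: G_def)
    show "M *v x \<in> G \<longleftrightarrow> x \<in> G" for x by (simp add: G_def l(3) a0)
    show "u \<in> borel_measurable borel" unfolding u_def[abs_def] by measurable
    show "u (M *v x) = u x + of_int 1" if "x \<in> G" for x
    proof -
      have "\<alpha> * m (M *v x) / l (M *v x) = \<alpha> * m x / l x + 1"
        using that a0 by (simp add: G_def l(3) m(3) field_simps)
      then show ?thesis by (simp add: u_def)
    qed
  qed auto
  obtain K1 where K1: "K1 > 0" "\<And>x. cmod (l x) \<le> K1 * norm x" using linear_functional_bound[OF l(1)] by blast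
  obtain K2 where K2: "K2 > 0" "\<And>x. cmod (m x) \<le> K2 * norm x" using linear_functional_bound[OF m(1)] by blast
  have "large_balls ?W"
    unfolding large_balls_def
  proof
    fix r :: real
    \<comment> \<open>On the ball |l| is at least t - K1|r|, which exceeds 2 K2|r| and so 2|m|; this
      keeps |m / l| below 1/2.\<close>
    define t where "t = K1 * \<bar>r\<bar> + 2 * K2 * \<bar>r\<bar> + 1"
    have "K1 * \<bar>r\<bar> \<ge> 0" "K2 * \<bar>r\<bar> \<ge> 0" using K1(1) K2(1) by auto
    have l0: "l (t *\<^sub>R v) = of_real t" "m (t *\<^sub>R v) = 0"
      using linear_cmul[OF l(1), of t v] linear_cmul[OF m(1), of t v] l(2) m(2) by (simp_all add: scaleR_conv_of_real)
    have "ball (t *\<^sub>R v) r \<subseteq> ?W"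
    proof
      fix x assume "x \<in> ball (t *\<^sub>R v) r"
      then have n: "norm (x - t *\<^sub>R v) \<le> \<bar>r\<bar>" by (simp add: dist_norm norm_minus_commute)
      have "cmod (l x - of_real t) \<le> K1 * \<bar>r\<bar>"
      proof -
        have "l (x - t *\<^sub>R v) = l x - of_real t" using linear_diff[OF l(1), of x "t *\<^sub>R v"] l0 by simp
        then have "cmod (l x - of_real t) \<le> K1 * norm (x - t *\<^sub>R v)" using K1(2)[of "x - t *\<^sub>R v"] by simp
        also have "\<dots> \<le> K1 * \<bar>r\<bar>" using n K1(1) by (intro mult_left_mono) auto
        finally show ?thesis .
      qed
      moreover have "cmod (of_real t) - cmod (l x) \<le> cmod (l x - of_real t)"
        by (metis norm_minus_commute norm_triangle_ineq2)
      moreover have "cmod (of_real t) \<ge> t" by simp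
      ultimately have lx: "cmod (l x) > 2 * (K2 * \<bar>r\<bar>)" unfolding t_def by linarith
      have mx: "cmod (m x) \<le> K2 * \<bar>r\<bar>"
      proof -
        have "m (x - t *\<^sub>R v) = m x" using linear_diff[OF m(1), of x "t *\<^sub>R v"] l0 by simp
        then have "cmod (m x) \<le> K2 * norm (x - t *\<^sub>R v)" using K2(2)[of "x - t *\<^sub>R v"] by simp
        also have "\<dots> \<le> K2 * \<bar>r\<bar>" using n K2(1) by (intro mult_left_mono) auto
        finally show ?thesis .
      qed
      have nz: "l x \<noteq> 0" using lx \<open>K2 * \<bar>r\<bar> \<ge> 0\<close> by auto
      have "\<bar>Re (\<alpha> * m x / l x)\<bar> \<le> cmod (\<alpha> * m x / l x)" by (rule abs_Re_le_cmod)
      also have "\<dots> = cmod (m x) / cmod (l x)" by (simp add: norm_mult norm_divide \<alpha>)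
      also have "\<dots> < 1 / 2" using lx mx nz by (simp add: field_simps)
      finally have "0 < u x" "u x < 1" unfolding u_def by linarith+
      then have "\<lfloor>u x\<rfloor> = 0" by linarith
      with nz show "x \<in> ?W" by (simp add: G_def)
    qed
    then show "\<exists>x. ball x r \<subseteq> ?W" by blast
  qed
  with tile show ?thesis by blast
qed

theorem non_orthogonal_jordan_dilation_tile:
  fixes J :: "real^'n^'n"
  assumes "real_jordan_matrix J" "\<not> orthogonal_matrix J" "invertible J"
  shows "\<exists>W. dilation_tile (transpose J) W \<and> large_balls W"
proof -
  obtain e Bs where J: "jordan_layout J e Bs"
    using assms(1) by (auto simp: real_jordan_matrix_def jordan_layout_def)
  obtain B where B: "B \<in> set Bs" "\<not> rotation_cell B"
    using rotation_cells_orthogonal[OF J] assms(2) by blast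
  have T: "invertible (transpose J)" by (rule transpose_invertible[OF assms(3)])
  from non_rotation_eigenfunctional[OF J B] show ?thesis
    using eigenfunctional_dilation_tile[OF T] generalized_eigenfunctional_dilation_tile[OF T] by metis
qed

subsection \<open>Matrices with bounded powers\<close>

lemma orthonormal_bessel_system:
  fixes g :: "'i \<Rightarrow> real^'n \<Rightarrow> complex"
  assumes on: "L2_orthonormal I g" and S: "S \<subseteq> I"
  shows "L2_bessel_system S g"
  unfolding L2_bessel_system_def
proof (intro conjI exI[of _ 1] ballI)
  show "g p \<in> L2_space" if "p \<in> S" for p using on S that by (auto simp: L2_orthonormal_def)
  fix f :: "real^'n \<Rightarrow> complex" assume f: "f \<in> L2_space"
  let ?c = "\<lambda>p. (cmod (L2_inner f (g p)))\<^sup>2"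
  have le: "sum ?c F \<le> (L2_norm f)\<^sup>2" if "finite F" "F \<subseteq> S" for F
    by (rule L2_bessel_finite[OF on that(1) _ f]) (use that S in blast)
  show s: "?c summable_on S"
    by (rule nonneg_bdd_above_summable_on) (use le in \<open>auto intro!: bdd_aboveI2\<close>)
  show "infsum ?c S \<le> 1 * (L2_norm f)\<^sup>2"
    using infsum_le_finite_sums[OF s le] by simp
qed

lemma orthonormal_wavelet_bessel:
  fixes A :: "real^'n^'n"
  assumes A: "invertible A" and \<psi>: "orthonormal_wavelet A integer_lattice \<infinity> \<psi>"
  shows "bessel_wavelet A integer_lattice 1 \<psi> \<and> \<not> (AE x in lebesgue. \<psi> 0 x = 0)"
proof
  have on: "L2_orthonormal (wavelet_index integer_lattice \<infinity>) (wavelet_system A \<psi>)"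
    using \<psi> by (simp add: orthonormal_wavelet_def L2_orthonormal_basis_iff)
  have "wavelet_index integer_lattice 1 \<subseteq> wavelet_index integer_lattice \<infinity>"
    by (auto simp: wavelet_index_def)
  from orthonormal_bessel_system[OF on this]
  show "bessel_wavelet A integer_lattice 1 \<psi>"
    using \<psi> by (simp add: bessel_wavelet_def orthonormal_wavelet_def)
  have "(0, 0 :: real^'n, 0) \<in> wavelet_index integer_lattice \<infinity>"
    by (simp add: wavelet_index_def integer_lattice_zero)
  then have "L2_inner (wavelet_system A \<psi> (0, 0, 0)) (wavelet_system A \<psi> (0, 0, 0)) = 1"
    using on by (simp add: L2_orthonormal_def)
  moreover have "wavelet_system A \<psi> (0, 0, 0) = \<psi> 0"
    using A by (simp add: wavelet_system_def invertible_det_nz fun_eq_iff)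
  ultimately have one: "L2_inner (\<psi> 0) (\<psi> 0) = 1" by simp
  show "\<not> (AE x in lebesgue. \<psi> 0 x = 0)"
  proof
    assume ae: "AE x in lebesgue. \<psi> 0 x = 0"
    have "L2_inner (\<psi> 0) (\<psi> 0) = 0"
      by (rule L2_inner_disjoint) (use ae in \<open>rule eventually_mono, simp\<close>)
    with one show False by simp
  qed
qed

section \<open>Unitary similarity and bounds on all powers\<close>

lemma map_matrix_mult_hom:
  fixes A :: "'a::semiring_1^'m^'n" and B :: "'a^'k^'m" and f :: "'a \<Rightarrow> 'b::semiring_1"
  assumes "\<And>x y. f (x + y) = f x + f y" "\<And>x y. f (x * y) = f x * f y" "f 0 = 0"
  shows "map_matrix f (A ** B) = map_matrix f A ** map_matrix f B"
proof -
  have "f (\<Sum>k\<in>S. g k) = (\<Sum>k\<in>S. f (g k))" for S :: "'m set" and g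
    by (induction S rule: infinite_finite_induct) (auto simp: assms)
  then show ?thesis
    by (simp add: vec_eq_iff matrix_matrix_mult_def assms)
qed

lemma map_matrix_of_real_mult:
  "map_matrix complex_of_real (A ** B) = map_matrix complex_of_real A ** map_matrix complex_of_real B"
  by (rule map_matrix_mult_hom) auto

lemma map_matrix_of_real_1: "map_matrix complex_of_real (mat 1) = mat 1"
  by (simp add: vec_eq_iff mat_def)

lemma matrix_inv_map_of_real:
  fixes P :: "real^'n^'n"
  assumes "invertible P"
  shows "invertible (map_matrix complex_of_real P)"
    and "matrix_inv (map_matrix complex_of_real P) = map_matrix complex_of_real (matrix_inv P)"
proof -
  have *: "map_matrix complex_of_real P ** map_matrix complex_of_real (matrix_inv P) = mat 1"
    "map_matrix complex_of_real (matrix_inv P) ** map_matrix complex_of_real P = mat 1"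
    by (simp_all add: map_matrix_of_real_mult[symmetric] matrix_inv_inverse[OF assms] map_matrix_of_real_1)
  then show "invertible (map_matrix complex_of_real P)" unfolding invertible_def by blast
  show "matrix_inv (map_matrix complex_of_real P) = map_matrix complex_of_real (matrix_inv P)"
    using *(1) by (rule matrix_inv_eqI)
qed

lemma orthogonal_similar_unitary:
  fixes A J :: "real^'n^'n"
  assumes J: "orthogonal_matrix J" and s: "similar_matrix A J"
  shows "\<exists>U. unitary_matrix U \<and> similar_matrix (map_matrix complex_of_real A) U"
proof (intro exI conjI)
  let ?c = "map_matrix complex_of_real :: real^'n^'n \<Rightarrow> complex^'n^'n"
  have "map_matrix cnj (?c J) = ?c J" "transpose (?c J) = ?c (transpose J)"
    by (simp_all add: vec_eq_iff transpose_def)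
  then show "unitary_matrix (?c J)"
    using J by (simp add: unitary_matrix_def orthogonal_matrix_def map_matrix_of_real_mult[symmetric] map_matrix_of_real_1)
  obtain P where P: "invertible P" "A = P ** J ** matrix_inv P" using s by (auto simp: similar_matrix_def)
  show "similar_matrix (?c A) (?c J)"
    unfolding similar_matrix_def
  proof (intro exI conjI)
    show "invertible (?c P)" by (rule matrix_inv_map_of_real(1)[OF P(1)])
    show "?c A = ?c P ** ?c J ** matrix_inv (?c P)"
      by (simp add: P(2) map_matrix_of_real_mult matrix_inv_map_of_real(2)[OF P(1)])
  qed
qed

lemma unitary_matrix_mult:
  assumes U: "unitary_matrix U" and V: "unitary_matrix V"
  shows "unitary_matrix (U ** V)"
proof -
  let ?a = "\<lambda>U. transpose (map_matrix cnj U)"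
  have a: "?a (U ** V) = ?a V ** ?a U"
    by (simp add: map_matrix_mult_hom matrix_transpose_mul)
  have "?a V ** ?a U ** (U ** V) = ?a V ** (?a U ** U) ** V" "U ** V ** (?a V ** ?a U) = U ** (V ** ?a V) ** ?a U"
    by (simp_all add: matrix_mul_assoc)
  then show ?thesis using U V by (simp add: unitary_matrix_def a)
qed

lemma unitary_matrix_adjoint:
  assumes U: "unitary_matrix U"
  shows "unitary_matrix (transpose (map_matrix cnj U))"
proof -
  have "transpose (map_matrix cnj (transpose (map_matrix cnj U))) = U"
    by (simp add: vec_eq_iff transpose_def)
  with U show ?thesis by (simp add: unitary_matrix_def)
qed

lemma unitary_matrix_entry_le:
  fixes U :: "complex^'n^'n"
  assumes U: "unitary_matrix U"
  shows "cmod (U $ i $ j) \<le> 1"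
proof -
  have "(transpose (map_matrix cnj U) ** U) $ j $ j = 1"
    using U by (simp add: unitary_matrix_def mat_def)
  then have "(\<Sum>k\<in>UNIV. cnj (U $ k $ j) * U $ k $ j) = 1"
    by (simp add: matrix_matrix_mult_def transpose_def)
  moreover have "cnj (U $ k $ j) * U $ k $ j = of_real ((cmod (U $ k $ j))\<^sup>2)" for k
    by (simp only: complex_norm_square mult.commute)
  ultimately have "complex_of_real (\<Sum>k\<in>UNIV. (cmod (U $ k $ j))\<^sup>2) = of_real 1" by simp
  then have s: "(\<Sum>k\<in>UNIV. (cmod (U $ k $ j))\<^sup>2) = 1" by (simp only: of_real_eq_iff)
  have "(cmod (U $ i $ j))\<^sup>2 \<le> (\<Sum>k\<in>UNIV. (cmod (U $ k $ j))\<^sup>2)"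
    by (rule member_le_sum) auto
  then show ?thesis using s by (simp add: power_le_one_iff abs_le_square_iff[symmetric, of _ 1, simplified] del: abs_le_square_iff)
qed

lemma unitary_powers:
  fixes A :: "real^'n^'n" and U Q :: "complex^'n^'n"
  assumes A: "invertible A" and U: "unitary_matrix U" and Q: "invertible Q"
    and AU: "map_matrix complex_of_real A = Q ** U ** matrix_inv Q"
  shows "\<exists>V. unitary_matrix V \<and> map_matrix complex_of_real (matrix_powi A j) = Q ** V ** matrix_inv Q"
proof -
  let ?c = "map_matrix complex_of_real :: real^'n^'n \<Rightarrow> complex^'n^'n"
  let ?U = "transpose (map_matrix cnj U)"
  have mid: "(Q ** X ** matrix_inv Q) ** (Q ** Y ** matrix_inv Q) = Q ** (X ** Y) ** matrix_inv Q" for X Y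
  proof -
    have "(Q ** X ** matrix_inv Q) ** (Q ** Y ** matrix_inv Q) = Q ** X ** (matrix_inv Q ** Q) ** Y ** matrix_inv Q"
      by (simp only: matrix_mul_assoc)
    then show ?thesis by (simp add: matrix_inv_inverse[OF Q] matrix_mul_assoc)
  qed
  have inv: "?c (matrix_inv A) = Q ** ?U ** matrix_inv Q"
    unfolding matrix_inv_map_of_real(2)[OF A, symmetric]
    by (rule matrix_inv_eqI) (use U in \<open>simp add: AU mid unitary_matrix_def matrix_inv_inverse[OF Q]\<close>)
  show ?thesis
  proof (induction j rule: int_induct[of _ 0])
    case base
    have "unitary_matrix (mat 1 :: complex^'n^'n)"
    proof -
      have "transpose (map_matrix cnj (mat 1 :: complex^'n^'n)) = mat 1"
        by (simp add: vec_eq_iff transpose_def mat_def)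
      then show ?thesis by (simp add: unitary_matrix_def)
    qed
    then show ?case
      by (intro exI[of _ "mat 1"]) (simp add: map_matrix_of_real_1 matrix_inv_inverse[OF Q])
  next
    case (step1 i)
    then obtain V where V: "unitary_matrix V" "?c (matrix_powi A i) = Q ** V ** matrix_inv Q" by blast
    then show ?case
      by (intro exI[of _ "U ** V"])
         (simp add: matrix_powi_step[OF A] map_matrix_of_real_mult AU mid unitary_matrix_mult U)
  next
    case (step2 i)
    then obtain V where V: "unitary_matrix V" "?c (matrix_powi A i) = Q ** V ** matrix_inv Q" by blast
    then show ?case
      by (intro exI[of _ "?U ** V"])
         (simp add: matrix_powi_step_minus[OF A] map_matrix_of_real_mult inv mid unitary_matrix_mult unitary_matrix_adjoint[OF U])
  qed
qed

text \<open>Powers of a unitary matrix have entries of modulus at most 1, so the bound depends on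
  the conjugating matrix alone. It covers negative powers too, which keeps limits of powers
  invertible.\<close>

lemma similar_unitary_powers_bounded:
  fixes A :: "real^'n^'n"
  assumes A: "invertible A" and U: "unitary_matrix U" and s: "similar_matrix (map_matrix complex_of_real A) U"
  shows "\<exists>C. \<forall>j a b. \<bar>matrix_powi A j $ a $ b\<bar> \<le> C"
proof -
  obtain Q where Q: "invertible Q" "map_matrix complex_of_real A = Q ** U ** matrix_inv Q"
    using s by (auto simp: similar_matrix_def)
  define R where "R = matrix_inv Q"
  define C where "C = (\<Sum>a\<in>UNIV. \<Sum>c\<in>UNIV. cmod (Q $ a $ c)) * (\<Sum>b\<in>UNIV. \<Sum>d\<in>UNIV. cmod (R $ d $ b))"
  show ?thesis
  proof (intro exI allI)
    fix j a b
    obtain V where V: "unitary_matrix V" "map_matrix complex_of_real (matrix_powi A j) = Q ** V ** R"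
      using unitary_powers[OF A U Q, of j] by (auto simp: R_def)
    have "\<bar>matrix_powi A j $ a $ b\<bar> = cmod (map_matrix complex_of_real (matrix_powi A j) $ a $ b)" by simp
    also have "\<dots> = cmod (\<Sum>d\<in>UNIV. (\<Sum>c\<in>UNIV. Q $ a $ c * V $ c $ d) * R $ d $ b)"
      by (simp only: V(2) matrix_matrix_mult_def vec_lambda_beta)
    also have "\<dots> \<le> (\<Sum>d\<in>UNIV. (\<Sum>c\<in>UNIV. cmod (Q $ a $ c)) * cmod (R $ d $ b))"
    proof (rule order_trans[OF norm_sum], rule sum_mono)
      fix d
      have "cmod (\<Sum>c\<in>UNIV. Q $ a $ c * V $ c $ d) \<le> (\<Sum>c\<in>UNIV. cmod (Q $ a $ c))"
      proof (rule order_trans[OF norm_sum], rule sum_mono)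
        fix c show "cmod (Q $ a $ c * V $ c $ d) \<le> cmod (Q $ a $ c)"
          using mult_left_mono[OF unitary_matrix_entry_le[OF V(1), of c d], of "cmod (Q $ a $ c)"]
          by (simp add: norm_mult)
      qed
      then show "cmod ((\<Sum>c\<in>UNIV. Q $ a $ c * V $ c $ d) * R $ d $ b) \<le> (\<Sum>c\<in>UNIV. cmod (Q $ a $ c)) * cmod (R $ d $ b)"
        unfolding norm_mult by (rule mult_right_mono) simp
    qed
    also have "\<dots> = (\<Sum>c\<in>UNIV. cmod (Q $ a $ c)) * (\<Sum>d\<in>UNIV. cmod (R $ d $ b))"
      by (simp add: sum_distrib_left)
    also have "\<dots> \<le> C"
      unfolding C_def
    proof (rule mult_mono)
      show "(\<Sum>c\<in>UNIV. cmod (Q $ a $ c)) \<le> (\<Sum>a\<in>UNIV. \<Sum>c\<in>UNIV. cmod (Q $ a $ c))"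
        by (rule member_le_sum[of a UNIV "\<lambda>a. \<Sum>c\<in>UNIV. cmod (Q $ a $ c)"]) (auto intro: sum_nonneg)
      show "(\<Sum>d\<in>UNIV. cmod (R $ d $ b)) \<le> (\<Sum>b\<in>UNIV. \<Sum>d\<in>UNIV. cmod (R $ d $ b))"
        by (rule member_le_sum[of b UNIV "\<lambda>b. \<Sum>d\<in>UNIV. cmod (R $ d $ b)"]) (auto intro: sum_nonneg)
    qed (auto intro!: sum_nonneg)
    finally show "\<bar>matrix_powi A j $ a $ b\<bar> \<le> C" .
  qed
qed

section \<open>Limits of powers and vanishing of Bessel wavelets\<close>

lemma tendsto_matrix_mult:
  fixes X :: "'b \<Rightarrow> real^'m^'n" and Y :: "'b \<Rightarrow> real^'k^'m"
  assumes "(X \<longlongrightarrow> a) F" "(Y \<longlongrightarrow> b) F"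
  shows "((\<lambda>m. X m ** Y m) \<longlongrightarrow> a ** b) F"
  unfolding matrix_matrix_mult_def
  by (intro tendsto_vec_lambda tendsto_sum tendsto_mult tendsto_vec_nth assms)

lemma tendsto_matrix_vector_mult:
  fixes X :: "'b \<Rightarrow> real^'m^'n"
  assumes "(X \<longlongrightarrow> a) F"
  shows "((\<lambda>m. X m *v y) \<longlongrightarrow> a *v y) F"
  unfolding matrix_vector_mult_def
  by (intro tendsto_vec_lambda tendsto_sum tendsto_mult tendsto_vec_nth tendsto_const assms)

lemma tendsto_det:
  fixes X :: "'b \<Rightarrow> real^'n^'n"
  assumes "(X \<longlongrightarrow> a) F"
  shows "((\<lambda>m. det (X m)) \<longlongrightarrow> det a) F"
  unfolding det_def
  by (intro tendsto_sum tendsto_mult tendsto_prod tendsto_vec_nth tendsto_const assms)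

lemma matrix_vector_bound:
  fixes X :: "real^'n^'n"
  assumes "\<And>a b. \<bar>X $ a $ b\<bar> \<le> C"
  shows "norm (X *v y) \<le> real CARD('n) * (real CARD('n) * C) * norm y"
proof -
  have C: "C \<ge> 0" using assms[of undefined undefined] by linarith
  have "norm (X *v y) \<le> (\<Sum>i\<in>UNIV. \<bar>(X *v y) $ i\<bar>)" by (rule norm_le_l1_cart)
  also have "\<dots> \<le> (\<Sum>i\<in>(UNIV :: 'n set). real CARD('n) * C * norm y)"
  proof (rule sum_mono)
    fix i
    have "\<bar>(X *v y) $ i\<bar> \<le> (\<Sum>j\<in>UNIV. \<bar>X $ i $ j * y $ j\<bar>)"
      unfolding matrix_vector_mult_def vec_lambda_beta by (rule sum_abs)
    also have "\<dots> \<le> (\<Sum>j\<in>(UNIV :: 'n set). C * norm y)"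
      by (rule sum_mono) (unfold abs_mult, intro mult_mono assms component_le_norm_cart C abs_ge_zero)
    finally show "\<bar>(X *v y) $ i\<bar> \<le> real CARD('n) * C * norm y" by simp
  qed
  finally show ?thesis by (simp add: mult.assoc)
qed

text \<open>Compactness is applied to the pairs of a power and its inverse, so that one subsequence
  serves both and the two limits are inverse to each other.\<close>

lemma bounded_powers_limit:
  fixes A :: "real^'n^'n"
  assumes A: "invertible A" and C: "\<And>j a b. \<bar>matrix_powi A j $ a $ b\<bar> \<le> C"
  obtains r :: "nat \<Rightarrow> nat" and L L' :: "real^'n^'n"
  where "strict_mono r" "L ** L' = mat 1"
    "(\<lambda>m. matrix_powi A (- int (r m))) \<longlonglongrightarrow> L'"
proof -
  let ?f = "\<lambda>m::nat. (matrix_powi A (int m), matrix_powi A (- int m))"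
  have nb: "norm (matrix_powi A j) \<le> real CARD('n) * (real CARD('n) * C)" for j
  proof -
    have "norm (matrix_powi A j) \<le> (\<Sum>i\<in>UNIV. norm (matrix_powi A j $ i))"
      unfolding norm_vec_def by (rule L2_set_le_sum) simp
    also have "\<dots> \<le> (\<Sum>i\<in>(UNIV::'n set). real CARD('n) * C)"
    proof (rule sum_mono)
      fix i
      have "norm (matrix_powi A j $ i) \<le> (\<Sum>k\<in>UNIV. \<bar>matrix_powi A j $ i $ k\<bar>)" by (rule norm_le_l1_cart)
      also have "\<dots> \<le> (\<Sum>k\<in>(UNIV::'n set). C)" by (rule sum_mono) (rule C)
      finally show "norm (matrix_powi A j $ i) \<le> real CARD('n) * C" by simp
    qed
    finally show ?thesis by simp
  qed
  let ?B = "real CARD('n) * (real CARD('n) * C)"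
  have "bounded (range ?f)"
  proof (rule bounded_subset)
    show "bounded (cball (0 :: real^'n^'n) ?B \<times> cball (0 :: real^'n^'n) ?B)"
      by (intro bounded_Times bounded_cball)
    show "range ?f \<subseteq> cball 0 ?B \<times> cball 0 ?B" using nb by auto
  qed
  then obtain p and r :: "nat \<Rightarrow> nat" where r: "strict_mono r" "(?f \<circ> r) \<longlonglongrightarrow> p"
    using bounded_imp_convergent_subsequence by blast
  obtain L L' where p: "p = (L, L')" by (cases p)
  have L: "(\<lambda>m. matrix_powi A (int (r m))) \<longlonglongrightarrow> L" and L': "(\<lambda>m. matrix_powi A (- int (r m))) \<longlonglongrightarrow> L'"
    using tendsto_fst[OF r(2)] tendsto_snd[OF r(2)] by (simp_all add: p o_def)
  have "matrix_powi A (int (r m)) ** matrix_powi A (- int (r m)) = mat 1" for m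
    by (simp add: matrix_powi_add[OF A, symmetric])
  with tendsto_matrix_mult[OF L L'] have "L ** L' = mat 1"
    by (simp add: LIMSEQ_const_iff)
  from that[OF r(1) this L'] show thesis .
qed

text \<open>The test functions are waves on a translated cube, for which Parseval is available.
  Their discontinuities lie on the boundary of the cube, a null set, so pointwise convergence under
  the integral still holds almost everywhere.\<close>

lemma tile_wave_continuous_at:
  fixes k a y :: "real^'n"
  defines "K \<equiv> {x. x - a \<in> unit_cube}"
  assumes y: "y - a \<notin> cbox 0 1 - box 0 1" and z: "z \<longlonglongrightarrow> y"
  shows "(\<lambda>m::nat. tile_wave K k (z m)) \<longlonglongrightarrow> tile_wave K k y"
proof -
  have za: "(\<lambda>m. z m - a) \<longlonglongrightarrow> y - a" by (intro tendsto_intros z)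
  have box: "box 0 1 \<subseteq> (unit_cube :: (real^'n) set)"
    by (auto simp: unit_cube_def mem_box_cart less_imp_le)
  have wave: "(\<lambda>m. wave k (z m)) \<longlonglongrightarrow> wave k y"
    by (rule continuous_on_tendsto_compose[OF continuous_on_wave[of UNIV] z]) auto
  show ?thesis
  proof (cases "y - a \<in> box 0 1")
    case True
    then have "eventually (\<lambda>m. z m - a \<in> box 0 1) sequentially"
      by (rule topological_tendstoD[OF za open_box])
    then have "eventually (\<lambda>m. wave k (z m) = tile_wave K k (z m)) sequentially"
      by eventually_elim (use box in \<open>auto simp: tile_wave_def K_def\<close>)
    with wave have "(\<lambda>m. tile_wave K k (z m)) \<longlonglongrightarrow> wave k y" by (rule Lim_transform_eventually)
    moreover have "tile_wave K k y = wave k y" using True box by (auto simp: tile_wave_def K_def)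
    ultimately show ?thesis by simp
  next
    case False
    with y have "y - a \<in> - cbox 0 1" by blast
    then have "eventually (\<lambda>m. z m - a \<in> - cbox 0 1) sequentially"
      by (intro topological_tendstoD[OF za]) auto
    then have "eventually (\<lambda>m. tile_wave K k (z m) = tile_wave K k y) sequentially"
      by eventually_elim (use \<open>y - a \<in> - cbox 0 1\<close> unit_cube_subset_cbox in \<open>auto simp: tile_wave_def K_def indicator_def\<close>)
    then show ?thesis by (rule tendsto_eventually)
  qed
qed

lemma bounded_powers_no_bessel_wavelet:
  fixes A :: "real^'n^'n"
  assumes A: "invertible A" and C: "\<And>j a b. \<bar>matrix_powi A j $ a $ b\<bar> \<le> C"
    and \<psi>: "bessel_wavelet A integer_lattice 1 \<psi>"
  shows "AE x in lebesgue. \<psi> 0 x = 0"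
proof -
  obtain r :: "nat \<Rightarrow> nat" and L L' :: "real^'n^'n" where r: "strict_mono r" and LL: "L ** L' = mat 1"
    and lim: "(\<lambda>m. matrix_powi A (- int (r m))) \<longlonglongrightarrow> L'"
    by (rule bounded_powers_limit[OF A C])
  have L'L: "L' ** L = mat 1" using LL by (simp add: matrix_left_right_inverse)
  have L: "invertible L" using LL L'L unfolding invertible_def by blast
  let ?b = "\<lambda>m. matrix_powi A (- int (r m))"
  let ?p = "\<psi> 0"
  have pL: "?p \<in> L2_space" using \<psi> by (simp add: bessel_wavelet_def one_enat_def)
  note [measurable] = L2_spaceD[OF pL]
  have orth: "L2_inner (tile_wave {x. x - a \<in> unit_cube} k) ?p = 0" for a k
  proof -
    let ?K = "{x. x - a \<in> unit_cube}"
    let ?\<phi> = "tile_wave ?K k"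
    have K: "lattice_tile ?K" by (rule lattice_tile_translate[OF lattice_tile_unit_cube])
    have \<phi>L: "?\<phi> \<in> L2_space" by (rule tile_wave_L2[OF K])
    \<comment> \<open>Composition with L undoes the limit: after the substitution in
      \<open>inner\<close> the argument becomes L A^(-r) y, which tends to y. The Jacobian and the
      normalization of the wavelet combine to the square root of |det A^(-r)|.\<close>
    define f where "f x = ?\<phi> (L *v x)" for x
    have fL: "f \<in> L2_space" unfolding f_def[abs_def] by (rule L2_matrix[OF L \<phi>L])
    define I where "I m = (LINT y|lebesgue. ?\<phi> (L *v (?b m *v y)) * cnj (?p y))" for m
    let ?g = "\<lambda>m. wavelet_system A \<psi> (int (r m), 0, 0)"
    have gL: "?g m \<in> L2_space" for m
      using \<psi> by (simp add: bessel_wavelet_def L2_bessel_system_def wavelet_index_def integer_lattice_zero one_enat_def)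
    have inner: "L2_inner f (?g m) = of_real (sqrt \<bar>det (?b m)\<bar>) * I m" for m
    proof -
      let ?c = "\<bar>det A\<bar> powr (real_of_int (int (r m)) / 2)"
      have N: "invertible (?b m)" by (rule matrix_powi_invertible[OF A])
      have "L2_inner f (?g m) = of_real \<bar>det (?b m)\<bar> * (LINT y|lebesgue. f (?b m *v y) * cnj (?g m (?b m *v y)))"
        unfolding L2_inner_def
        by (rule integral_matrix[OF N borel_measurable_integrable[OF integrable_L2_mult[OF fL gL]]])
      also have "(\<lambda>y. f (?b m *v y) * cnj (?g m (?b m *v y))) = (\<lambda>y. of_real ?c * (?\<phi> (L *v (?b m *v y)) * cnj (?p y)))"
        by (auto simp: f_def wavelet_system_def matrix_powi_vector_add[OF A])
      also have "(LINT y|lebesgue. of_real ?c * (?\<phi> (L *v (?b m *v y)) * cnj (?p y))) = of_real ?c * I m"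
        unfolding I_def by (rule Bochner_Integration.integral_mult_right_zero)
      also have "of_real \<bar>det (?b m)\<bar> * (of_real ?c * I m) = of_real (\<bar>det (?b m)\<bar> * ?c) * I m"
        by simp
      also have "\<bar>det (?b m)\<bar> * ?c = sqrt \<bar>det (?b m)\<bar>"
      proof -
        have "\<bar>det (?b m)\<bar> = \<bar>det A\<bar> powr (- real (r m))"
          by (simp add: abs_det_matrix_powi[OF A])
        moreover have "sqrt (\<bar>det A\<bar> powr (- real (r m))) = \<bar>det A\<bar> powr (- real (r m) / 2)"
          by (simp add: powr_half_sqrt[symmetric] powr_powr)
        moreover have "\<bar>det A\<bar> powr (- real (r m)) * ?c = \<bar>det A\<bar> powr (- real (r m) / 2)"
          by (simp add: powr_add[symmetric])
        ultimately show ?thesis by simp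
      qed
      finally show ?thesis .
    qed
    \<comment> \<open>The indices with translation 0 and scales r m are distinct, since r is
      strictly increasing; these terms belong to one convergent Bessel sum and so tend to 0.\<close>
    have "(\<lambda>m. (cmod (L2_inner f (?g m)))\<^sup>2) \<longlonglongrightarrow> 0"
    proof -
      let ?h = "\<lambda>m::nat. (int (r m), 0 :: real^'n, 0 :: nat)"
      let ?F = "\<lambda>p. (cmod (L2_inner f (wavelet_system A \<psi> p)))\<^sup>2"
      have "?F summable_on wavelet_index integer_lattice 1"
        using \<psi> fL by (auto simp: bessel_wavelet_def L2_bessel_system_def)
      then have "?F summable_on range ?h"
        by (rule summable_on_subset_banach) (auto simp: wavelet_index_def integer_lattice_zero one_enat_def)
      moreover have "inj ?h" using strict_mono_imp_inj_on[OF r] by (auto simp: inj_on_def)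
      ultimately have "(?F \<circ> ?h) summable_on UNIV" by (simp only: summable_on_reindex)
      then have "summable (?F \<circ> ?h)" by (subst (asm) summable_on_UNIV_nonneg_real_iff) auto
      from summable_LIMSEQ_zero[OF this] show ?thesis by (simp add: o_def)
    qed
    then have "(\<lambda>m. sqrt ((cmod (L2_inner f (?g m)))\<^sup>2)) \<longlonglongrightarrow> sqrt 0" by (rule tendsto_real_sqrt)
    then have lim0: "(\<lambda>m. L2_inner f (?g m)) \<longlonglongrightarrow> 0" by (simp add: tendsto_norm_zero_iff)
    have "(\<lambda>m. of_real (sqrt \<bar>det (?b m)\<bar>) * I m) \<longlonglongrightarrow> of_real (sqrt \<bar>det L'\<bar>) * (LINT y|lebesgue. ?\<phi> y * cnj (?p y))"
    proof (intro tendsto_mult tendsto_of_real tendsto_real_sqrt tendsto_rabs tendsto_det lim)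
      show "I \<longlonglongrightarrow> (LINT y|lebesgue. ?\<phi> y * cnj (?p y))"
      proof -
        have "bounded ?K"
        proof -
          have "?K \<subseteq> (\<lambda>x. a + x) ` cbox 0 1"
            using unit_cube_subset_cbox by (force simp: image_iff)
          then show ?thesis by (rule bounded_subset[OF bounded_translation[OF bounded_cbox]])
        qed
        then obtain R where R: "\<And>z. z \<in> ?K \<Longrightarrow> norm z \<le> R" by (auto simp: bounded_iff)
        obtain c where c: "c > 0" "\<And>x. norm (L' *v x) \<le> c * norm x"
          using linear_bounded_pos[OF matrix_vector_mul_linear[of L']] by (metis mult.commute)
        define D where "D = real CARD('n) * (real CARD('n) * C)"
        have D: "norm (matrix_powi A j *v x) \<le> D * norm x" for j x
          unfolding D_def by (rule matrix_vector_bound[OF C])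
        have "C \<ge> 0" using C[of 0 undefined undefined] by linarith
        then have D0: "D \<ge> 0" by (simp add: D_def)
        let ?S = "cball 0 (D * (c * R)) :: (real^'n) set"
        \<comment> \<open>A nonzero value forces z = L A^(-r) y into the bounded cube, and y = A^r
          L' z. The uniform bound on powers confines all such y to one ball, on which the
          square-integrable generator is integrable.\<close>
        have dom: "cmod (?\<phi> (L *v (?b m *v y)) * cnj (?p y)) \<le> cmod (?p y * indicator ?S y)" for m y
        proof (cases "L *v (?b m *v y) \<in> ?K")
          case True
          let ?z = "L *v (?b m *v y)"
          have "L' *v ?z = ?b m *v y" by (simp add: matrix_vector_mul_assoc matrix_mul_assoc L'L)
          then have "matrix_powi A (int (r m)) *v (L' *v ?z) = y"
            by (simp add: matrix_powi_vector_add[OF A])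
          then have "norm y \<le> D * norm (L' *v ?z)" using D[of "int (r m)" "L' *v ?z"] by simp
          also have "\<dots> \<le> D * (c * norm ?z)" by (intro mult_left_mono c D0)
          also have "\<dots> \<le> D * (c * R)" using R[OF True] c(1) D0 by (intro mult_left_mono) auto
          finally have "y \<in> ?S" by simp
          then show ?thesis by (simp add: norm_mult tile_wave_def indicator_def)
        next
          case False
          then show ?thesis by (simp add: tile_wave_def)
        qed
        have S: "?S \<in> lmeasurable" by simp
        show ?thesis
          unfolding I_def[abs_def]
        proof (rule integral_dominated_convergence[where w="\<lambda>y. cmod (?p y * indicator ?S y)"])
        show "integrable lebesgue (\<lambda>y. cmod (?p y * indicator ?S y))"
          by (rule integrable_norm[OF L12_integrable[OF L2_finite_measure_L12[OF pL S]]])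
        show "AE y in lebesgue. norm (?\<phi> (L *v (?b m *v y)) * cnj (?p y)) \<le> cmod (?p y * indicator ?S y)" for m
          using dom by simp
        have "negligible ((\<lambda>x. a + x) ` (cbox 0 1 - box 0 (1::real^'n)))"
          by (rule negligible_translation) (rule negligible_frontier_interval)
        then have "(\<lambda>x. a + x) ` (cbox 0 1 - box 0 (1::real^'n)) \<in> null_sets lebesgue"
          by (simp add: negligible_iff_null_sets)
        from AE_not_in[OF this]
        show "AE y in lebesgue. (\<lambda>m. ?\<phi> (L *v (?b m *v y)) * cnj (?p y)) \<longlonglongrightarrow> ?\<phi> y * cnj (?p y)"
        proof eventually_elim
          case (elim y)
          have ya: "y - a \<notin> cbox 0 1 - box 0 1"
          proof
            assume "y - a \<in> cbox 0 1 - box 0 1"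
            then have "a + (y - a) \<in> (\<lambda>x. a + x) ` (cbox 0 1 - box 0 1)" by (rule imageI)
            with elim show False by simp
          qed
          have "(\<lambda>m. (L ** ?b m) *v y) \<longlonglongrightarrow> (L ** L') *v y"
            by (intro tendsto_matrix_vector_mult tendsto_matrix_mult tendsto_const lim)
          then have "(\<lambda>m. L *v (?b m *v y)) \<longlonglongrightarrow> y"
            by (simp add: LL matrix_vector_mul_assoc)
          then show ?case
            by (intro tendsto_mult tendsto_const tile_wave_continuous_at ya)
        qed
        show "(\<lambda>y. ?\<phi> y * cnj (?p y)) \<in> borel_measurable lebesgue"
          using L2_spaceD[OF \<phi>L] by measurable
        show "(\<lambda>y. ?\<phi> (L *v (?b m *v y)) * cnj (?p y)) \<in> borel_measurable lebesgue" for m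
        proof -
          have "(\<lambda>y. f (?b m *v y)) \<in> borel_measurable lebesgue"
            by (rule measurable_matrix_comp[OF matrix_powi_invertible[OF A] L2_spaceD[OF fL]])
          then show ?thesis unfolding f_def by measurable
        qed
      qed
      qed
    qed
    with lim0 have "of_real (sqrt \<bar>det L'\<bar>) * (LINT y|lebesgue. ?\<phi> y * cnj (?p y)) = 0"
      unfolding inner by (rule LIMSEQ_unique[rotated])
    moreover have "det L' \<noteq> 0"
    proof
      assume "det L' = 0"
      then have "det (L ** L') = 0" by (simp add: det_mul)
      then show False by (simp add: LL)
    qed
    ultimately show ?thesis by (simp add: L2_inner_def)
  qed
  \<comment> \<open>All Fourier coefficients on the translated cube vanish, so by Parseval the
    generator vanishes almost everywhere there; countably many translates cover space.\<close>
  have ae: "AE x in lebesgue. x - a \<in> unit_cube \<longrightarrow> ?p x = 0" for a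
  proof -
    let ?K = "{x. x - a \<in> unit_cube}"
    have K: "lattice_tile ?K" by (rule lattice_tile_translate[OF lattice_tile_unit_cube])
    have "L2_inner ?p (tile_wave ?K k) = 0" for k
      by (subst L2_inner_cnj) (simp add: orth)
    then have "energy (\<lambda>x. ?p x * indicator ?K x) = 0"
      using tile_parseval[OF K pL] by simp
    then have "AE x in lebesgue. ennreal ((cmod (?p x * indicator ?K x))\<^sup>2) = 0"
      unfolding energy_def using L2_spaceD[OF L2_mult_indicator[OF pL lattice_tile_sets[OF K]]]
      by (subst (asm) nn_integral_0_iff_AE) auto
    then show ?thesis by eventually_elim (auto simp: indicator_def)
  qed
  have "AE x in lebesgue. \<forall>m. x - lattice_enum m \<in> unit_cube \<longrightarrow> ?p x = 0"
    unfolding AE_all_countable using ae by blast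
  then show ?thesis
  proof eventually_elim
    case (elim x)
    obtain k where k: "k \<in> integer_lattice" "x + k \<in> unit_cube"
      using lattice_tile_unit_cube unfolding lattice_tile_def by blast
    obtain m where "- k = lattice_enum m"
      using integer_lattice_uminus[OF k(1)] unfolding range_lattice_enum[symmetric] by (rule imageE)
    with k(2) have "x - lattice_enum m \<in> unit_cube" by (metis diff_minus_eq_add)
    with elim show ?case by blast
  qed
qed

section \<open>Assembling the equivalences\<close>

lemma similar_invertible:
  assumes "similar_matrix A (J :: real^'n^'n)" "invertible A"
  shows "invertible J"
  using assms by (auto simp: similar_matrix_def invertible_det_nz det_mul)

lemma similar_matrix_refl: "similar_matrix A A" for A :: "real^'n^'n"
proof -
  have "invertible (mat 1 :: real^'n^'n)" by (simp add: invertible_det_nz)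
  moreover have "matrix_inv (mat 1 :: real^'n^'n) = mat 1" by (rule matrix_inv_eqI) simp
  ultimately show ?thesis unfolding similar_matrix_def by (intro exI[of _ "mat 1"]) simp
qed

text \<open>Stated for any C similar to J, as it is applied to A and to J itself. Moving the lattice
  to Z^n conjugates C by B, which stays similar to J, and a tile for the transpose of J can be
  carried over.\<close>

lemma non_orthogonal_wavelets:
  fixes C J :: "real^'n^'n"
  assumes J: "real_jordan_matrix J" "\<not> orthogonal_matrix J" and C: "invertible C" "similar_matrix C J"
    and \<Gamma>: "full_rank_lattice \<Gamma>"
  shows "\<exists>\<psi>. orthonormal_wavelet C \<Gamma> \<infinity> \<psi>"
proof -
  obtain B :: "real^'n^'n" where B: "invertible B" "\<Gamma> = (\<lambda>k. B *v k) ` integer_lattice"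
    using \<Gamma> by (auto simp: full_rank_lattice_def)
  obtain P where P: "invertible P" "C = P ** J ** matrix_inv P" using C(2) by (auto simp: similar_matrix_def)
  have iJ: "invertible J" by (rule similar_invertible[OF C(2,1)])
  let ?D = "matrix_inv B ** C ** B" and ?R = "matrix_inv B ** P"
  have iB: "invertible (matrix_inv B)" by (rule invertible_matrix_inv[OF B(1)])
  have D: "invertible ?D" by (intro invertible_mult iB C B)
  have iR: "invertible ?R" by (intro invertible_mult iB P)
  have Rinv: "matrix_inv ?R = matrix_inv P ** B"
  proof (rule matrix_inv_eqI)
    have "?R ** (matrix_inv P ** B) = matrix_inv B ** (P ** matrix_inv P) ** B" by (simp only: matrix_mul_assoc)
    then show "?R ** (matrix_inv P ** B) = mat 1" by (simp add: matrix_inv_inverse[OF P(1)] matrix_inv_inverse[OF B(1)])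
  qed
  have DR: "?D = ?R ** J ** matrix_inv ?R"
    unfolding Rinv P(2) by (simp only: matrix_mul_assoc)
  \<comment> \<open>Transposing D = R J R^(-1) conjugates the transpose of J by the inverse
    transpose of R.\<close>
  let ?S = "transpose (matrix_inv ?R)"
  have S: "invertible ?S" by (intro transpose_invertible invertible_matrix_inv iR)
  have Sinv: "matrix_inv ?S = transpose ?R"
    by (rule matrix_inv_eqI) (simp add: matrix_transpose_mul[symmetric] matrix_inv_inverse[OF iR] transpose_mat del: transpose_matrix_vector)
  have "transpose ?D = ?S ** transpose J ** matrix_inv ?S"
    unfolding Sinv by (subst DR) (simp only: matrix_transpose_mul matrix_mul_assoc)
  then obtain W where "dilation_tile (transpose ?D) W" "large_balls W"
    using non_orthogonal_jordan_dilation_tile[OF J iJ] dilation_tile_similar[OF transpose_invertible[OF iJ] S] by blast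
  then obtain \<psi> where "orthonormal_wavelet ?D integer_lattice \<infinity> \<psi>"
    using dilation_tile_wavelet[OF D] by blast
  from orthonormal_wavelet_change_lattice[OF C(1) B(1) this] show ?thesis
    unfolding B(2) by blast
qed

lemma full_rank_integer_lattice: "full_rank_lattice (integer_lattice :: (real^'n) set)"
  unfolding full_rank_lattice_def
  by (intro exI[of _ "mat 1"]) (simp add: invertible_det_nz)

lemma bessel_wavelet_not_unitary:
  fixes A :: "real^'n^'n"
  assumes A: "invertible A" and \<psi>: "bessel_wavelet A integer_lattice 1 \<psi>" "\<not> (AE x in lebesgue. \<psi> 0 x = 0)"
  shows "\<not> (\<exists>U. unitary_matrix U \<and> similar_matrix (map_matrix complex_of_real A) U)"
proof
  assume "\<exists>U. unitary_matrix U \<and> similar_matrix (map_matrix complex_of_real A) U"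
  then obtain C where C: "\<And>j a b. \<bar>matrix_powi A j $ a $ b\<bar> \<le> C"
    using similar_unitary_powers_bounded[OF A] by metis
  from bounded_powers_no_bessel_wavelet[OF A C \<psi>(1)] \<psi>(2) show False by blast
qed

theorem theorem10:
  fixes A J :: "real^'n^'n"
  assumes "invertible A"
    and "real_jordan_form A J"
  defines "S1 \<equiv> \<forall>\<Gamma>. full_rank_lattice \<Gamma> \<longrightarrow> (\<exists>\<psi>. orthonormal_wavelet J \<Gamma> \<infinity> \<psi>)"
    and "S2 \<equiv> \<exists>\<psi>. orthonormal_wavelet A integer_lattice \<infinity> \<psi>"
    and "S3 \<equiv> \<forall>\<Gamma>. full_rank_lattice \<Gamma> \<longrightarrow> (\<exists>\<psi>. orthonormal_wavelet A \<Gamma> \<infinity> \<psi>)"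
    and "S4 \<equiv> \<exists>\<psi>. bessel_wavelet A integer_lattice 1 \<psi> \<and> \<not> (AE x in lebesgue. \<psi> 0 x = 0)"
    and "S5 \<equiv> \<not> orthogonal_matrix J"
    and "S6 \<equiv> \<not> (\<exists>U. unitary_matrix U \<and> similar_matrix (map_matrix complex_of_real A) U)"
  shows "(S1 \<longleftrightarrow> S2) \<and> (S2 \<longleftrightarrow> S3) \<and> (S3 \<longleftrightarrow> S4) \<and> (S4 \<longleftrightarrow> S5) \<and> (S5 \<longleftrightarrow> S6)"
proof -
  have J: "real_jordan_matrix J" and s: "similar_matrix A J"
    using assms(2) by (simp_all add: real_jordan_form_def)
  have iJ: "invertible J" by (rule similar_invertible[OF s assms(1)])
  have "S5 \<Longrightarrow> S1"
    unfolding S5_def S1_def using non_orthogonal_wavelets[OF J _ iJ similar_matrix_refl] by blast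
  moreover have "S5 \<Longrightarrow> S3"
    unfolding S5_def S3_def using non_orthogonal_wavelets[OF J _ assms(1) s] by blast
  moreover have "S3 \<Longrightarrow> S2"
    unfolding S3_def S2_def using full_rank_integer_lattice by blast
  moreover have "S2 \<Longrightarrow> S4"
    unfolding S2_def S4_def using orthonormal_wavelet_bessel[OF assms(1)] by blast
  moreover have "S4 \<Longrightarrow> S6"
    unfolding S4_def S6_def using bessel_wavelet_not_unitary[OF assms(1)] by blast
  moreover have "S6 \<Longrightarrow> S5"
    unfolding S6_def S5_def using orthogonal_similar_unitary[OF _ s] by blast
  \<comment> \<open>The remaining statements form a cycle starting from \<open>S5\<close>;
    \<open>S1\<close> is attached to it by applying the obstruction for bounded powers to J in place
    of A.\<close>
  moreover have "S1 \<Longrightarrow> S5"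
  proof -
    assume S1
    then obtain \<psi> where "orthonormal_wavelet J integer_lattice \<infinity> \<psi>"
      unfolding S1_def using full_rank_integer_lattice by blast
    then have "\<not> (\<exists>U. unitary_matrix U \<and> similar_matrix (map_matrix complex_of_real J) U)"
      using orthonormal_wavelet_bessel[OF iJ] bessel_wavelet_not_unitary[OF iJ] by blast
    then show S5
      unfolding S5_def using orthogonal_similar_unitary[OF _ similar_matrix_refl] by blast
  qed
  ultimately show ?thesis by blast
qed

end
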